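(* Let $q>0$ be real and let $n,d\ge1$. Let $C$ be the cascade of $n-1$ Pieri transforms on $V^{\otimes n}$ for $U_q(d)$, and let $W:V^{\otimes n}\to\bigoplus_{\lambda\vdash n,\ \ell(\lambda)\le d}V^\lambda\otimes R^\lambda$ be a (real) quantum Schur-Weyl transform for $U_q(d)\otimes H_q(n)$. Then $C$ agrees with $W$ up to signs: for every $\lambda\vdash n$ with $\ell(\lambda)\le d$, every $t\in\mathrm{SSYT}(\lambda,d)$ and every $S\in\mathrm{SYT}(\lambda)$, $$C^{-1}|\lambda,t,S\rangle=\pm\,W^{-1}|\lambda,t,S\rangle .$$
   Context: Quantum integers: $[m]=\frac{q^m-q^{-m}}{q-q^{-1}}$ (and $[m]=m$ for $q=1$). **Tableaux.** $\lambda\vdash n$ is a partition of $n$, and $\ell(\lambda)$ is its number of nonzero parts. $\mathrm{SSYT}(\lambda,d)$ is the set of semistandard tableaux of shape $\lambda$ with entries in $\{1,\dots,d\}$ (rows weakly increasing, columns strictly increasing). $\mathrm{SYT}(\lambda)$ is the set of standard tableaux. $\mathrm{sh}(t)$ is the shape of $t$. For a tableau $t$, $t^{(k)}$ is the tableau of boxes of $t$ with entries $\le k$. The residue of the box in row $i$, column $j$ is $j-i$. $\mu$ covers $\lambda$ if $\mu$ is obtained from $\lambda$ by adding one box. **Quantum group.** For real $q>0$, $U_q(d)=U_q(\mathfrak{gl}(d))$ has generators $e_i,f_i$ ($1\le i\le d-1$) and $q^{\pm h_i/2}$ ($1\le i\le d$). The $q^{\pm h_i/2}$ commute and are mutually inverse,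 and with $k_i=h_i-h_{i+1}$ the relations are: $q^{h_i/2}e_j=q^{(\delta_{ij}-\delta_{i,j+1})/2}e_jq^{h_i/2}$; $q^{h_i/2}f_j=q^{-(\delta_{ij}-\delta_{i,j+1})/2}f_jq^{h_i/2}$; $[e_i,f_j]=\delta_{ij}\frac{q^{k_i}-q^{-k_i}}{q-q^{-1}}$; $[e_i,e_j]=[f_i,f_j]=0$ for $|i-j|\ge2$; $[2]\,e_ie_{i\pm1}e_i=e_i^2e_{i\pm1}+e_{i\pm1}e_i^2$ and likewise for the $f_i$. The coproduct is $\Delta(q^{h_i/2})=q^{h_i/2}\otimes q^{h_i/2}$, $\Delta(e_i)=e_i\otimes q^{-k_i/2}+q^{k_i/2}\otimes e_i$, $\Delta(f_i)=f_i\otimes q^{-k_i/2}+q^{k_i/2}\otimes f_i$. The $*$-structure is $e_i^*=f_i$, $(q^{h_i/2})^*=q^{h_i/2}$. For $q=1$ read $U(\mathfrak{gl}(d))$ (equivalently the unitary group $U(d)$). $V=\mathbb C^d$ has orthonormal basis $v_1,\dots,v_d$ with $f_iv_i=v_{i+1}$, $e_iv_{i+1}=v_i$ (other values of $e_i,f_i$ on basis vectors being $0$), $q^{h_i/2}v_j=q^{\delta_{ij}/2}v_j$. For $\ell(\lambda)\le d$, $V^\lambda$ is the irreducible $*$-representation of highest weight $\lambda$ ($q^{h_i/2}$ acting on the highest weight vector by $q^{\lambda_i/2}$), so $V=V^{(1)}$. The word basis of $V^{\otimes n}$ is $|w\rangle=v_{w_1}\otimes\cdots\otimes v_{w_n}$,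 $w\in\{1,\dots,d\}^n$. **GTJ basis.** The Gelfand-Tsetlin-Jimbo basis $\{|v_t\rangle: t\in\mathrm{SSYT}(\lambda,d)\}$ of $V^\lambda$ is the orthonormal basis, unique up to one overall phase, such that for each $k\le d$, $|v_t\rangle$ lies in a copy of the irrep $V^{\mathrm{sh}(t^{(k)})}$ for the subalgebra $U_q(k)\subseteq U_q(d)$ generated by $e_i,f_i$ ($i<k$), $q^{\pm h_i/2}$ ($i\le k$), and such that all $e_i,f_i$ have nonnegative real matrix entries. For $V$ it is $v_1,\dots,v_d$. One such basis is fixed for each $V^\lambda$. **Hecke algebra.** $H_q(n)$ has generators $T_1,\dots,T_{n-1}$ with the braid relations ($T_iT_j=T_jT_i$ for $|i-j|>1$, $T_iT_{i+1}T_i=T_{i+1}T_iT_{i+1}$) and $(T_i-q^{-1})(T_i+q)=0$; $H_1(n)=\mathbb C[S(n)]$. Its irrep $R^\lambda$ ($\lambda\vdash n$) has orthonormal YYH (Young-Yamanouchi-Hoefsmit) basis $\{|r_S\rangle:S\in\mathrm{SYT}(\lambda)\}$ with $T_i|r_S\rangle=\frac{q^{-a}}{[a]}|r_S\rangle+\sqrt{1-\frac1{[a]^2}}\,|r_{s_iS}\rangle$, where $a$ is the residue of the box of $i+1$ in $S$ minus the residue of the box of $i$, and $s_iS$ is $S$ with $i,i+1$ interchanged (the last term is $0$ if $i,i+1$ are in the same row or column). $H_q(n)$ acts on $V^{\otimes n}$, commuting with $U_q(d)$: $T_i$ acts on tensor factors $i,i+1$ by $T(v_a\otimes v_b)=v_b\otimes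 v_a$ if $a<b$, $(q^{-1}-q)v_a\otimes v_b+v_b\otimes v_a$ if $a>b$, $q^{-1}v_a\otimes v_a$ if $a=b$. **Schur-Weyl transform.** A (real) quantum Schur-Weyl transform is a unitary isomorphism of $U_q(d)\otimes H_q(n)$-representations $V^{\otimes n}\to\bigoplus_{\lambda\vdash n,\ \ell(\lambda)\le d}V^\lambda\otimes R^\lambda$ with real matrix in the word basis and the bases $|v_t\rangle\otimes|r_S\rangle=|\lambda,t,S\rangle$. **Pieri transforms and cascade.** A Pieri transform for $\lambda$ is a unitary $U_q(d)$-isomorphism $V^\lambda\otimes V\to\bigoplus_{\mu}V^\mu$, sum over $\mu$ covering $\lambda$ with $\ell(\mu)\le d$, with real matrix in the bases $|v_t\rangle\otimes v_i$ and $|v_s\rangle$. It is unique up to a sign for each $\mu$; one is fixed for each $\lambda$. The cascade of $n-1$ Pieri transforms is the map $C=C_n$ from $V^{\otimes n}$ to the Hilbert space with orthonormal basis $|\lambda,t,S\rangle$ ($\lambda\vdash n$, $\ell(\lambda)\le d$, $t\in\mathrm{SSYT}(\lambda,d)$, $S\in\mathrm{SYT}(\lambda)$), defined by $C_1=\mathrm{id}$ and: $C_{k+1}$ applies $C_k$ to the first $k$ tensor factors, giving combinations of $|\lambda,t,S'\rangle$ with $\lambda\vdash k$, and then applies the Pieri transform for $\lambda$ to $|v_t\rangle\otimes v_i$ ($v_i$ in tensor factor $k+1$); a component $|v_s\rangle$ with $s$ of shape $\mu$ is recorded as $|\mu,s,S\rangle$, where $S\in\mathrm{SYT}(\mu)$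 is $S'$ with $k+1$ added in the box $\mu\setminus\lambda$. *)

theory Defs
  imports Complex_Main "HOL-Library.Nonpos_Ints"
begin

section \<open>Partitions and tableaux\<close>

definition qint :: "real \<Rightarrow> int \<Rightarrow> real" where
  "qint q m = (if q = 1 then real_of_int m else (q powi m - q powi (- m)) / (q - inverse q))"

definition partitions :: "nat \<Rightarrow> nat list set" where
  "partitions n = {lam. sorted_wrt (\<ge>) lam \<and> 0 \<notin> set lam \<and> sum_list lam = n}"

text \<open>Boxes are (row, column) pairs counted from 0; this does not affect residues.\<close>

definition boxes :: "nat list \<Rightarrow> (nat \<times> nat) set" where
  "boxes lam = {(i, j). i < length lam \<and> j < lam ! i}"

definition covers :: "nat list \<Rightarrow> nat list \<Rightarrow> bool" where
  "covers \<mu> lam \<longleftrightarrow> (\<exists>b. b \<notin> boxes lam \<and> boxes \<mu> = insert b (boxes lam))"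

text \<open>A tableau is the list of its rows, top row first.\<close>

type_synonym tableau = "nat list list"

definition shape :: "tableau \<Rightarrow> nat list" where
  "shape t = map length t"

definition SSYT :: "nat list \<Rightarrow> nat \<Rightarrow> tableau set" where
  "SSYT lam d = {t. shape t = lam \<and> set (concat t) \<subseteq> {1..d} \<and> (\<forall>r\<in>set t. sorted r) \<and>
     (\<forall>i j. Suc i < length t \<longrightarrow> j < length (t ! Suc i) \<longrightarrow> t ! i ! j < t ! Suc i ! j)}"

definition SYT :: "nat list \<Rightarrow> tableau set" where
  "SYT lam = {S \<in> SSYT lam (sum_list lam). distinct (concat S)}"

definition tab_le :: "nat \<Rightarrow> tableau \<Rightarrow> tableau" where
  "tab_le k t = filter (\<lambda>r. r \<noteq> []) (map (filter (\<lambda>x. x \<le> k)) t)"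

definition residue :: "tableau \<Rightarrow> nat \<Rightarrow> int" where
  "residue S x = (THE c. \<exists>i j. i < length S \<and> j < length (S ! i) \<and> S ! i ! j = x \<and> c = int j - int i)"

definition swap_entries :: "nat \<Rightarrow> tableau \<Rightarrow> tableau" where
  "swap_entries i S = map (map (id(i := Suc i, Suc i := i))) S"

text \<open>The tableau of shape \<open>\<mu>\<close> that agrees with \<open>S\<close> on the boxes of \<open>S\<close> and has entry
  \<open>x\<close> in the other boxes (in use: in the single box by which \<open>\<mu>\<close> exceeds the shape of \<open>S\<close>).\<close>

definition add_box :: "nat list \<Rightarrow> tableau \<Rightarrow> nat \<Rightarrow> tableau" where
  "add_box \<mu> S x =
     map (\<lambda>i. map (\<lambda>j. if (i, j) \<in> boxes (shape S) then S ! i ! j else x) [0..<\<mu> ! i]) [0..<length \<mu>]"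


section \<open>Matrices over finite index sets\<close>

text \<open>The Hilbert space with orthonormal basis indexed by a finite set \<open>B\<close> consists of the functions
  vanishing off \<open>B\<close>. A linear map from the space over \<open>B\<close> to the space over \<open>A\<close> is given by its
  matrix \<open>M\<close>, where \<open>M a b\<close> is the entry in row \<open>a \<in> A\<close> and column \<open>b \<in> B\<close>; values of
  \<open>M\<close> outside \<open>A \<times> B\<close> are irrelevant.\<close>

type_synonym ('a, 'b) cmat = "'a \<Rightarrow> 'b \<Rightarrow> complex"

definition mmul :: "('a, 'b) cmat \<Rightarrow> 'b set \<Rightarrow> ('b, 'c) cmat \<Rightarrow> ('a, 'c) cmat"
    ("(_ \<odot>\<^bsub>_\<^esub>/ _)" [70, 0, 71] 70) where
  "M \<odot>\<^bsub>B\<^esub> N = (\<lambda>a c. \<Sum>b\<in>B. M a b * N b c)"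

definition mone :: "('a, 'a) cmat" where
  "mone a b = (if a = b then 1 else 0)"

definition madj :: "('a, 'b) cmat \<Rightarrow> ('b, 'a) cmat" where
  "madj M = (\<lambda>b a. cnj (M a b))"

definition meq :: "'a set \<Rightarrow> 'b set \<Rightarrow> ('a, 'b) cmat \<Rightarrow> ('a, 'b) cmat \<Rightarrow> bool" where
  "meq A B M N \<longleftrightarrow> (\<forall>a\<in>A. \<forall>b\<in>B. M a b = N a b)"

definition inverse_mat :: "'a set \<Rightarrow> 'b set \<Rightarrow> ('a, 'b) cmat \<Rightarrow> ('b, 'a) cmat \<Rightarrow> bool" where
  "inverse_mat A B M N \<longleftrightarrow> meq A A (M \<odot>\<^bsub>B\<^esub> N) mone \<and> meq B B (N \<odot>\<^bsub>A\<^esub> M) mone"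

definition invertible_mat :: "'a set \<Rightarrow> 'b set \<Rightarrow> ('a, 'b) cmat \<Rightarrow> bool" where
  "invertible_mat A B M \<longleftrightarrow> (\<exists>N. inverse_mat A B M N)"

text \<open>If \<open>M\<close> is invertible, the entries of \<open>minv A B M\<close> with row in \<open>B\<close> and column in \<open>A\<close> are
  uniquely determined.\<close>

definition minv :: "'a set \<Rightarrow> 'b set \<Rightarrow> ('a, 'b) cmat \<Rightarrow> ('b, 'a) cmat" where
  "minv A B M = (SOME N. inverse_mat A B M N)"

definition unitary_mat :: "'a set \<Rightarrow> 'b set \<Rightarrow> ('a, 'b) cmat \<Rightarrow> bool" where
  "unitary_mat A B M \<longleftrightarrow> inverse_mat A B M (madj M)"

definition real_mat :: "'a set \<Rightarrow> 'b set \<Rightarrow> ('a, 'b) cmat \<Rightarrow> bool" where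
  "real_mat A B M \<longleftrightarrow> (\<forall>a\<in>A. \<forall>b\<in>B. M a b \<in> \<real>)"

definition vecs :: "'b set \<Rightarrow> ('b \<Rightarrow> complex) set" where
  "vecs B = {x. \<forall>b. b \<notin> B \<longrightarrow> x b = 0}"

definition mvec :: "'b set \<Rightarrow> ('b, 'b) cmat \<Rightarrow> ('b \<Rightarrow> complex) \<Rightarrow> 'b \<Rightarrow> complex" where
  "mvec B M x = (\<lambda>a. if a \<in> B then \<Sum>b\<in>B. M a b * x b else 0)"

definition basis_vec :: "'b \<Rightarrow> 'b \<Rightarrow> complex" where
  "basis_vec b = (\<lambda>a. if a = b then 1 else 0)"

definition subspace_of :: "'b set \<Rightarrow> ('b \<Rightarrow> complex) set \<Rightarrow> bool" where
  "subspace_of B X \<longleftrightarrow> X \<subseteq> vecs B \<and> (\<lambda>_. 0) \<in> X \<and>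
     (\<forall>x\<in>X. \<forall>y\<in>X. (\<lambda>b. x b + y b) \<in> X) \<and> (\<forall>c. \<forall>x\<in>X. (\<lambda>b. c * x b) \<in> X)"


section \<open>Representations of the quantum group\<close>

text \<open>The generators of \<open>U\<^sub>q(d)\<close> are \<open>e\<^sub>i\<close>, \<open>f\<^sub>i\<close>, and, for \<open>q \<noteq> 1\<close>, \<open>GenK i\<close> for \<open>q\<^bsup>h\<^sub>i/2\<^esup>\<close> and
  \<open>GenKinv i\<close> for its inverse. For \<open>q = 1\<close> the algebra is \<open>U(gl(d))\<close> and the Cartan generators are
  instead \<open>GenH i\<close> for \<open>h\<^sub>i\<close>. Values of a representation on generators outside \<open>uq_gens q d\<close> are
  irrelevant.\<close>

datatype gen = GenE nat | GenF nat | GenK nat | GenKinv nat | GenH nat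

definition uq_gens :: "real \<Rightarrow> nat \<Rightarrow> gen set" where
  "uq_gens q d = GenE ` {1..<d} \<union> GenF ` {1..<d} \<union>
     (if q = 1 then GenH ` {1..d} else GenK ` {1..d} \<union> GenKinv ` {1..d})"

type_synonym 'b rep = "gen \<Rightarrow> ('b, 'b) cmat"

text \<open>The exponent in \<open>q\<^bsup>h\<^sub>i\<^esup> e\<^sub>j = q\<^bsup>wt i j\<^esup> e\<^sub>j q\<^bsup>h\<^sub>i\<^esup>\<close>.\<close>

definition wt :: "nat \<Rightarrow> nat \<Rightarrow> real" where
  "wt i j = of_bool (i = j) - of_bool (i = Suc j)"

text \<open>The matrix of \<open>(q\<^bsup>k\<^sub>i\<^esup> - q\<^bsup>-k\<^sub>i\<^esup>) / (q - q\<^sup>-\<^sup>1)\<close>, which for \<open>q = 1\<close> is \<open>k\<^sub>i = h\<^sub>i - h\<^sub>i\<^sub>+\<^sub>1\<close>.\<close>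

definition qint_k :: "real \<Rightarrow> 'b set \<Rightarrow> 'b rep \<Rightarrow> nat \<Rightarrow> ('b, 'b) cmat" where
  "qint_k q B \<rho> i = (\<lambda>a b.
     if q = 1 then \<rho> (GenH i) a b - \<rho> (GenH (Suc i)) a b
     else ((\<rho> (GenK i) \<odot>\<^bsub>B\<^esub> \<rho> (GenK i) \<odot>\<^bsub>B\<^esub> \<rho> (GenKinv (Suc i)) \<odot>\<^bsub>B\<^esub> \<rho> (GenKinv (Suc i))) a b
         - (\<rho> (GenKinv i) \<odot>\<^bsub>B\<^esub> \<rho> (GenKinv i) \<odot>\<^bsub>B\<^esub> \<rho> (GenK (Suc i)) \<odot>\<^bsub>B\<^esub> \<rho> (GenK (Suc i))) a b)
         / complex_of_real (q - inverse q))"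

definition cartan_relations :: "real \<Rightarrow> nat \<Rightarrow> 'b set \<Rightarrow> 'b rep \<Rightarrow> bool" where
  "cartan_relations q d B \<rho> \<longleftrightarrow>
     (if q = 1 then
        (\<forall>i\<in>{1..d}. \<forall>j\<in>{1..d}. meq B B (\<rho> (GenH i) \<odot>\<^bsub>B\<^esub> \<rho> (GenH j)) (\<rho> (GenH j) \<odot>\<^bsub>B\<^esub> \<rho> (GenH i))) \<and>
        (\<forall>i\<in>{1..d}. \<forall>j\<in>{1..<d}. \<forall>a\<in>B. \<forall>b\<in>B.
           (\<rho> (GenH i) \<odot>\<^bsub>B\<^esub> \<rho> (GenE j)) a b - (\<rho> (GenE j) \<odot>\<^bsub>B\<^esub> \<rho> (GenH i)) a b
             = complex_of_real (wt i j) * \<rho> (GenE j) a b \<and>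
           (\<rho> (GenH i) \<odot>\<^bsub>B\<^esub> \<rho> (GenF j)) a b - (\<rho> (GenF j) \<odot>\<^bsub>B\<^esub> \<rho> (GenH i)) a b
             = - complex_of_real (wt i j) * \<rho> (GenF j) a b)
      else
        (\<forall>i\<in>{1..d}. inverse_mat B B (\<rho> (GenK i)) (\<rho> (GenKinv i))) \<and>
        (\<forall>i\<in>{1..d}. \<forall>j\<in>{1..d}. meq B B (\<rho> (GenK i) \<odot>\<^bsub>B\<^esub> \<rho> (GenK j)) (\<rho> (GenK j) \<odot>\<^bsub>B\<^esub> \<rho> (GenK i))) \<and>
        (\<forall>i\<in>{1..d}. \<forall>j\<in>{1..<d}. \<forall>a\<in>B. \<forall>b\<in>B.
           (\<rho> (GenK i) \<odot>\<^bsub>B\<^esub> \<rho> (GenE j)) a b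
             = complex_of_real (q powr (wt i j / 2)) * (\<rho> (GenE j) \<odot>\<^bsub>B\<^esub> \<rho> (GenK i)) a b \<and>
           (\<rho> (GenK i) \<odot>\<^bsub>B\<^esub> \<rho> (GenF j)) a b
             = complex_of_real (q powr (- wt i j / 2)) * (\<rho> (GenF j) \<odot>\<^bsub>B\<^esub> \<rho> (GenK i)) a b))"

definition ef_relations :: "real \<Rightarrow> nat \<Rightarrow> 'b set \<Rightarrow> 'b rep \<Rightarrow> bool" where
  "ef_relations q d B \<rho> \<longleftrightarrow>
     (\<forall>i\<in>{1..<d}. \<forall>j\<in>{1..<d}. \<forall>a\<in>B. \<forall>b\<in>B.
        (\<rho> (GenE i) \<odot>\<^bsub>B\<^esub> \<rho> (GenF j)) a b - (\<rho> (GenF j) \<odot>\<^bsub>B\<^esub> \<rho> (GenE i)) a b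
          = (if i = j then qint_k q B \<rho> i a b else 0))"

definition serre_relations :: "real \<Rightarrow> nat \<Rightarrow> 'b set \<Rightarrow> (nat \<Rightarrow> ('b, 'b) cmat) \<Rightarrow> bool" where
  "serre_relations q d B X \<longleftrightarrow>
     (\<forall>i\<in>{1..<d}. \<forall>j\<in>{1..<d}. i + 2 \<le> j \<longrightarrow> meq B B (X i \<odot>\<^bsub>B\<^esub> X j) (X j \<odot>\<^bsub>B\<^esub> X i)) \<and>
     (\<forall>i\<in>{1..<d}. \<forall>j\<in>{1..<d}. (j = Suc i \<or> i = Suc j) \<longrightarrow> (\<forall>a\<in>B. \<forall>b\<in>B.
        complex_of_real (qint q 2) * (X i \<odot>\<^bsub>B\<^esub> X j \<odot>\<^bsub>B\<^esub> X i) a b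
          = (X i \<odot>\<^bsub>B\<^esub> X i \<odot>\<^bsub>B\<^esub> X j) a b + (X j \<odot>\<^bsub>B\<^esub> X i \<odot>\<^bsub>B\<^esub> X i) a b))"

definition uq_rep :: "real \<Rightarrow> nat \<Rightarrow> 'b set \<Rightarrow> 'b rep \<Rightarrow> bool" where
  "uq_rep q d B \<rho> \<longleftrightarrow> cartan_relations q d B \<rho> \<and> ef_relations q d B \<rho> \<and>
     serre_relations q d B (\<lambda>i. \<rho> (GenE i)) \<and> serre_relations q d B (\<lambda>i. \<rho> (GenF i))"

definition uq_star_rep :: "real \<Rightarrow> nat \<Rightarrow> 'b set \<Rightarrow> 'b rep \<Rightarrow> bool" where
  "uq_star_rep q d B \<rho> \<longleftrightarrow> uq_rep q d B \<rho> \<and>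
     (\<forall>i\<in>{1..<d}. meq B B (madj (\<rho> (GenE i))) (\<rho> (GenF i))) \<and>
     (\<forall>i\<in>{1..d}. if q = 1 then meq B B (madj (\<rho> (GenH i))) (\<rho> (GenH i))
                 else meq B B (madj (\<rho> (GenK i))) (\<rho> (GenK i)))"

definition invariant_subspace :: "real \<Rightarrow> nat \<Rightarrow> 'b set \<Rightarrow> 'b rep \<Rightarrow> ('b \<Rightarrow> complex) set \<Rightarrow> bool" where
  "invariant_subspace q k B \<rho> X \<longleftrightarrow> subspace_of B X \<and> (\<forall>g\<in>uq_gens q k. \<forall>x\<in>X. mvec B (\<rho> g) x \<in> X)"

definition irreducible_subspace :: "real \<Rightarrow> nat \<Rightarrow> 'b set \<Rightarrow> 'b rep \<Rightarrow> ('b \<Rightarrow> complex) set \<Rightarrow> bool" where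
  "irreducible_subspace q k B \<rho> X \<longleftrightarrow> invariant_subspace q k B \<rho> X \<and> X \<noteq> {\<lambda>_. 0} \<and>
     (\<forall>Y. invariant_subspace q k B \<rho> Y \<and> Y \<subseteq> X \<longrightarrow> Y = {\<lambda>_. 0} \<or> Y = X)"

definition part :: "nat list \<Rightarrow> nat \<Rightarrow> nat" where
  "part \<nu> i = (if 1 \<le> i \<and> i \<le> length \<nu> then \<nu> ! (i - 1) else 0)"

definition highest_weight_vec ::
    "real \<Rightarrow> nat \<Rightarrow> 'b set \<Rightarrow> 'b rep \<Rightarrow> nat list \<Rightarrow> ('b \<Rightarrow> complex) \<Rightarrow> bool" where
  "highest_weight_vec q k B \<rho> \<nu> x \<longleftrightarrow> x \<in> vecs B \<and> x \<noteq> (\<lambda>_. 0) \<and>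
     (\<forall>i\<in>{1..<k}. mvec B (\<rho> (GenE i)) x = (\<lambda>_. 0)) \<and>
     (\<forall>i\<in>{1..k}. if q = 1 then mvec B (\<rho> (GenH i)) x = (\<lambda>b. of_nat (part \<nu> i) * x b)
        else mvec B (\<rho> (GenK i)) x = (\<lambda>b. complex_of_real (q powr (real (part \<nu> i) / 2)) * x b))"

text \<open>\<open>X\<close> is a copy of the irreducible representation of \<open>U\<^sub>q(k)\<close> of highest weight \<open>\<nu>\<close>,
  for the restriction of \<open>\<rho>\<close> to \<open>U\<^sub>q(k)\<close>.\<close>

definition copy_of_irrep :: "real \<Rightarrow> nat \<Rightarrow> 'b set \<Rightarrow> 'b rep \<Rightarrow> nat list \<Rightarrow> ('b \<Rightarrow> complex) set \<Rightarrow> bool" where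
  "copy_of_irrep q k B \<rho> \<nu> X \<longleftrightarrow> irreducible_subspace q k B \<rho> X \<and>
     (\<exists>x\<in>X. highest_weight_vec q k B \<rho> \<nu> x)"

definition vec_rep :: "real \<Rightarrow> nat rep" where
  "vec_rep q g a b = (case g of
       GenE i \<Rightarrow> if a = i \<and> b = Suc i then 1 else 0
     | GenF i \<Rightarrow> if a = Suc i \<and> b = i then 1 else 0
     | GenK i \<Rightarrow> if a = b then complex_of_real (q powr (of_bool (i = b) / 2)) else 0
     | GenKinv i \<Rightarrow> if a = b then complex_of_real (q powr (- of_bool (i = b) / 2)) else 0
     | GenH i \<Rightarrow> if a = b \<and> i = b then 1 else 0)"

text \<open>\<open>\<rho>\<close>, written as matrices indexed by \<open>SSYT lam d\<close>, is the irreducible \<open>*\<close>-representation of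
  highest weight \<open>lam\<close> in its Gelfand-Tsetlin-Jimbo basis. An overall phase of that basis does not
  change the matrices.\<close>

definition gtj_irrep :: "real \<Rightarrow> nat \<Rightarrow> nat list \<Rightarrow> tableau rep \<Rightarrow> bool" where
  "gtj_irrep q d lam \<rho> \<longleftrightarrow> (let B = SSYT lam d in
     uq_star_rep q d B \<rho> \<and>
     copy_of_irrep q d B \<rho> lam (vecs B) \<and>
     (\<forall>k\<in>{1..d}. \<forall>t\<in>B. \<exists>X. copy_of_irrep q k B \<rho> (shape (tab_le k t)) X \<and> basis_vec t \<in> X) \<and>
     (\<forall>i\<in>{1..<d}. \<forall>s\<in>B. \<forall>t\<in>B. \<rho> (GenE i) s t \<in> \<real>\<^sub>\<ge>\<^sub>0 \<and> \<rho> (GenF i) s t \<in> \<real>\<^sub>\<ge>\<^sub>0))"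

text \<open>The last conjunct is the identification of \<open>V\<^bsup>(1)\<^esup>\<close> with \<open>V\<close>, the basis vector of the
  one-box tableau with entry \<open>i\<close> being \<open>v\<^sub>i\<close>.\<close>

definition gtj_family :: "real \<Rightarrow> nat \<Rightarrow> (nat list \<Rightarrow> tableau rep) \<Rightarrow> bool" where
  "gtj_family q d V \<longleftrightarrow>
     (\<forall>m. \<forall>lam\<in>partitions m. length lam \<le> d \<longrightarrow> gtj_irrep q d lam (V lam)) \<and>
     (\<forall>g\<in>uq_gens q d. \<forall>i\<in>{1..d}. \<forall>j\<in>{1..d}. V [1] g [[i]] [[j]] = vec_rep q g i j)"

text \<open>The matrices of \<open>q\<^bsup>k\<^sub>i/2\<^esup>\<close> and \<open>q\<^bsup>-k\<^sub>i/2\<^esup>\<close>.\<close>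

definition k_half :: "real \<Rightarrow> 'b set \<Rightarrow> 'b rep \<Rightarrow> nat \<Rightarrow> ('b, 'b) cmat" where
  "k_half q B \<rho> i = (if q = 1 then mone else \<rho> (GenK i) \<odot>\<^bsub>B\<^esub> \<rho> (GenKinv (Suc i)))"

definition k_half_inv :: "real \<Rightarrow> 'b set \<Rightarrow> 'b rep \<Rightarrow> nat \<Rightarrow> ('b, 'b) cmat" where
  "k_half_inv q B \<rho> i = (if q = 1 then mone else \<rho> (GenKinv i) \<odot>\<^bsub>B\<^esub> \<rho> (GenK (Suc i)))"

definition kron :: "('a, 'b) cmat \<Rightarrow> ('c, 'd) cmat \<Rightarrow> ('a \<times> 'c, 'b \<times> 'd) cmat" where
  "kron M N = (\<lambda>(a, c) (b, d). M a b * N c d)"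

definition tensor_rep :: "real \<Rightarrow> 'a set \<Rightarrow> 'a rep \<Rightarrow> 'b set \<Rightarrow> 'b rep \<Rightarrow> ('a \<times> 'b) rep" where
  "tensor_rep q A \<rho> B \<sigma> g x y = (case g of
       GenE i \<Rightarrow> kron (\<rho> g) (k_half_inv q B \<sigma> i) x y + kron (k_half q A \<rho> i) (\<sigma> g) x y
     | GenF i \<Rightarrow> kron (\<rho> g) (k_half_inv q B \<sigma> i) x y + kron (k_half q A \<rho> i) (\<sigma> g) x y
     | GenK i \<Rightarrow> kron (\<rho> g) (\<sigma> g) x y
     | GenKinv i \<Rightarrow> kron (\<rho> g) (\<sigma> g) x y
     | GenH i \<Rightarrow> kron (\<rho> g) mone x y + kron mone (\<sigma> g) x y)"

definition words :: "nat \<Rightarrow> nat \<Rightarrow> nat list set" where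
  "words d n = {w. length w = n \<and> set w \<subseteq> {1..d}}"

definition trivial_rep :: "'b rep" where
  "trivial_rep g a b = (case g of GenK i \<Rightarrow> mone a b | GenKinv i \<Rightarrow> mone a b | _ \<Rightarrow> 0)"

text \<open>The action on the \<open>n\<close>-fold tensor power of \<open>V\<close> in the word basis; a word \<open>w\<close> of length
  \<open>n + 1\<close> stands for the tensor product of \<open>butlast w\<close> and \<open>last w\<close>. By coassociativity the
  bracketing does not matter.\<close>

primrec word_rep :: "real \<Rightarrow> nat \<Rightarrow> nat \<Rightarrow> nat list rep" where
  "word_rep q d 0 = trivial_rep"
| "word_rep q d (Suc n) = (\<lambda>g u w.
     tensor_rep q (words d n) (word_rep q d n) {1..d} (vec_rep q) g (butlast u, last u) (butlast w, last w))"

text \<open>\<open>M\<close>, from the space over \<open>B\<close> carrying \<open>\<sigma>\<close> to the space over \<open>A\<close> carrying \<open>\<rho>\<close>,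
  commutes with the action of \<open>U\<^sub>q(d)\<close>.\<close>

definition uq_intertwiner ::
    "real \<Rightarrow> nat \<Rightarrow> 'a set \<Rightarrow> 'a rep \<Rightarrow> 'b set \<Rightarrow> 'b rep \<Rightarrow> ('a, 'b) cmat \<Rightarrow> bool" where
  "uq_intertwiner q d A \<rho> B \<sigma> M \<longleftrightarrow>
     (\<forall>g\<in>uq_gens q d. meq A B (M \<odot>\<^bsub>B\<^esub> \<sigma> g) (\<rho> g \<odot>\<^bsub>A\<^esub> M))"


section \<open>The Hecke algebra\<close>

definition hecke_word :: "real \<Rightarrow> nat \<Rightarrow> (nat list, nat list) cmat" where
  "hecke_word q i u w = (let a = w ! (i - 1); b = w ! i; w' = w[i - 1 := b, i := a] in
     if a < b then mone u w'
     else if a > b then complex_of_real (inverse q - q) * mone u w + mone u w'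
     else complex_of_real (inverse q) * mone u w)"

text \<open>The matrix of \<open>T\<^sub>i\<close> in the Young-Yamanouchi-Hoefsmit basis. If \<open>i\<close> and \<open>i + 1\<close> are in the
  same row or column of \<open>S\<close>, then \<open>swap_entries i S\<close> is not standard, and the coefficient vanishes
  as well.\<close>

definition yyh :: "real \<Rightarrow> nat \<Rightarrow> (tableau, tableau) cmat" where
  "yyh q i S' S = (let a = residue S (Suc i) - residue S i in
     complex_of_real (q powi (- a) / qint q a) * mone S' S
     + complex_of_real (sqrt (1 - 1 / (qint q a)\<^sup>2)) * mone S' (swap_entries i S))"


section \<open>Schur-Weyl and Pieri transforms\<close>

type_synonym sw_label = "nat list \<times> tableau \<times> tableau"

definition sw_index :: "nat \<Rightarrow> nat \<Rightarrow> sw_label set" where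
  "sw_index d n = {(lam, t, S). lam \<in> partitions n \<and> length lam \<le> d \<and> t \<in> SSYT lam d \<and> S \<in> SYT lam}"

definition sw_uq :: "(nat list \<Rightarrow> tableau rep) \<Rightarrow> sw_label rep" where
  "sw_uq V g = (\<lambda>(lam, t, S) (lam', t', S'). if lam = lam' \<and> S = S' then V lam g t t' else 0)"

definition sw_hecke :: "real \<Rightarrow> nat \<Rightarrow> (sw_label, sw_label) cmat" where
  "sw_hecke q i = (\<lambda>(lam, t, S) (lam', t', S'). if lam = lam' \<and> t = t' then yyh q i S S' else 0)"

definition schur_weyl_transform ::
    "real \<Rightarrow> nat \<Rightarrow> nat \<Rightarrow> (nat list \<Rightarrow> tableau rep) \<Rightarrow> (sw_label, nat list) cmat \<Rightarrow> bool" where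
  "schur_weyl_transform q d n V W \<longleftrightarrow>
     unitary_mat (sw_index d n) (words d n) W \<and>
     real_mat (sw_index d n) (words d n) W \<and>
     uq_intertwiner q d (sw_index d n) (sw_uq V) (words d n) (word_rep q d n) W \<and>
     (\<forall>i\<in>{1..<n}. meq (sw_index d n) (words d n)
        (W \<odot>\<^bsub>words d n\<^esub> hecke_word q i) (sw_hecke q i \<odot>\<^bsub>sw_index d n\<^esub> W))"

text \<open>The basis of the direct sum of the \<open>V\<^bsup>\<mu>\<^esup>\<close> is indexed by tableaux alone, since a tableau
  determines its shape \<open>\<mu>\<close>.\<close>

definition pieri_index :: "nat \<Rightarrow> nat list \<Rightarrow> tableau set" where
  "pieri_index d lam =
     {s. \<exists>\<mu>\<in>partitions (Suc (sum_list lam)). covers \<mu> lam \<and> length \<mu> \<le> d \<and> s \<in> SSYT \<mu> d}"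

definition pieri_uq :: "(nat list \<Rightarrow> tableau rep) \<Rightarrow> tableau rep" where
  "pieri_uq V g s s' = (if shape s = shape s' then V (shape s) g s s' else 0)"

definition pieri_transform ::
    "real \<Rightarrow> nat \<Rightarrow> (nat list \<Rightarrow> tableau rep) \<Rightarrow> nat list \<Rightarrow> (tableau, tableau \<times> nat) cmat \<Rightarrow> bool" where
  "pieri_transform q d V lam P \<longleftrightarrow> (let A = pieri_index d lam; B = SSYT lam d \<times> {1..d} in
     unitary_mat A B P \<and> real_mat A B P \<and>
     uq_intertwiner q d A (pieri_uq V) B (tensor_rep q (SSYT lam d) (V lam) {1..d} (vec_rep q)) P)"

text \<open>\<open>cascade d P m\<close> is the cascade of \<open>m\<close> Pieri transforms, acting on \<open>m + 1\<close> tensor factors.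
  For \<open>m = 0\<close> it is the identity: the word with single letter \<open>i\<close> is sent to the one-box tableau
  with entry \<open>i\<close>, whose list of rows has that word as its only element.\<close>

primrec cascade ::
    "nat \<Rightarrow> (nat list \<Rightarrow> (tableau, tableau \<times> nat) cmat) \<Rightarrow> nat \<Rightarrow> (sw_label, nat list) cmat" where
  "cascade d P 0 = (\<lambda>(lam, t, S) w. if lam = [1] \<and> t = [w] \<and> S = [[1]] then 1 else 0)"
| "cascade d P (Suc m) = (\<lambda>(\<mu>, s, S) w. \<Sum>(lam, t, S')\<in>sw_index d (Suc m).
     if covers \<mu> lam \<and> S = add_box \<mu> S' (m + 2)
     then P lam s (t, last w) * cascade d P m (lam, t, S') (butlast w) else 0)"

end

theory Submission
  imports Defs "HOL-Library.Multiset"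
begin

text \<open>
  The matrix \<open>M = C W\<^sup>T\<close> is a real unitary intertwiner for \<open>U\<^sub>q(d)\<close>, so by Schur's lemma it is a direct
  sum of matrices \<open>1 \<otimes> m\<close>, one for each \<open>\<lambda>\<close>, and it suffices to show that each \<open>m\<close> is diagonal, which
  can be read off on highest weight vectors. Order words by their prefix contents (the Bruhat order),
  and attach to a standard tableau \<open>S\<close> the word of the rows of \<open>1, 2, \<dots>, n\<close> in \<open>S\<close>. Since the
  \<open>k\<close>-th stage of the cascade lands in an irreducible representation whose highest weight is the shape
  of the first \<open>k\<close> boxes of \<open>S\<close>, the row of \<open>C\<close> with index \<open>S\<close> is supported on words below the row
  word of \<open>S\<close>. The Hecke action shows the same for \<open>W\<close>, with a nonzero entry at the row word
  itself. Hence \<open>m\<close> is triangular, and a real unitary triangular matrix is diagonal with entries \<open>\<plusminus>1\<close>.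
\<close>

section \<open>Tableaux\<close>

text \<open>The Pieri transforms know only \<open>U_q(d)\<close>, so their definition does not show
  how the Hecke algebra acts on the labels of the cascade. No Hecke equivariance of \<open>C\<close>
  is established on the way: only the letters that can occur in a prefix are read off from
  \<open>C\<close>, and all Hecke relations are applied to \<open>W\<close>. One order has to serve
  both sides: it may see nothing of the cascade but weights of prefixes, and it must be compatible
  with exchanging neighbouring letters, which is what \<open>T_i\<close> does. Highest weight rows
  suffice because the matrix \<open>m\<close> is the same for all \<open>t\<close>; their words also
  share the letter sum of the row words, which pins down the leading coefficient. That coefficient
  is carried from tableau to tableau through the factor \<open>sqrt (1 - 1/[a]^2)\<close>, nonzero
  because \<open>[m] > 1\<close> for \<open>m \<ge> 2\<close> and every real \<open>q > 0\<close>.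
  The signs are inherent, since each Pieri transform is itself fixed only up to signs.\<close>

definition entry :: "tableau \<Rightarrow> nat \<times> nat \<Rightarrow> nat" where
  "entry t b = t ! fst b ! snd b"

lemma boxes_Nil [simp]: "boxes [] = {}"
  by (simp add: boxes_def)

lemma boxes_Cons: "boxes (a # l) = (Pair 0 ` {..<a}) \<union> (\<lambda>(i, j). (Suc i, j)) ` boxes l"
proof -
  have "(i, j) \<in> boxes (a # l) \<longleftrightarrow> (i, j) \<in> (Pair 0 ` {..<a}) \<union> (\<lambda>(i, j). (Suc i, j)) ` boxes l" for i j
    by (cases i) (auto simp: boxes_def image_iff)
  then show ?thesis by (intro set_eqI) (metis surj_pair)
qed

lemma finite_boxes [simp]: "finite (boxes l)"
  by (induction l) (auto simp: boxes_Cons)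

text \<open>The bridge from lists of rows to functions on boxes: length, letter sum, distinctness
  and content of a tableau are all derived from this identity.\<close>

lemma mset_concat_boxes: "mset (concat t) = image_mset (entry t) (mset_set (boxes (shape t)))"
proof (induction t)
  case Nil
  then show ?case by (simp add: shape_def)
next
  case (Cons r t)
  have inj: "inj_on (\<lambda>(i, j). (Suc i, j)) X" for X :: "(nat \<times> nat) set"
    by (auto simp: inj_on_def)
  have row: "mset r = image_mset (entry (r # t)) (mset_set (Pair 0 ` {..<length r}))"
  proof -
    have "mset r = mset (map ((!) r) [0..<length r])" by (simp only: map_nth)
    also have "\<dots> = image_mset ((!) r) (mset_set {..<length r})"
      by (simp add: mset_map lessThan_atLeast0)
    also have "\<dots> = image_mset (entry (r # t)) (image_mset (Pair 0) (mset_set {..<length r}))"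
      by (simp add: multiset.map_comp comp_def entry_def)
    also have "image_mset (Pair 0) (mset_set {..<length r}) = mset_set (Pair 0 ` {..<length r})"
      by (rule image_mset_mset_set) (simp add: inj_on_def)
    finally show ?thesis .
  qed
  have rest: "image_mset (entry t) (mset_set (boxes (shape t)))
      = image_mset (entry (r # t)) (mset_set ((\<lambda>(i, j). (Suc i, j)) ` boxes (shape t)))"
  proof -
    have "entry (r # t) \<circ> (\<lambda>(i, j). (Suc i, j)) = entry t"
      by (auto simp: fun_eq_iff entry_def)
    then show ?thesis
      by (simp add: image_mset_mset_set [OF inj, symmetric] multiset.map_comp)
  qed
  have dis: "Pair 0 ` {..<length r} \<inter> (\<lambda>(i, j). (Suc i, j)) ` boxes (shape t) = {}"
    by auto
  have "shape (r # t) = length r # shape t" by (simp add: shape_def)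
  then show ?case
    using Cons row rest dis by (simp add: boxes_Cons mset_set_Union)
qed

lemma set_concat_boxes: "set (concat t) = entry t ` boxes (shape t)"
  by (metis mset_concat_boxes set_mset_mset set_image_mset finite_set_mset_mset_set finite_boxes)

lemma length_concat_boxes: "length (concat t) = card (boxes (shape t))"
  by (metis mset_concat_boxes size_mset size_image_mset size_mset_set)

lemma sum_list_shape: "sum_list (shape t) = length (concat t)"
  by (simp add: shape_def length_concat)

lemma card_boxes: "card (boxes l) = sum_list l"
proof -
  have "shape (map (\<lambda>k. replicate k (0 :: nat)) l) = l"
    by (simp add: shape_def comp_def)
  then show ?thesis
    using length_concat_boxes [of "map (\<lambda>k. replicate k 0) l"]
      sum_list_shape [of "map (\<lambda>k. replicate k 0) l"] by metis
qed

lemma distinct_concat_boxes: "distinct (concat t) \<longleftrightarrow> inj_on (entry t) (boxes (shape t))"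
  by (metis card_distinct distinct_card finite_boxes inj_on_iff_eq_card length_concat_boxes set_concat_boxes)

lemma sum_list_concat: "sum_list (concat t) = (\<Sum>b\<in>boxes (shape t). entry t b)"
proof -
  have "sum_list (concat t) = sum_mset (mset (concat t))" by (rule sum_mset_sum_list [symmetric])
  then show ?thesis unfolding mset_concat_boxes by (simp add: sum_unfold_sum_mset)
qed

lemma size_filter_concat:
  "size (filter_mset Q (mset (concat t))) = card {b \<in> boxes (shape t). Q (entry t b)}"
  unfolding mset_concat_boxes by (simp add: filter_mset_image_mset)

section \<open>Partitions, their diagrams and semistandard fillings\<close>

lemma partition_nth_mono:
  assumes "lam \<in> partitions n" "i \<le> i'" "i' < length lam"
  shows "lam ! i' \<le> lam ! i"
  using assms by (cases "i = i'") (auto simp: partitions_def sorted_wrt_iff_nth_less)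

lemma partition_nth_pos:
  assumes "lam \<in> partitions n" "i < length lam"
  shows "0 < lam ! i"
  using assms by (auto simp: partitions_def) (metis gr0I nth_mem)

lemma partitions_sum: "lam \<in> partitions n \<Longrightarrow> sum_list lam = n"
  by (simp add: partitions_def)

lemma boxes_down_closed:
  assumes "lam \<in> partitions n" "(i', j') \<in> boxes lam" "i \<le> i'" "j \<le> j'"
  shows "(i, j) \<in> boxes lam"
  using partition_nth_mono [OF assms(1,3)] assms by (auto simp: boxes_def)

lemma partition_eqI:
  assumes "lam \<in> partitions n" "\<mu> \<in> partitions m" "boxes lam = boxes \<mu>"
  shows "lam = \<mu>"
proof -
  have in_iff: "(i < length lam \<and> j < lam ! i) = (i < length \<mu> \<and> j < \<mu> ! i)" for i j
    using assms(3) by (auto simp: boxes_def set_eq_iff)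
  \<comment> \<open>Parts are positive, so a row exists exactly when it has a box in column
    0.\<close>
  have *: "i < length lam \<longleftrightarrow> i < length \<mu>" for i
    using in_iff [of i 0] partition_nth_pos [OF assms(1), of i] partition_nth_pos [OF assms(2), of i]
    by blast
  then have len: "length lam = length \<mu>" by (meson nat_neq_iff)
  show ?thesis
  proof (rule nth_equalityI [OF len])
    fix i assume "i < length lam"
    then have "j < lam ! i \<longleftrightarrow> j < \<mu> ! i" for j using in_iff [of i j] len by auto
    then show "lam ! i = \<mu> ! i" by (meson nat_neq_iff)
  qed
qed

lemma tableau_eqI:
  assumes "shape s = shape t" "\<And>b. b \<in> boxes (shape s) \<Longrightarrow> entry s b = entry t b"
  shows "s = t"
proof (rule nth_equalityI)
  show len: "length s = length t" using assms(1) by (metis length_map shape_def)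
  fix i assume i: "i < length s"
  have "map length s ! i = map length t ! i" using assms(1) by (simp add: shape_def)
  then have len': "length (s ! i) = length (t ! i)" using i len by simp
  show "s ! i = t ! i"
  proof (rule nth_equalityI [OF len'])
    fix j assume "j < length (s ! i)"
    then show "s ! i ! j = t ! i ! j"
      using assms(2) [of "(i, j)"] i by (simp add: boxes_def shape_def entry_def)
  qed
qed

lemma finite_partitions [simp]: "finite (partitions n)"
proof (rule finite_subset)
  show "partitions n \<subseteq> {lam. set lam \<subseteq> {..n} \<and> length lam \<le> n}"
  proof
    fix lam assume lam: "lam \<in> partitions n"
    have "length lam \<le> sum_list lam"
      using lam unfolding partitions_def
      by (induction lam arbitrary: n) (auto simp: Suc_le_eq)
    moreover have "x \<le> sum_list lam" if "x \<in> set lam" for x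
      using that by (intro member_le_sum_list) auto
    ultimately show "lam \<in> {lam. set lam \<subseteq> {..n} \<and> length lam \<le> n}"
      using lam by (auto simp: partitions_def)
  qed
qed (rule finite_lists_length_le, simp)

lemma finite_SSYT [simp]: "finite (SSYT lam d)"
proof (rule finite_subset)
  let ?R = "{r. set r \<subseteq> {1..d} \<and> length r \<le> sum_list lam}"
  show "SSYT lam d \<subseteq> {t. set t \<subseteq> ?R \<and> length t = length lam}"
  proof
    fix t assume t: "t \<in> SSYT lam d"
    then have sh: "map length t = lam" by (simp add: SSYT_def shape_def)
    have "r \<in> ?R" if r: "r \<in> set t" for r
    proof -
      have "length r \<in> set lam" using r sh by auto
      then have "length r \<le> sum_list lam" by (intro member_le_sum_list) auto
      then show ?thesis using t r by (auto simp: SSYT_def)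
    qed
    then show "t \<in> {t. set t \<subseteq> ?R \<and> length t = length lam}" using sh by auto
  qed
  show "finite {t. set t \<subseteq> ?R \<and> length t = length lam}"
    by (intro finite_lists_length_eq finite_lists_length_le) simp
qed

lemma finite_SYT [simp]: "finite (SYT lam)"
  by (simp add: SYT_def)

lemma SSYT_shape: "t \<in> SSYT lam d \<Longrightarrow> shape t = lam"
  by (simp add: SSYT_def)

lemma SSYT_D:
  assumes "t \<in> SSYT lam d" "(i, j) \<in> boxes lam"
  shows "i < length t" "j < length (t ! i)"
  using assms by (auto simp: SSYT_def boxes_def shape_def)

lemma SSYT_I:
  assumes "shape t = lam" "\<And>b. b \<in> boxes lam \<Longrightarrow> entry t b \<in> {1..d}"
    and row: "\<And>i j j'. (i, j') \<in> boxes lam \<Longrightarrow> j < j' \<Longrightarrow> entry t (i, j) \<le> entry t (i, j')"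
    and col: "\<And>i j. (Suc i, j) \<in> boxes lam \<Longrightarrow> entry t (i, j) < entry t (Suc i, j)"
  shows "t \<in> SSYT lam d"
proof -
  have "sorted r" if "r \<in> set t" for r
  proof -
    obtain i where "i < length t" "r = t ! i" using \<open>r \<in> set t\<close> by (metis in_set_conv_nth)
    then show ?thesis using row [of i] assms(1)
      by (auto simp: sorted_wrt_iff_nth_less boxes_def shape_def entry_def)
  qed
  moreover have "set (concat t) \<subseteq> {1..d}"
    using assms(1,2) set_concat_boxes by auto
  ultimately show ?thesis using col assms(1)
    by (auto simp: SSYT_def boxes_def shape_def entry_def)
qed

lemma SSYT_entry_range: "t \<in> SSYT lam d \<Longrightarrow> b \<in> boxes lam \<Longrightarrow> entry t b \<in> {1..d}"
  using set_concat_boxes [of t] by (auto simp: SSYT_def)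

lemma SSYT_row_mono:
  assumes "t \<in> SSYT lam d" "(i, j') \<in> boxes lam" "j \<le> j'"
  shows "entry t (i, j) \<le> entry t (i, j')"
proof -
  have "sorted (t ! i)" "j' < length (t ! i)"
    using assms SSYT_D [OF assms(1,2)] by (auto simp: SSYT_def)
  then show ?thesis using assms(3) by (auto simp: entry_def intro: sorted_nth_mono)
qed

lemma SSYT_col_strict:
  assumes "t \<in> SSYT lam d" "lam \<in> partitions n" "(i', j) \<in> boxes lam" "i < i'"
  shows "entry t (i, j) < entry t (i', j)"
  using assms(4,3)
proof (induction i')
  case (Suc i')
  have 1: "entry t (i', j) < entry t (Suc i', j)"
    using assms(1) SSYT_D [OF assms(1) Suc.prems(2)] by (auto simp: SSYT_def entry_def)
  have 2: "(i', j) \<in> boxes lam" by (rule boxes_down_closed [OF assms(2) Suc.prems(2)]) auto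
  show ?case
    using 1 Suc.IH [OF _ 2] Suc.prems(1) by (cases "i = i'") auto
qed simp

text \<open>Columns increase strictly and start at 1 or more. This inequality is the source of every
  dominance statement below, for highest weights as well as for prefix counts.\<close>

lemma SSYT_entry_ge_row:
  assumes "t \<in> SSYT lam d" "lam \<in> partitions n" "(i, j) \<in> boxes lam"
  shows "Suc i \<le> entry t (i, j)"
  using assms(3)
proof (induction i)
  case 0
  then show ?case using SSYT_entry_range [OF assms(1), of "(0, j)"] by simp
next
  case (Suc i)
  have "(i, j) \<in> boxes lam" by (rule boxes_down_closed [OF assms(2) Suc.prems]) auto
  then show ?case
    using Suc SSYT_col_strict [OF assms(1,2) Suc.prems, of i] by fastforce
qed

section \<open>The tableau of highest weight and its extremality\<close>

definition hw_tableau :: "nat list \<Rightarrow> tableau" where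
  "hw_tableau lam = map (\<lambda>i. replicate (lam ! i) (Suc i)) [0..<length lam]"

lemma shape_hw_tableau [simp]: "shape (hw_tableau lam) = lam"
  by (auto simp: shape_def hw_tableau_def intro: nth_equalityI)

lemma entry_hw_tableau: "(i, j) \<in> boxes lam \<Longrightarrow> entry (hw_tableau lam) (i, j) = Suc i"
  by (simp add: entry_def hw_tableau_def boxes_def)

lemma hw_tableau_SSYT:
  assumes "lam \<in> partitions n" "length lam \<le> d"
  shows "hw_tableau lam \<in> SSYT lam d"
proof (rule SSYT_I)
  show "entry (hw_tableau lam) b \<in> {1..d}" if "b \<in> boxes lam" for b
    using that assms(2) entry_hw_tableau [of "fst b" "snd b" lam] by (auto simp: boxes_def)
  fix i j j' assume "(i, j') \<in> boxes lam" "j < j'"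
  moreover from this have "(i, j) \<in> boxes lam" by (auto simp: boxes_def)
  ultimately show "entry (hw_tableau lam) (i, j) \<le> entry (hw_tableau lam) (i, j')"
    by (simp add: entry_hw_tableau)
next
  fix i j assume *: "(Suc i, j) \<in> boxes lam"
  have "(i, j) \<in> boxes lam" by (rule boxes_down_closed [OF assms(1) *]) auto
  with * show "entry (hw_tableau lam) (i, j) < entry (hw_tableau lam) (Suc i, j)"
    by (simp add: entry_hw_tableau)
qed simp

lemma sum_concat_ge_hw:
  assumes "t \<in> SSYT lam d" "lam \<in> partitions n"
  shows "sum_list (concat (hw_tableau lam)) \<le> sum_list (concat t)"
  unfolding sum_list_concat using SSYT_shape [OF assms(1)] SSYT_entry_ge_row [OF assms]
  by (auto intro!: sum_mono simp: entry_hw_tableau)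

text \<open>Each entry is at least the corresponding one of \<open>hw_tableau lam\<close>, so equal
  letter sums force equality box by box. The letter sum thus stands in for the dominance order on
  weights.\<close>

lemma hw_tableau_unique:
  assumes "t \<in> SSYT lam d" "lam \<in> partitions n"
    and "sum_list (concat t) \<le> sum_list (concat (hw_tableau lam))"
  shows "t = hw_tableau lam"
proof (rule tableau_eqI)
  show sh: "shape t = shape (hw_tableau lam)" using SSYT_shape [OF assms(1)] by simp
  fix b assume b: "b \<in> boxes (shape t)"
  have le: "entry (hw_tableau lam) b \<le> entry t b" if "b \<in> boxes lam" for b
    using that SSYT_entry_ge_row [OF assms(1,2), of "fst b" "snd b"]
      entry_hw_tableau [of "fst b" "snd b" lam] by simp
  have "(\<Sum>b\<in>boxes lam. entry (hw_tableau lam) b) = (\<Sum>b\<in>boxes lam. entry t b)"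
    using assms(3) sum_concat_ge_hw [OF assms(1,2)] SSYT_shape [OF assms(1)]
    by (simp add: sum_list_concat)
  then show "entry t b = entry (hw_tableau lam) b"
    using sum_mono_inv [of "entry (hw_tableau lam)" "boxes lam" "entry t" b] le b
      SSYT_shape [OF assms(1)] by simp
qed

lemma count_hw_tableau:
  "count (mset (concat (hw_tableau lam))) (Suc i) = (if i < length lam then lam ! i else 0)"
proof -
  have "count (mset (concat (hw_tableau lam))) (Suc i)
      = size (filter_mset (\<lambda>x. x = Suc i) (mset (concat (hw_tableau lam))))"
    by (simp only: filter_eq_replicate_mset size_replicate_mset)
  also have "\<dots> = card {b \<in> boxes lam. entry (hw_tableau lam) b = Suc i}"
    by (simp only: size_filter_concat shape_hw_tableau)
  also have "{b \<in> boxes lam. entry (hw_tableau lam) b = Suc i}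
      = (if i < length lam then Pair i ` {..<lam ! i} else {})"
  proof -
    have "entry (hw_tableau lam) b = Suc (fst b)" if "b \<in> boxes lam" for b
      using that entry_hw_tableau [of "fst b" "snd b" lam] by simp
    then have "{b \<in> boxes lam. entry (hw_tableau lam) b = Suc i} = {b \<in> boxes lam. fst b = i}"
      by auto
    also have "\<dots> = (if i < length lam then Pair i ` {..<lam ! i} else {})"
      unfolding boxes_def by auto
    finally show ?thesis .
  qed
  finally show ?thesis by (simp add: card_image inj_on_def)
qed

lemma hw_tableau_content_inj:
  assumes "lam \<in> partitions n" "\<mu> \<in> partitions m"
    and "mset (concat (hw_tableau lam)) = mset (concat (hw_tableau \<mu>))"
  shows "lam = \<mu>"
proof -
  have *: "(if i < length lam then lam ! i else 0) = (if i < length \<mu> then \<mu> ! i else 0)" for i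
    unfolding count_hw_tableau [symmetric] by (simp only: assms(3))
  have "boxes l = {(i, j). j < (if i < length l then l ! i else 0)}" for l
    by (auto simp: boxes_def split: if_splits)
  then have "boxes lam = boxes \<mu>" by (simp only: *)
  then show ?thesis by (rule partition_eqI [OF assms(1,2)])
qed

lemma concat_tab_le: "concat (tab_le k t) = filter (\<lambda>x. x \<le> k) (concat t)"
proof -
  have "concat (filter (\<lambda>r. r \<noteq> []) xs) = concat xs" for xs :: tableau
    by (induction xs) auto
  then show ?thesis by (simp add: tab_le_def filter_concat)
qed

text \<open>With rows counted from 0, the entries in row \<open>k\<close> and further down exceed
  \<open>k\<close>, so these rows are filtered away. A highest weight of \<open>U_q(k)\<close>
  records only \<open>k\<close> parts; this bound guarantees that they account for all entries at
  most \<open>k\<close>.\<close>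

lemma length_tab_le:
  assumes "t \<in> SSYT lam d" "lam \<in> partitions n"
  shows "length (tab_le k t) \<le> k"
proof -
  define f where "f = (\<lambda>s. filter (\<lambda>r. r \<noteq> []) (map (filter (\<lambda>x. x \<le> k)) s))"
  have empty: "filter (\<lambda>x. x \<le> k) r = []" if r: "r \<in> set (drop k t)" for r
  proof -
    obtain i where "i < length (drop k t)" "r = drop k t ! i"
      using r unfolding in_set_conv_nth by blast
    then have i: "k + i < length t" "r = t ! (k + i)" by simp_all
    have "\<not> x \<le> k" if x: "x \<in> set r" for x
    proof -
      obtain j where j: "j < length r" "x = r ! j" using x unfolding in_set_conv_nth by blast
      have "(k + i, j) \<in> boxes (shape t)" using i j by (simp add: boxes_def shape_def)
      then have "Suc (k + i) \<le> entry t (k + i, j)"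
        by (intro SSYT_entry_ge_row [OF assms]) (simp add: SSYT_shape [OF assms(1)])
      then show ?thesis using i j by (simp add: entry_def)
    qed
    then show ?thesis by (simp add: filter_empty_conv)
  qed
  have "f (drop k t) = []"
    unfolding f_def filter_empty_conv using empty by fastforce
  moreover have "f (a @ b) = f a @ f b" for a b by (simp add: f_def)
  ultimately have "f t = f (take k t)"
    using append_take_drop_id [of k t] by (metis append_Nil2)
  moreover have "length (f (take k t)) \<le> k"
    unfolding f_def by (rule order_trans [OF length_filter_le]) simp
  ultimately show ?thesis by (simp add: tab_le_def f_def)
qed

section \<open>Standard tableaux and their row words\<close>

lemma SYT_SSYT: "S \<in> SYT lam \<Longrightarrow> S \<in> SSYT lam (sum_list lam)"
  by (simp add: SYT_def)

lemma SYT_shape: "S \<in> SYT lam \<Longrightarrow> shape S = lam"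
  by (simp add: SYT_def SSYT_def)

lemma SYT_I: "S \<in> SSYT lam n \<Longrightarrow> sum_list lam = n \<Longrightarrow> inj_on (entry S) (boxes lam) \<Longrightarrow> S \<in> SYT lam"
  unfolding SYT_def distinct_concat_boxes by (simp add: SSYT_shape)

lemma SYT_inj: "S \<in> SYT lam \<Longrightarrow> inj_on (entry S) (boxes lam)"
  using SYT_shape [of S lam] unfolding SYT_def distinct_concat_boxes by simp

lemma SYT_bij: "S \<in> SYT lam \<Longrightarrow> bij_betw (entry S) (boxes lam) {1..sum_list lam}"
proof -
  assume S: "S \<in> SYT lam"
  have "entry S ` boxes lam \<subseteq> {1..sum_list lam}"
    using SSYT_entry_range [OF SYT_SSYT [OF S]] by blast
  moreover have "card (entry S ` boxes lam) = card {1..sum_list lam}"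
    using card_image [OF SYT_inj [OF S]] by (simp add: card_boxes)
  ultimately have "entry S ` boxes lam = {1..sum_list lam}"
    by (intro card_subset_eq) auto
  then show ?thesis using SYT_inj [OF S] by (simp add: bij_betw_def)
qed

definition pos :: "tableau \<Rightarrow> nat \<Rightarrow> nat \<times> nat" where
  "pos S = the_inv_into (boxes (shape S)) (entry S)"

lemma pos_entry: "S \<in> SYT lam \<Longrightarrow> b \<in> boxes lam \<Longrightarrow> pos S (entry S b) = b"
  by (simp add: pos_def SYT_shape the_inv_into_f_f SYT_inj)

lemma bij_pos: "S \<in> SYT lam \<Longrightarrow> bij_betw (pos S) {1..sum_list lam} (boxes lam)"
  unfolding pos_def SYT_shape by (rule bij_betw_the_inv_into) (rule SYT_bij)

lemma pos_in_boxes: "S \<in> SYT lam \<Longrightarrow> x \<in> {1..sum_list lam} \<Longrightarrow> pos S x \<in> boxes lam"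
  by (meson bij_pos bij_betwE)

lemma entry_pos: "S \<in> SYT lam \<Longrightarrow> x \<in> {1..sum_list lam} \<Longrightarrow> entry S (pos S x) = x"
  unfolding pos_def SYT_shape by (rule f_the_inv_into_f_bij_betw [OF SYT_bij])

lemma pos_eqI: "S \<in> SYT lam \<Longrightarrow> b \<in> boxes lam \<Longrightarrow> entry S b = x \<Longrightarrow> pos S x = b"
  using pos_entry by blast

lemma SYT_strict:
  assumes "S \<in> SYT lam" "lam \<in> partitions n" "(i', j') \<in> boxes lam" "i \<le> i'" "j \<le> j'"
    and "(i, j) \<noteq> (i', j')"
  shows "entry S (i, j) < entry S (i', j')"
proof -
  have b: "(i, j) \<in> boxes lam" "(i, j') \<in> boxes lam"
    by (rule boxes_down_closed [OF assms(2,3)]; use assms in simp)+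
  have "entry S (i, j) \<le> entry S (i, j')"
    by (rule SSYT_row_mono [OF SYT_SSYT [OF assms(1)] b(2) assms(5)])
  also have "\<dots> \<le> entry S (i', j')"
    using SSYT_col_strict [OF SYT_SSYT [OF assms(1)] assms(2,3)] assms(4)
    by (cases "i = i'") (auto intro: less_imp_le)
  finally have "entry S (i, j) \<le> entry S (i', j')" .
  moreover have "entry S (i, j) \<noteq> entry S (i', j')"
    using inj_onD [OF SYT_inj [OF assms(1)]] b(1) assms(3,6) by blast
  ultimately show ?thesis by simp
qed

lemma residue_SYT:
  assumes "S \<in> SYT lam" "x \<in> {1..sum_list lam}"
  shows "residue S x = int (snd (pos S x)) - int (fst (pos S x))"
proof -
  have *: "(i < length S \<and> j < length (S ! i) \<and> S ! i ! j = x) \<longleftrightarrow> (i, j) = pos S x" for i j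
  proof
    assume a: "i < length S \<and> j < length (S ! i) \<and> S ! i ! j = x"
    then have "(i, j) \<in> boxes (shape S)" "entry S (i, j) = x"
      by (simp_all add: boxes_def shape_def entry_def)
    then show "(i, j) = pos S x" using pos_eqI [OF assms(1)] SYT_shape [OF assms(1)] by simp
  next
    assume "(i, j) = pos S x"
    then have "(i, j) \<in> boxes (shape S)" "entry S (i, j) = x"
      using pos_in_boxes [OF assms] entry_pos [OF assms] SYT_shape [OF assms(1)] by simp_all
    then show "i < length S \<and> j < length (S ! i) \<and> S ! i ! j = x"
      by (auto simp: boxes_def shape_def entry_def)
  qed
  have "residue S x = (THE c. \<exists>i j. (i, j) = pos S x \<and> c = int j - int i)"
    unfolding residue_def using * by (metis (lifting))
  also have "\<dots> = int (snd (pos S x)) - int (fst (pos S x))"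
    by (rule the_equality) (auto, metis prod.collapse, metis fst_conv snd_conv)
  finally show ?thesis .
qed

text \<open>The lattice (Yamanouchi) word of \<open>S\<close>. Letters are rows counted from 1, so
  for a shape with at most \<open>d\<close> rows it belongs to the word basis.\<close>

definition row_word :: "tableau \<Rightarrow> nat list" where
  "row_word S = map (\<lambda>p. Suc (fst (pos S (Suc p)))) [0..<length (concat S)]"

lemma length_row_word: "S \<in> SYT lam \<Longrightarrow> length (row_word S) = sum_list lam"
  by (simp add: row_word_def SYT_shape flip: sum_list_shape)

lemma nth_row_word: "S \<in> SYT lam \<Longrightarrow> p < sum_list lam \<Longrightarrow> row_word S ! p = Suc (fst (pos S (Suc p)))"
  using length_row_word [of S lam] by (simp add: row_word_def)

text \<open>The word tells which entries lie in which row, and an increasing row is determined by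
  its set of entries.\<close>

lemma row_word_inj:
  assumes "S \<in> SYT lam" "S' \<in> SYT lam" "row_word S = row_word S'"
  shows "S = S'"
proof (rule nth_equalityI)
  show "length S = length S'" using SYT_shape assms(1,2) by (metis length_map shape_def)
  fix i assume "i < length S"
  have row: "sorted (T ! i) \<and> distinct (T ! i) \<and>
      set (T ! i) = {x \<in> {1..sum_list lam}. row_word T ! (x - 1) = Suc i}"
    if T: "T \<in> SYT lam" and i: "i < length T" for T
  proof (intro conjI)
    show "sorted (T ! i)" using T i by (auto simp: SYT_def SSYT_def)
    show "distinct (T ! i)" using T i unfolding SYT_def by (simp add: distinct_concat_iff)
    have "x \<in> set (T ! i) \<longleftrightarrow> (\<exists>b\<in>boxes lam. fst b = i \<and> entry T b = x)" for x
      using i SYT_shape [OF T]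
      by (force simp: in_set_conv_nth boxes_def shape_def entry_def)
    also have "(\<exists>b\<in>boxes lam. fst b = i \<and> entry T b = x)
        \<longleftrightarrow> x \<in> {1..sum_list lam} \<and> fst (pos T x) = i" for x
      using pos_entry [OF T] entry_pos [OF T] pos_in_boxes [OF T] SYT_bij [OF T]
      by (metis bij_betwE)
    also have "x \<in> {1..sum_list lam} \<and> fst (pos T x) = i
        \<longleftrightarrow> x \<in> {1..sum_list lam} \<and> row_word T ! (x - 1) = Suc i" for x
      using nth_row_word [OF T, of "x - 1"] by auto
    finally show "set (T ! i) = {x \<in> {1..sum_list lam}. row_word T ! (x - 1) = Suc i}" by blast
  qed
  have "i < length S'" using \<open>i < length S\<close> \<open>length S = length S'\<close> by simp
  then show "S ! i = S' ! i"
    using row [OF assms(1) \<open>i < length S\<close>] row [OF assms(2) \<open>i < length S'\<close>] assms(3)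
    by (metis sorted_distinct_set_unique)
qed

section \<open>Exchanging consecutive entries\<close>

definition step_swap :: "nat \<Rightarrow> nat \<Rightarrow> nat" where
  "step_swap i = id(i := Suc i, Suc i := i)"

lemma step_swap_invol [simp]: "step_swap i (step_swap i x) = x"
  by (simp add: step_swap_def)

text \<open>The transposition reverses the order of a single pair, so standardness can only break
  between the boxes of \<open>i\<close> and \<open>Suc i\<close>.\<close>

lemma step_swap_less: "a < b \<Longrightarrow> \<not> (a = i \<and> b = Suc i) \<Longrightarrow> step_swap i a < step_swap i b"
  by (auto simp: step_swap_def)

lemma shape_swap_entries: "shape (swap_entries i S) = shape S"
  by (simp add: swap_entries_def shape_def comp_def)

lemma entry_swap_entries:
  "b \<in> boxes (shape S) \<Longrightarrow> entry (swap_entries i S) b = step_swap i (entry S b)"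
  by (auto simp: swap_entries_def step_swap_def entry_def boxes_def shape_def)

lemma swap_entries_invol: "swap_entries i (swap_entries i S) = S"
  by (rule tableau_eqI) (simp_all add: shape_swap_entries entry_swap_entries)

lemma swap_entries_SYT:
  assumes S: "S \<in> SYT lam" and lam: "lam \<in> partitions n" and i: "1 \<le> i" "i < n"
    and r: "fst (pos S i) \<noteq> fst (pos S (Suc i))" and c: "snd (pos S i) \<noteq> snd (pos S (Suc i))"
  shows "swap_entries i S \<in> SYT lam"
proof (rule SYT_I)
  let ?S = "swap_entries i S"
  have n: "sum_list lam = n" using lam by (rule partitions_sum)
  have sh: "shape S = lam" using S by (rule SYT_shape)
  have e: "entry ?S b = step_swap i (entry S b)" if "b \<in> boxes lam" for b
    using that sh by (simp add: entry_swap_entries)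
  have less: "entry ?S b < entry ?S b'"
    if "b \<in> boxes lam" "b' \<in> boxes lam" "entry S b < entry S b'" "fst b = fst b' \<or> snd b = snd b'" for b b'
  proof -
    have "\<not> (entry S b = i \<and> entry S b' = Suc i)"
      using that r c pos_eqI [OF S] by metis
    then show ?thesis using that by (simp add: e step_swap_less)
  qed
  show "?S \<in> SSYT lam n"
  proof (rule SSYT_I)
    show "shape ?S = lam" by (simp add: shape_swap_entries sh)
    fix b assume b: "b \<in> boxes lam"
    show "entry ?S b \<in> {1..n}"
      using SSYT_entry_range [OF SYT_SSYT [OF S] b] i n by (auto simp: e [OF b] step_swap_def)
  next
    fix i j j' assume b: "(i, j') \<in> boxes lam" "j < j'"
    moreover from b have "(i, j) \<in> boxes lam" by (auto simp: boxes_def)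
    moreover have "entry S (i, j) < entry S (i, j')" using SYT_strict [OF S lam b(1)] b by simp
    ultimately show "entry ?S (i, j) \<le> entry ?S (i, j')" by (simp add: less less_imp_le)
  next
    fix i j assume b: "(Suc i, j) \<in> boxes lam"
    have b': "(i, j) \<in> boxes lam" by (rule boxes_down_closed [OF lam b]) auto
    have "entry S (i, j) < entry S (Suc i, j)" using SYT_strict [OF S lam b] by simp
    then show "entry ?S (i, j) < entry ?S (Suc i, j)" using b b' by (simp add: less)
  qed
  show "sum_list lam = n" by (rule n)
  show "inj_on (entry ?S) (boxes lam)"
  proof (rule inj_onI)
    fix b b' assume b: "b \<in> boxes lam" "b' \<in> boxes lam" "entry ?S b = entry ?S b'"
    then have "entry S b = entry S b'" using e step_swap_invol by metis
    then show "b = b'" using b SYT_inj [OF S] by (meson inj_onD)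
  qed
qed

lemma pos_swap_entries:
  assumes S: "S \<in> SYT lam" and S': "swap_entries i S \<in> SYT lam" and i: "1 \<le> i" "i < sum_list lam"
    and x: "x \<in> {1..sum_list lam}"
  shows "pos (swap_entries i S) x = pos S (step_swap i x)"
proof (rule pos_eqI [OF S'])
  have *: "step_swap i x \<in> {1..sum_list lam}" using i x by (auto simp: step_swap_def)
  show "pos S (step_swap i x) \<in> boxes lam" by (rule pos_in_boxes [OF S *])
  then show "entry (swap_entries i S) (pos S (step_swap i x)) = x"
    using SYT_shape [OF S] by (simp add: entry_swap_entries entry_pos [OF S *])
qed

text \<open>Matches the two sides of the Hecke action: entry \<open>Suc p\<close> is recorded at
  list position \<open>p\<close>, so a swap of entries becomes a swap of neighbouring
  letters.\<close>

lemma row_word_swap_entries: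
  assumes S: "S \<in> SYT lam" and S': "swap_entries (Suc p) S \<in> SYT lam" and p: "Suc p < sum_list lam"
  shows "row_word (swap_entries (Suc p) S)
    = (row_word S)[p := row_word S ! Suc p, Suc p := row_word S ! p]"
proof (rule nth_equalityI)
  show "length (row_word (swap_entries (Suc p) S))
    = length ((row_word S)[p := row_word S ! Suc p, Suc p := row_word S ! p])"
    by (simp add: length_row_word [OF S] length_row_word [OF S'])
  fix k assume "k < length (row_word (swap_entries (Suc p) S))"
  then have k: "k < sum_list lam" by (simp add: length_row_word [OF S'])
  have "row_word (swap_entries (Suc p) S) ! k = Suc (fst (pos S (step_swap (Suc p) (Suc k))))"
    using k p by (simp add: nth_row_word [OF S'] pos_swap_entries [OF S S'])
  also have "\<dots> = (row_word S)[p := row_word S ! Suc p, Suc p := row_word S ! p] ! k"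
    using k p by (auto simp: nth_list_update length_row_word [OF S] nth_row_word [OF S] step_swap_def)
  finally show "row_word (swap_entries (Suc p) S) ! k
    = (row_word S)[p := row_word S ! Suc p, Suc p := row_word S ! p] ! k" .
qed

section \<open>Ascents of standard tableaux\<close>

lemma SYT_ascent:
  assumes S: "S \<in> SYT lam" and lam: "lam \<in> partitions n" and i: "1 \<le> i" "i < n"
    and r: "fst (pos S i) < fst (pos S (Suc i))"
  shows "snd (pos S (Suc i)) \<le> snd (pos S i)"
    and "snd (pos S (Suc i)) = snd (pos S i) \<Longrightarrow> fst (pos S (Suc i)) = Suc (fst (pos S i))"
proof -
  have n: "sum_list lam = n" using lam by (rule partitions_sum)
  obtain r c where rc: "pos S i = (r, c)" by fastforce
  obtain r' c' where rc': "pos S (Suc i) = (r', c')" by fastforce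
  have e: "entry S (r, c) = i" "entry S (r', c') = Suc i"
    using entry_pos [OF S, of i] entry_pos [OF S, of "Suc i"] i n rc rc' by auto
  have b': "(r', c') \<in> boxes lam" using pos_in_boxes [OF S, of "Suc i"] i n rc' by auto
  have lt: "r < r'" using r rc rc' by simp
  show 1: "snd (pos S (Suc i)) \<le> snd (pos S i)"
  proof (rule ccontr)
    assume "\<not> ?thesis"
    then have c: "c < c'" using rc rc' by simp
    have b: "(r, c') \<in> boxes lam" by (rule boxes_down_closed [OF lam b']) (use lt in auto)
    have "entry S (r, c) < entry S (r, c')" using SYT_strict [OF S lam b] c by simp
    moreover have "entry S (r, c') < entry S (r', c')" using SYT_strict [OF S lam b'] lt by simp
    ultimately show False using e by simp
  qed
  assume "snd (pos S (Suc i)) = snd (pos S i)"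
  then have c: "c' = c" using rc rc' by simp
  show "fst (pos S (Suc i)) = Suc (fst (pos S i))"
  proof (rule ccontr)
    assume "\<not> ?thesis"
    then have r2: "Suc r < r'" using rc rc' lt by simp
    have b: "(Suc r, c) \<in> boxes lam" by (rule boxes_down_closed [OF lam b']) (use r2 c in auto)
    have "entry S (r, c) < entry S (Suc r, c)" using SYT_strict [OF S lam b] by simp
    moreover have "entry S (Suc r, c) < entry S (r', c')" using SYT_strict [OF S lam b'] r2 c by simp
    ultimately show False using e by simp
  qed
qed

lemma pos_one_row:
  assumes "S \<in> SYT lam" "lam \<in> partitions n" "1 \<le> n"
  shows "fst (pos S 1) = 0"
proof -
  have "1 \<in> {1..sum_list lam}" using assms(2,3) by (simp add: partitions_def)
  then have "pos S 1 \<in> boxes lam" "entry S (pos S 1) = 1"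
    using assms(1) pos_in_boxes entry_pos by blast+
  then show ?thesis
    using SSYT_entry_ge_row [OF SYT_SSYT [OF assms(1)] assms(2), of "fst (pos S 1)" "snd (pos S 1)"] by simp
qed

text \<open>A free ascent is an \<open>i\<close> with \<open>i + 1\<close> in a lower row and in
  another column: there the swap gives a standard tableau again, with a smaller row word.\<close>

definition no_free_ascent :: "tableau \<Rightarrow> bool" where
  "no_free_ascent S \<longleftrightarrow> (\<forall>i. 1 \<le> i \<longrightarrow> i < length (concat S) \<longrightarrow>
     fst (pos S i) < fst (pos S (Suc i)) \<longrightarrow> snd (pos S i) = snd (pos S (Suc i)))"

text \<open>The tableaux without free ascents are the minimal ones; their row words consist of runs
  \<open>1, 2, 3, \<dots>\<close> that fill columns.\<close>

lemma no_free_ascent_descent: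
  assumes S: "S \<in> SYT lam" and lam: "lam \<in> partitions n" and i: "1 \<le> i" "i < n"
    and nfa: "no_free_ascent S" and r: "fst (pos S (Suc i)) \<le> fst (pos S i)"
  shows "fst (pos S (Suc i)) = 0"
proof (rule ccontr)
  assume nz: "fst (pos S (Suc i)) \<noteq> 0"
  have n: "sum_list lam = n" using lam by (rule partitions_sum)
  have len: "length (concat S) = n" using sum_list_shape [of S] SYT_shape [OF S] n by simp
  obtain r c where rc: "pos S (Suc i) = (Suc r, c)"
    using nz by (metis not0_implies_Suc prod.collapse)
  have b: "(Suc r, c) \<in> boxes lam" using pos_in_boxes [OF S, of "Suc i"] i n rc by auto
  have b2: "(r, c) \<in> boxes lam" by (rule boxes_down_closed [OF lam b]) auto
  have ei: "entry S (Suc r, c) = Suc i" using entry_pos [OF S, of "Suc i"] i n rc by auto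
  \<comment> \<open>Standardness puts \<open>p < Suc i\<close>, and \<open>p\<close> lies in row
    \<open>r\<close> while \<open>i\<close> lies in row \<open>Suc r\<close> or lower. Somewhere
    from \<open>p\<close> to \<open>i\<close> an ascent \<open>j\<close> must cross from row at most
    \<open>r\<close> to a row beyond it.\<close>
  define p where "p = entry S (r, c)"
  have pos_p: "pos S p = (r, c)" unfolding p_def by (rule pos_entry [OF S b2])
  have p1: "1 \<le> p" using SSYT_entry_range [OF SYT_SSYT [OF S] b2] p_def by simp
  have "p < Suc i" using SYT_strict [OF S lam b, of r c] ei p_def by simp
  moreover have "p \<noteq> i" using pos_p r rc by auto
  ultimately have p_i: "p < i" by simp
  have "\<exists>j. p \<le> j \<and> j < i \<and> fst (pos S j) < Suc r \<and> Suc r \<le> fst (pos S (Suc j))"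
  proof (rule ccontr)
    assume no: "\<not> ?thesis"
    have "fst (pos S j) < Suc r" if "p \<le> j" "j \<le> i" for j
      using that
    proof (induction j rule: dec_induct)
      case base
      then show ?case using pos_p by simp
    next
      case (step j)
      then show ?case using no by (meson Suc_le_lessD less_imp_le not_less)
    qed
    from this [of i] show False using p_i r rc by simp
  qed
  then obtain j where j: "p \<le> j" "j < i" "fst (pos S j) < Suc r" "Suc r \<le> fst (pos S (Suc j))" by blast
  have j1: "1 \<le> j" "j < n" using j p1 i by auto
  have asc: "fst (pos S j) < fst (pos S (Suc j))" using j by simp
  have same: "snd (pos S j) = snd (pos S (Suc j))"
    using nfa j1 asc len by (simp add: no_free_ascent_def)
  have "fst (pos S (Suc j)) = Suc (fst (pos S j))"
    using SYT_ascent(2) [OF S lam j1 asc] same by simp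
  then have rows: "fst (pos S j) = r" "fst (pos S (Suc j)) = Suc r" using j by auto
  define c1 where "c1 = snd (pos S j)"
  have pj: "pos S j = (r, c1)" using rows c1_def by (metis prod.collapse)
  have pj': "pos S (Suc j) = (Suc r, c1)" using rows c1_def same by (metis prod.collapse)
  have ej: "entry S (r, c1) = j" using entry_pos [OF S, of j] j1 n pj by auto
  have ej': "entry S (Suc r, c1) = Suc j" using entry_pos [OF S, of "Suc j"] j1 n pj' by auto
  have bj: "(Suc r, c1) \<in> boxes lam" using pos_in_boxes [OF S, of "Suc j"] j1 n pj' by auto
  \<comment> \<open>The crossing occupies a single column \<open>c1\<close>. If
    \<open>c1 = c\<close>, then \<open>j = i\<close>; to the left of \<open>c\<close> it gives
    \<open>j < p\<close>; to the right it gives \<open>i < j\<close>. Each contradicts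
    \<open>p \<le> j < i\<close>.\<close>
  consider "c1 = c" | "c1 < c" | "c < c1" by linarith
  then show False
  proof cases
    case 1
    then show False using ej' ei j by simp
  next
    case 2
    then have "entry S (r, c1) < entry S (r, c)" using SYT_strict [OF S lam b2] by simp
    then show False using ej p_def j by simp
  next
    case 3
    then have "entry S (Suc r, c) < entry S (Suc r, c1)" using SYT_strict [OF S lam bj] by simp
    then show False using ej' ei j by simp
  qed
qed

section \<open>Words ordered by prefix counts\<close>

definition prefix_count :: "nat list \<Rightarrow> nat \<Rightarrow> nat \<Rightarrow> nat" where
  "prefix_count w k m = (\<Sum>i<k. of_bool (w ! i \<le> m))"

text \<open>Greater words have their small letters earlier. Words of different content are
  comparable too, which the support statement for arbitrary \<open>t\<close> requires.\<close>

definition prefix_le :: "nat list \<Rightarrow> nat list \<Rightarrow> bool" where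
  "prefix_le u v \<longleftrightarrow> (\<forall>k\<le>length u. \<forall>m. prefix_count u k m \<le> prefix_count v k m)"

text \<open>A numerical rank for the order, strictly increasing on words of one length with letters
  at most \<open>d\<close>; all inductions along the order run on it.\<close>

definition prefix_height :: "nat \<Rightarrow> nat list \<Rightarrow> nat" where
  "prefix_height d w = (\<Sum>k\<le>length w. \<Sum>m\<le>d. prefix_count w k m)"

definition letter_swap :: "nat \<Rightarrow> nat list \<Rightarrow> nat list" where
  "letter_swap p w = w[p := w ! Suc p, Suc p := w ! p]"

lemma prefix_count_0 [simp]: "prefix_count w 0 m = 0"
  by (simp add: prefix_count_def)

lemma prefix_count_Suc: "prefix_count w (Suc k) m = prefix_count w k m + of_bool (w ! k \<le> m)"
  by (simp add: prefix_count_def)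

lemma prefix_count_bound: "prefix_count w k m \<le> k"
  by (induction k) (auto simp: prefix_count_Suc)

lemma prefix_count_cong: "(\<And>i. i < k \<Longrightarrow> u ! i = v ! i) \<Longrightarrow> prefix_count u k m = prefix_count v k m"
  by (simp add: prefix_count_def)

lemma prefix_count_full: "prefix_count w (length w) m = size (filter_mset (\<lambda>x. x \<le> m) (mset w))"
proof -
  have "prefix_count w (length w) m = card {i. i < length w \<and> w ! i \<le> m}"
    by (simp add: prefix_count_def sum.If_cases of_bool_def Int_def lessThan_def)
  also have "\<dots> = length (filter (\<lambda>x. x \<le> m) w)" by (rule length_filter_conv_card [symmetric])
  finally show ?thesis by (metis mset_filter size_mset)
qed

lemma prefix_le_refl: "prefix_le w w"
  by (simp add: prefix_le_def)

lemma prefix_le_trans: "prefix_le u v \<Longrightarrow> prefix_le v w \<Longrightarrow> length u = length v \<Longrightarrow> prefix_le u w"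
  unfolding prefix_le_def by (metis order_trans)

lemma length_letter_swap [simp]: "length (letter_swap p w) = length w"
  by (simp add: letter_swap_def)

lemma letter_swap_invol: "Suc p < length w \<Longrightarrow> letter_swap p (letter_swap p w) = w"
  by (rule nth_equalityI) (auto simp: letter_swap_def nth_list_update)

lemma nth_letter_swap:
  "Suc p < length w \<Longrightarrow> k < length w \<Longrightarrow>
    letter_swap p w ! k = (if k = p then w ! Suc p else if k = Suc p then w ! p else w ! k)"
  by (auto simp: letter_swap_def nth_list_update)

lemma mset_letter_swap: "Suc p < length w \<Longrightarrow> mset (letter_swap p w) = mset w"
  unfolding letter_swap_def by (rule mset_swap) auto

text \<open>Only the prefix of length \<open>Suc p\<close> separates the two exchanged
  letters.\<close>

lemma prefix_count_letter_swap:
  assumes "Suc p < length w" "k \<le> length w"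
  shows "prefix_count (letter_swap p w) k m
    = (if k = Suc p then prefix_count w p m + of_bool (w ! Suc p \<le> m) else prefix_count w k m)"
  using assms(2)
proof (induction k)
  case (Suc k)
  consider "k < p" | "k = p" | "k = Suc p" | "Suc p < k" by linarith
  then show ?case
  proof cases
    case 3
    have "prefix_count w k m = prefix_count w p m + of_bool (w ! p \<le> m)"
      using 3 by (simp add: prefix_count_Suc)
    then show ?thesis using Suc 3 assms(1) by (simp add: prefix_count_Suc nth_letter_swap)
  qed (use Suc assms(1) in \<open>simp_all add: prefix_count_Suc nth_letter_swap\<close>)
qed simp

lemma prefix_le_letter_swap:
  assumes "Suc p < length w" "w ! Suc p \<le> w ! p"
  shows "prefix_le w (letter_swap p w)"
  using assms by (auto simp: prefix_le_def prefix_count_letter_swap prefix_count_Suc)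

text \<open>On the rearrangements of a fixed word, \<open>prefix_le\<close> is the Bruhat order, and this is its
  lifting property.\<close>

lemma prefix_le_letter_swap_mono:
  assumes "prefix_le u v" "length u = length v" "Suc p < length v" "v ! Suc p < v ! p"
  shows "prefix_le (letter_swap p u) (letter_swap p v)"
  unfolding prefix_le_def
proof (intro allI impI)
  fix k m assume "k \<le> length (letter_swap p u)"
  then have k: "k \<le> length u" by simp
  have le: "prefix_count u j m \<le> prefix_count v j m" if "j \<le> length u" for j
    using assms(1) that by (simp add: prefix_le_def)
  show "prefix_count (letter_swap p u) k m \<le> prefix_count (letter_swap p v) k m"
  proof (cases "k = Suc p")
    case True
    have 1: "prefix_count u p m \<le> prefix_count v p m" using assms by (intro le) simp
    have 2: "prefix_count u (Suc (Suc p)) m \<le> prefix_count v (Suc (Suc p)) m"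
      using assms by (intro le) simp
    have "prefix_count u p m + of_bool (u ! Suc p \<le> m)
        \<le> prefix_count v p m + of_bool (v ! Suc p \<le> m)"
    \<comment> \<open>If the letter moved to position \<open>p\<close> of \<open>v\<close> counts,
      the bound at length \<open>p\<close> gains a full unit. Otherwise neither of the two letters
      of \<open>v\<close> counts, and the bound at length \<open>p + 2\<close> applies.\<close>
    proof (cases "v ! Suc p \<le> m")
      case True
      then show ?thesis using 1 by (simp add: of_bool_def)
    next
      case False
      then have "\<not> v ! p \<le> m" using assms(4) by simp
      then show ?thesis using False 2 by (simp add: prefix_count_Suc)
    qed
    then show ?thesis using True k assms by (simp add: prefix_count_letter_swap)
  qed (use le k assms in \<open>simp add: prefix_count_letter_swap\<close>)
qed

lemma prefix_height_mono: "prefix_le u v \<Longrightarrow> length u = length v \<Longrightarrow> prefix_height d u \<le> prefix_height d v"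
  unfolding prefix_height_def prefix_le_def by (auto intro!: sum_mono)

text \<open>Termwise inequalities with equal totals are equalities, so all prefix counts agree;
  their increments recover the letters, for which thresholds up to \<open>d\<close> suffice.\<close>

lemma prefix_le_antisym_height:
  assumes le: "prefix_le u v" and len: "length u = length v" and d: "set u \<subseteq> {..d}" "set v \<subseteq> {..d}"
    and h: "prefix_height d v \<le> prefix_height d u"
  shows "u = v"
proof (rule nth_equalityI [OF len])
  have ple: "prefix_count u k m \<le> prefix_count v k m" if "k \<le> length u" for k m
    using le that by (simp add: prefix_le_def)
  have "prefix_height d u = prefix_height d v" using h prefix_height_mono [OF le len] by (rule le_antisym [rotated])
  then have tot: "(\<Sum>k\<le>length u. \<Sum>m\<le>d. prefix_count u k m) = (\<Sum>k\<le>length u. \<Sum>m\<le>d. prefix_count v k m)"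
    by (simp add: prefix_height_def len)
  have row: "(\<Sum>m\<le>d. prefix_count u k m) = (\<Sum>m\<le>d. prefix_count v k m)" if "k \<le> length u" for k
    by (rule sum_mono_inv [OF tot]) (use ple that in \<open>simp_all add: sum_mono\<close>)
  have eq: "prefix_count u k m = prefix_count v k m" if "k \<le> length u" "m \<le> d" for k m
    by (rule sum_mono_inv [OF row [OF that(1)]]) (use ple that in simp_all)
  fix k assume k: "k < length u"
  have iff: "u ! k \<le> m \<longleftrightarrow> v ! k \<le> m" if "m \<le> d" for m
    using eq [of k m] eq [of "Suc k" m] k that
    by (cases "u ! k \<le> m"; cases "v ! k \<le> m") (simp_all add: prefix_count_Suc)
  have "u ! k \<in> set u" "v ! k \<in> set v" using k len by simp_all
  then have "u ! k \<le> d" "v ! k \<le> d" using d by blast+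
  then have "u ! k \<le> v ! k" "v ! k \<le> u ! k" using iff by auto
  then show "u ! k = v ! k" by (rule le_antisym)
qed

lemma prefix_height_bound:
  "prefix_height d w \<le> (\<Sum>k\<le>length w. \<Sum>m\<le>d. k)"
  unfolding prefix_height_def by (intro sum_mono prefix_count_bound)

text \<open>\<open>Q\<close> stands for the support of a vector that is antisymmetric along the ascents of \<open>v\<close>.
  Sorting each run of a word in \<open>Q\<close> moves it up in the order, and a word that is increasing on all runs
  dominates \<open>v\<close> letter by letter, so it equals \<open>v\<close> once the letter sums agree.\<close>

lemma sort_runs:
  assumes v: "\<And>p. Suc p < n \<Longrightarrow> v ! Suc p = 1 \<or> v ! Suc p = Suc (v ! p)" "length v = n" "0 < n \<Longrightarrow> v ! 0 = 1"
    and Q: "\<And>w. w \<in> Q \<Longrightarrow> length w = n \<and> set w \<subseteq> {1..d} \<and> sum_list w = sum_list v"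
    and ne: "\<And>w p. w \<in> Q \<Longrightarrow> Suc p < n \<Longrightarrow> v ! p < v ! Suc p \<Longrightarrow> w ! p \<noteq> w ! Suc p"
    and sw: "\<And>w p. w \<in> Q \<Longrightarrow> Suc p < n \<Longrightarrow> v ! p < v ! Suc p \<Longrightarrow> w ! Suc p < w ! p \<Longrightarrow> letter_swap p w \<in> Q"
    and w: "w \<in> Q"
  shows "prefix_le w v \<and> v \<in> Q"
proof -
  define bnd where "bnd = (\<Sum>k\<le>n. \<Sum>m\<le>d. k)"
  show ?thesis
    using w
  \<comment> \<open>Heights of words of length \<open>n\<close> are bounded by \<open>bnd\<close>,
    so the remaining distance drops whenever a swap raises the word.\<close>
  proof (induction "bnd - prefix_height d w" arbitrary: w rule: less_induct)
    case less
    have len: "length w = n" and sub: "set w \<subseteq> {1..d}" and sum: "sum_list w = sum_list v"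
      using Q [OF less.prems] by auto
    show ?case
    proof (cases "\<exists>p. Suc p < n \<and> v ! p < v ! Suc p \<and> w ! Suc p < w ! p")
      case True
      then obtain p where p: "Suc p < n" "v ! p < v ! Suc p" "w ! Suc p < w ! p" by blast
      let ?w = "letter_swap p w"
      have inQ: "?w \<in> Q" by (rule sw [OF less.prems p])
      have le: "prefix_le w ?w" using p len by (intro prefix_le_letter_swap) auto
      have "w ! p \<noteq> ?w ! p" using p len by (simp add: nth_letter_swap)
      then have "w \<noteq> ?w" by auto
      then have "prefix_height d w < prefix_height d ?w"
        using prefix_le_antisym_height [OF le, of d] sub Q [OF inQ] by (force simp: not_less [symmetric])
      moreover have "prefix_height d ?w \<le> bnd"
        using prefix_height_bound [of d ?w] len by (simp add: bnd_def)
      ultimately have "prefix_le ?w v \<and> v \<in> Q" by (intro less.hyps [OF _ inQ]) simp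
      then show ?thesis using prefix_le_trans [OF le] by auto
    next
      case no_descent: False
      \<comment> \<open>Along a run \<open>v\<close> grows by exactly one and \<open>w\<close> by at
        least one, since it has neither descents nor equal neighbours there; where a run starts,
        \<open>v\<close> has the least possible letter 1.\<close>
      have ge: "v ! p \<le> w ! p" if "p < n" for p
        using that
      proof (induction p)
        case 0
        then have "w ! 0 \<in> set w" using len by simp
        then show ?case using 0 sub v(3) by auto
      next
        case (Suc p)
        have "w ! Suc p \<in> set w" using Suc.prems len by simp
        then have 1: "1 \<le> w ! Suc p" using sub by auto
        show ?case
        proof (cases "v ! Suc p = 1")
          case False
          then have asc: "v ! Suc p = Suc (v ! p)" using v(1) [OF Suc.prems] by simp
          then have "w ! p \<noteq> w ! Suc p" "\<not> w ! Suc p < w ! p"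
            using ne [OF less.prems Suc.prems] no_descent Suc.prems by (auto simp del: One_nat_def)
          then show ?thesis using asc Suc by simp
        qed (use 1 in simp)
      qed
      have tot: "(\<Sum>p<n. v ! p) = (\<Sum>p<n. w ! p)"
        using sum len v(2) by (simp add: sum_list_sum_nth lessThan_atLeast0)
      have "v ! p = w ! p" if "p < n" for p
        by (rule sum_mono_inv [OF tot]) (use ge that in simp_all)
      then have "w = v" using len v(2) by (intro nth_equalityI) auto
      then show ?thesis using less.prems by (simp add: prefix_le_refl)
    qed
  qed
qed

section \<open>Row words in the prefix order\<close>

lemma sum_boxes_pos:
  assumes "S \<in> SYT lam"
  shows "(\<Sum>p<sum_list lam. g (pos S (Suc p))) = (\<Sum>b\<in>boxes lam. g b)"
proof -
  have "(\<Sum>p<sum_list lam. g (pos S (Suc p))) = (\<Sum>x\<in>{1..sum_list lam}. g (pos S x))"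
    by (rule sum.reindex_bij_witness [where i = "\<lambda>x. x - 1" and j = Suc]) auto
  also have "\<dots> = (\<Sum>b\<in>boxes lam. g b)"
    by (rule sum.reindex_bij_betw [OF bij_pos [OF assms]])
  finally show ?thesis .
qed

lemma prefix_count_row_word_full:
  assumes "S \<in> SYT lam"
  shows "prefix_count (row_word S) (sum_list lam) m = card {b \<in> boxes lam. fst b < m}"
proof -
  have "prefix_count (row_word S) (sum_list lam) m
      = (\<Sum>p<sum_list lam. of_bool (Suc (fst (pos S (Suc p))) \<le> m))"
    unfolding prefix_count_def by (rule sum.cong) (auto simp: nth_row_word [OF assms])
  also have "\<dots> = (\<Sum>b\<in>boxes lam. of_bool (Suc (fst b) \<le> m))"
    by (rule sum_boxes_pos [OF assms])
  also have "\<dots> = card {b \<in> boxes lam. fst b < m}"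
    by (simp add: Suc_le_eq Int_def)
  finally show ?thesis .
qed

text \<open>Dominance of weights by the highest weight: entries at most \<open>m\<close> lie in the
  first \<open>m\<close> rows. The role of \<open>S\<close> is to express the right side by a row
  word; every standard tableau of the shape gives the same count.\<close>

lemma prefix_count_content_le:
  assumes s: "s \<in> SSYT \<mu> d" and \<mu>: "\<mu> \<in> partitions n" and w: "mset w = mset (concat s)"
    and S: "S \<in> SYT \<mu>"
  shows "prefix_count w n m \<le> prefix_count (row_word S) n m"
proof -
  have n: "sum_list \<mu> = n" using \<mu> by (rule partitions_sum)
  have "length w = n"
    using w n SSYT_shape [OF s] sum_list_shape [of s] by (metis size_mset)
  then have "prefix_count w n m = card {b \<in> boxes \<mu>. entry s b \<le> m}"
    using prefix_count_full [of w m] w SSYT_shape [OF s] by (simp only: size_filter_concat)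
  also have "\<dots> \<le> card {b \<in> boxes \<mu>. fst b < m}"
  proof (rule card_mono)
    show "{b \<in> boxes \<mu>. entry s b \<le> m} \<subseteq> {b \<in> boxes \<mu>. fst b < m}"
      using SSYT_entry_ge_row [OF s \<mu>] by fastforce
  qed simp
  also have "\<dots> = prefix_count (row_word S) n m" using prefix_count_row_word_full [OF S] n by simp
  finally show ?thesis .
qed

text \<open>Both sides add up row numbers over all boxes. This supplies the equality of letter sums
  on which the run-sorting argument rests.\<close>

lemma sum_row_word:
  assumes S: "S \<in> SYT lam"
  shows "sum_list (row_word S) = sum_list (concat (hw_tableau lam))"
proof -
  have "sum_list (row_word S) = (\<Sum>p<sum_list lam. Suc (fst (pos S (Suc p))))"
    unfolding sum_list_sum_nth [of "row_word S"] length_row_word [OF S]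
    by (rule sum.cong) (auto simp: nth_row_word [OF S])
  also have "\<dots> = (\<Sum>b\<in>boxes lam. Suc (fst b))" by (rule sum_boxes_pos [OF S])
  also have "\<dots> = (\<Sum>b\<in>boxes lam. entry (hw_tableau lam) b)"
  proof (rule sum.cong)
    fix b assume "b \<in> boxes lam"
    then show "Suc (fst b) = entry (hw_tableau lam) b"
      using entry_hw_tableau [of "fst b" "snd b" lam] by simp
  qed simp
  finally show ?thesis unfolding sum_list_concat by simp
qed

lemma row_word_range:
  assumes S: "S \<in> SYT lam"
  shows "set (row_word S) \<subseteq> {1..length lam}"
proof
  fix x assume "x \<in> set (row_word S)"
  then obtain p where p: "p < sum_list lam" "x = row_word S ! p"
    using length_row_word [OF S] by (metis in_set_conv_nth)
  then have "pos S (Suc p) \<in> boxes lam" by (intro pos_in_boxes [OF S]) simp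
  then show "x \<in> {1..length lam}" using p nth_row_word [OF S] by (auto simp: boxes_def)
qed

section \<open>Adding and removing a box\<close>

lemma coversE:
  assumes "covers \<mu> lam"
  obtains b where "b \<notin> boxes lam" "boxes \<mu> = insert b (boxes lam)"
  using assms by (auto simp: covers_def)

lemma covers_length_le:
  assumes "covers \<mu> lam" "lam \<in> partitions n"
  shows "length lam \<le> length \<mu>"
proof (rule ccontr)
  assume *: "\<not> ?thesis"
  then have "(length \<mu>, 0) \<in> boxes lam"
    using partition_nth_pos [OF assms(2)] by (simp add: boxes_def)
  then have "(length \<mu>, 0) \<in> boxes \<mu>" using assms(1) by (auto elim: coversE)
  then show False by (simp add: boxes_def)
qed

lemma shape_add_box: "shape (add_box \<mu> S x) = \<mu>"
  by (auto simp: add_box_def shape_def intro: nth_equalityI)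

lemma entry_add_box:
  "b \<in> boxes \<mu> \<Longrightarrow> entry (add_box \<mu> S x) b = (if b \<in> boxes (shape S) then entry S b else x)"
  by (cases b) (simp add: add_box_def entry_def boxes_def)

context
  fixes lam \<mu> :: "nat list" and n :: nat and S :: tableau
  assumes lam: "lam \<in> partitions n" and \<mu>: "\<mu> \<in> partitions (Suc n)" and cov: "covers \<mu> lam"
    and S: "S \<in> SYT lam"
begin

lemma entry_add_box_old: "b \<in> boxes lam \<Longrightarrow> entry (add_box \<mu> S (Suc n)) b = entry S b"
  using cov SYT_shape [OF S] by (auto elim!: coversE simp: entry_add_box)

lemma entry_add_box_new: "b \<in> boxes \<mu> \<Longrightarrow> b \<notin> boxes lam \<Longrightarrow> entry (add_box \<mu> S (Suc n)) b = Suc n"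
  using SYT_shape [OF S] by (simp add: entry_add_box)

lemma entry_add_box_old_less: "b \<in> boxes lam \<Longrightarrow> entry S b \<in> {1..n}"
  using SSYT_entry_range [OF SYT_SSYT [OF S]] partitions_sum [OF lam] by simp

text \<open>The smaller shape can be read off from the enlarged tableau alone; this is what makes
  restriction of standard tableaux unambiguous.\<close>

lemma boxes_add_box: "boxes lam = {b \<in> boxes \<mu>. entry (add_box \<mu> S (Suc n)) b \<le> n}"
proof (intro set_eqI iffI)
  fix b assume b: "b \<in> boxes lam"
  then show "b \<in> {b \<in> boxes \<mu>. entry (add_box \<mu> S (Suc n)) b \<le> n}"
    using cov entry_add_box_old [OF b] entry_add_box_old_less [OF b] by (simp add: covers_def) blast
next
  fix b assume b: "b \<in> {b \<in> boxes \<mu>. entry (add_box \<mu> S (Suc n)) b \<le> n}"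
  show "b \<in> boxes lam"
  proof (rule ccontr)
    assume "b \<notin> boxes lam"
    then show False using b entry_add_box_new [of b] by simp
  qed
qed

lemma add_box_SYT: "add_box \<mu> S (Suc n) \<in> SYT \<mu>"
proof (rule SYT_I)
  let ?T = "add_box \<mu> S (Suc n)"
  have sub: "boxes lam \<subseteq> boxes \<mu>" using cov by (auto elim: coversE)
  have less: "entry ?T b < entry ?T b'"
    if b: "b \<in> boxes \<mu>" "b' \<in> boxes \<mu>" and neq: "b \<noteq> b'"
      and le: "fst b \<le> fst b'" "snd b \<le> snd b'" for b b'
  proof (cases "b' \<in> boxes lam")
    case True
    then have "b \<in> boxes lam"
      using boxes_down_closed [OF lam, of "fst b'" "snd b'" "fst b" "snd b"] le by simp
    moreover have "entry S (fst b, snd b) < entry S (fst b', snd b')"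
      by (rule SYT_strict [OF S lam]) (use True le neq in \<open>auto simp: prod_eq_iff\<close>)
    ultimately show ?thesis using True by (simp add: entry_add_box_old)
  next
    case False
    then have "b \<in> boxes lam" using b neq cov by (auto elim: coversE)
    then show ?thesis
      using False b entry_add_box_old_less [of b] by (simp add: entry_add_box_old entry_add_box_new)
  qed
  show "?T \<in> SSYT \<mu> (Suc n)"
  proof (rule SSYT_I)
    show "shape ?T = \<mu>" by (rule shape_add_box)
    fix b assume b: "b \<in> boxes \<mu>"
    show "entry ?T b \<in> {1..Suc n}"
      using b entry_add_box_old_less [of b] entry_add_box_old [of b] entry_add_box_new [of b]
      by (cases "b \<in> boxes lam") auto
  next
    fix i j j' assume b: "(i, j') \<in> boxes \<mu>" "j < j'"
    moreover from b have "(i, j) \<in> boxes \<mu>" by (auto simp: boxes_def)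
    ultimately show "entry ?T (i, j) \<le> entry ?T (i, j')" by (intro less_imp_le [OF less]) auto
  next
    fix i j assume b: "(Suc i, j) \<in> boxes \<mu>"
    have b': "(i, j) \<in> boxes \<mu>" by (rule boxes_down_closed [OF \<mu> b]) auto
    show "entry ?T (i, j) < entry ?T (Suc i, j)" using b b' by (intro less) auto
  qed
  show "sum_list \<mu> = Suc n" using \<mu> by (rule partitions_sum)
  show "inj_on (entry ?T) (boxes \<mu>)"
  proof (rule inj_onI)
    fix b b' assume b: "b \<in> boxes \<mu>" "b' \<in> boxes \<mu>" and eq: "entry ?T b = entry ?T b'"
    have in_iff: "b \<in> boxes lam \<longleftrightarrow> b' \<in> boxes lam" using b eq boxes_add_box by auto
    show "b = b'"
    proof (cases "b \<in> boxes lam")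
      case True
      then show ?thesis
        using in_iff eq SYT_inj [OF S] by (simp add: entry_add_box_old inj_on_def)
    next
      case False
      then show ?thesis using in_iff b cov by (auto elim: coversE)
    qed
  qed
qed

lemma pos_add_box: "x \<in> {1..n} \<Longrightarrow> pos (add_box \<mu> S (Suc n)) x = pos S x"
proof (rule pos_eqI [OF add_box_SYT])
  assume "x \<in> {1..n}"
  then have x: "x \<in> {1..sum_list lam}" by (simp add: partitions_sum [OF lam])
  have "pos S x \<in> boxes lam" by (rule pos_in_boxes [OF S x])
  then show "pos S x \<in> boxes \<mu>" using boxes_add_box by blast
  show "entry (add_box \<mu> S (Suc n)) (pos S x) = x"
    using \<open>pos S x \<in> boxes lam\<close> by (simp only: entry_add_box_old entry_pos [OF S x])
qed

lemma prefix_count_add_box: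
  "k \<le> n \<Longrightarrow> prefix_count (row_word (add_box \<mu> S (Suc n))) k m = prefix_count (row_word S) k m"
  by (rule prefix_count_cong)
    (simp add: nth_row_word [OF S] nth_row_word [OF add_box_SYT] partitions_sum [OF lam]
      partitions_sum [OF \<mu>] pos_add_box)

end

lemma add_box_inj:
  assumes "lam \<in> partitions n" "lam' \<in> partitions n" "\<mu> \<in> partitions (Suc n)"
    and "covers \<mu> lam" "covers \<mu> lam'" "S \<in> SYT lam" "S' \<in> SYT lam'"
    and eq: "add_box \<mu> S (Suc n) = add_box \<mu> S' (Suc n)"
  shows "lam = lam' \<and> S = S'"
proof -
  have "boxes lam = boxes lam'"
    using boxes_add_box [OF assms(1,3,4,6)] boxes_add_box [OF assms(2,3,5,7)] eq by simp
  then have lam: "lam = lam'" by (rule partition_eqI [OF assms(1,2)])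
  moreover have "S = S'"
  proof (rule tableau_eqI)
    show "shape S = shape S'" using lam assms by (simp add: SYT_shape)
    fix b assume "b \<in> boxes (shape S)"
    then have "b \<in> boxes lam" using assms by (simp add: SYT_shape)
    then show "entry S b = entry S' b"
      using entry_add_box_old [OF assms(1,3,4,6)] entry_add_box_old [OF assms(2,3,5,7)] eq lam by simp
  qed
  ultimately show ?thesis by simp
qed

lemma remove_corner:
  assumes \<mu>: "\<mu> \<in> partitions (Suc n)" and b: "(r, c) \<in> boxes \<mu>"
    and right: "(r, Suc c) \<notin> boxes \<mu>" and below: "(Suc r, c) \<notin> boxes \<mu>"
  shows "\<exists>lam. lam \<in> partitions n \<and> boxes lam = boxes \<mu> - {(r, c)}"
proof -
  have r: "r < length \<mu>" "\<mu> ! r = Suc c" using b right by (auto simp: boxes_def)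
  have below': "\<mu> ! i \<le> c" if "r < i" "i < length \<mu>" for i
  proof -
    have "\<mu> ! i \<le> \<mu> ! Suc r" using partition_nth_mono [OF \<mu>] that by simp
    moreover have "\<mu> ! Suc r \<le> c" using below that by (auto simp: boxes_def)
    ultimately show ?thesis by simp
  qed
  \<comment> \<open>A corner in column 0 empties its row, which is then the last one; as partitions
    carry no zero parts, that row is dropped instead of being set to 0.\<close>
  define lam where "lam = (if c = 0 then butlast \<mu> else \<mu>[r := c])"
  have last: "Suc r = length \<mu>" if "c = 0"
    using below' [of "Suc r"] partition_nth_pos [OF \<mu>, of "Suc r"] that r(1) by fastforce
  have boxes_lam: "boxes lam = boxes \<mu> - {(r, c)}"
  proof (cases "c = 0")
    case True
    then have "(i, j) \<in> boxes lam \<longleftrightarrow> (i, j) \<in> boxes \<mu> \<and> (i, j) \<noteq> (r, c)" for i j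
      using last r by (cases "i = r") (auto simp: lam_def boxes_def nth_butlast)
    then show ?thesis by auto
  next
    case False
    then have "(i, j) \<in> boxes lam \<longleftrightarrow> (i, j) \<in> boxes \<mu> \<and> (i, j) \<noteq> (r, c)" for i j
      using r by (cases "i = r") (auto simp: lam_def boxes_def)
    then show ?thesis by auto
  qed
  have "sum_list lam = n"
  proof -
    have "card (boxes lam) = card (boxes \<mu>) - 1" using b by (simp add: boxes_lam)
    then show ?thesis using partitions_sum [OF \<mu>] by (simp add: card_boxes)
  qed
  moreover have pos: "0 < lam ! i" if "i < length lam" for i
  proof (cases "c = 0")
    case True
    then show ?thesis using that partition_nth_pos [OF \<mu>, of i] by (simp add: lam_def nth_butlast)
  next
    case False
    then show ?thesis using that partition_nth_pos [OF \<mu>, of i]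
      by (cases "i = r") (simp_all add: lam_def)
  qed
  then have "0 \<notin> set lam" by (metis in_set_conv_nth less_irrefl)
  moreover have "sorted_wrt (\<ge>) lam"
    unfolding sorted_wrt_iff_nth_less
  proof (intro allI impI)
    fix i i' assume i: "i < i'" "i' < length lam"
    show "lam ! i' \<le> lam ! i"
    proof (cases "c = 0")
      case True
      then show ?thesis using i partition_nth_mono [OF \<mu>, of i i'] by (simp add: lam_def nth_butlast)
    next
      case False
      then show ?thesis using i partition_nth_mono [OF \<mu>, of i i'] below' [of i'] r
        by (cases "r = i'") (simp_all add: lam_def nth_list_update)
    qed
  qed
  ultimately show ?thesis using boxes_lam by (auto simp: partitions_def)
qed

text \<open>The largest entry sits in a corner, since anything to its right or below it would be
  larger still. Together with \<open>add_box_inj\<close>, every standard tableau is the extension of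
  exactly one smaller one.\<close>

lemma add_box_surj:
  assumes T: "T \<in> SYT \<mu>" and \<mu>: "\<mu> \<in> partitions (Suc n)"
  shows "\<exists>lam S. lam \<in> partitions n \<and> covers \<mu> lam \<and> S \<in> SYT lam \<and> T = add_box \<mu> S (Suc n)"
proof -
  have n: "sum_list \<mu> = Suc n" using \<mu> by (rule partitions_sum)
  obtain r c where rc: "pos T (Suc n) = (r, c)" by fastforce
  have b: "(r, c) \<in> boxes \<mu>" using pos_in_boxes [OF T, of "Suc n"] n rc by simp
  have e: "entry T (r, c) = Suc n" using entry_pos [OF T, of "Suc n"] n rc by simp
  have max: "entry T b \<le> Suc n" if "b \<in> boxes \<mu>" for b
    using SSYT_entry_range [OF SYT_SSYT [OF T] that] n by simp
  have right: "(r, Suc c) \<notin> boxes \<mu>"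
    using SYT_strict [OF T \<mu>, of r "Suc c" r c] max [of "(r, Suc c)"] e by fastforce
  have below: "(Suc r, c) \<notin> boxes \<mu>"
    using SYT_strict [OF T \<mu>, of "Suc r" c r c] max [of "(Suc r, c)"] e by fastforce
  obtain lam where lam: "lam \<in> partitions n" "boxes lam = boxes \<mu> - {(r, c)}"
    using remove_corner [OF \<mu> b right below] by blast
  have cov: "covers \<mu> lam" using lam b by (auto simp: covers_def)
  define S where "S = map (\<lambda>i. map (\<lambda>j. T ! i ! j) [0..<lam ! i]) [0..<length lam]"
  have shS: "shape S = lam" by (auto simp: S_def shape_def intro: nth_equalityI)
  have eS: "entry S b = entry T b" if "b \<in> boxes lam" for b
    using that by (cases b) (simp add: S_def entry_def boxes_def)
  have SY: "S \<in> SYT lam"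
  proof (rule SYT_I)
    show "S \<in> SSYT lam n"
    proof (rule SSYT_I [OF shS])
      fix b assume b': "b \<in> boxes lam"
      then have "entry T b \<noteq> Suc n"
        using lam e b inj_onD [OF SYT_inj [OF T], of b "(r, c)"] by auto
      then show "entry S b \<in> {1..n}"
        using b' lam SSYT_entry_range [OF SYT_SSYT [OF T], of b] n by (simp add: eS)
    next
      fix i j j' assume b': "(i, j') \<in> boxes lam" "j < j'"
      moreover from b' have "(i, j) \<in> boxes lam" by (auto simp: boxes_def)
      ultimately show "entry S (i, j) \<le> entry S (i, j')"
        using lam SSYT_row_mono [OF SYT_SSYT [OF T], of i j' j] by (simp add: eS)
    next
      fix i j assume b': "(Suc i, j) \<in> boxes lam"
      have "(i, j) \<in> boxes lam" by (rule boxes_down_closed [OF lam(1) b']) auto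
      then show "entry S (i, j) < entry S (Suc i, j)"
        using lam b' SSYT_col_strict [OF SYT_SSYT [OF T] \<mu>, of "Suc i" j i] by (simp add: eS)
    qed
    show "sum_list lam = n" using lam(1) by (rule partitions_sum)
    have "inj_on (entry T) (boxes lam)" using SYT_inj [OF T] lam(2) by (auto intro: inj_on_subset)
    then show "inj_on (entry S) (boxes lam)" by (simp add: eS cong: inj_on_cong)
  qed
  have "T = add_box \<mu> S (Suc n)"
  proof (rule tableau_eqI)
    show "shape T = shape (add_box \<mu> S (Suc n))" by (simp add: SYT_shape [OF T] shape_add_box)
    fix b' assume "b' \<in> boxes (shape T)"
    then have b': "b' \<in> boxes \<mu>" by (simp add: SYT_shape [OF T])
    show "entry T b' = entry (add_box \<mu> S (Suc n)) b'"
    proof (cases "b' \<in> boxes lam")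
      case True
      then show ?thesis using entry_add_box_old [OF lam(1) \<mu> cov SY] by (simp add: eS)
    next
      case False
      then have "b' = (r, c)" using b' lam by auto
      then show ?thesis using entry_add_box_new [OF lam(1) \<mu> cov SY b' False] e by simp
    qed
  qed
  then show ?thesis using lam cov SY by blast
qed

section \<open>Intertwiners and weights\<close>

lemma mmul_assoc: "(M \<odot>\<^bsub>B\<^esub> N) \<odot>\<^bsub>C\<^esub> L = M \<odot>\<^bsub>B\<^esub> (N \<odot>\<^bsub>C\<^esub> L)"
  unfolding mmul_def sum_distrib_left sum_distrib_right
  by (intro ext, subst sum.swap) (simp add: mult.assoc)

lemma meq_refl: "meq A B M M"
  by (simp add: meq_def)

lemma meq_sym: "meq A B M N \<Longrightarrow> meq A B N M"
  by (simp add: meq_def)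

lemma meq_trans [trans]: "meq A B M N \<Longrightarrow> meq A B N L \<Longrightarrow> meq A B M L"
  by (simp add: meq_def)

lemma meq_mmul: "meq A B M M' \<Longrightarrow> meq B C N N' \<Longrightarrow> meq A C (M \<odot>\<^bsub>B\<^esub> N) (M' \<odot>\<^bsub>B\<^esub> N')"
  by (auto simp: meq_def mmul_def intro!: sum.cong)

lemma mone_mmul: "finite A \<Longrightarrow> meq A B (mone \<odot>\<^bsub>A\<^esub> M) M"
  by (simp add: meq_def mmul_def mone_def if_distrib if_distribR cong: if_cong)

lemma mmul_mone: "finite B \<Longrightarrow> meq A B (M \<odot>\<^bsub>B\<^esub> mone) M"
  by (simp add: meq_def mmul_def mone_def if_distrib if_distribR cong: if_cong)

lemma madj_mmul: "madj (M \<odot>\<^bsub>B\<^esub> N) = madj N \<odot>\<^bsub>B\<^esub> madj M"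
  by (simp add: madj_def mmul_def mult.commute)

lemma madj_madj [simp]: "madj (madj M) = M"
  by (simp add: madj_def)

lemma inverse_mat_mmul:
  assumes "inverse_mat A B M M'" "inverse_mat B C N N'" "finite A" "finite B" "finite C"
  shows "inverse_mat A C (M \<odot>\<^bsub>B\<^esub> N) (N' \<odot>\<^bsub>B\<^esub> M')"
proof -
  have *: "meq A A ((M \<odot>\<^bsub>B\<^esub> N) \<odot>\<^bsub>C\<^esub> (N' \<odot>\<^bsub>B\<^esub> M')) mone"
    if M: "meq A A (M \<odot>\<^bsub>B\<^esub> M') mone" and N: "meq B B (N \<odot>\<^bsub>C\<^esub> N') mone" and fin: "finite B"
    for A :: "'p set" and B :: "'r set" and C :: "'s set" and M M' N N'
  proof -
    have "(M \<odot>\<^bsub>B\<^esub> N) \<odot>\<^bsub>C\<^esub> (N' \<odot>\<^bsub>B\<^esub> M') = M \<odot>\<^bsub>B\<^esub> ((N \<odot>\<^bsub>C\<^esub> N') \<odot>\<^bsub>B\<^esub> M')"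
      by (simp only: mmul_assoc)
    moreover have "meq A A (M \<odot>\<^bsub>B\<^esub> ((N \<odot>\<^bsub>C\<^esub> N') \<odot>\<^bsub>B\<^esub> M')) (M \<odot>\<^bsub>B\<^esub> M')"
      by (intro meq_mmul meq_refl meq_trans [OF meq_mmul [OF N meq_refl] mone_mmul] fin)
    ultimately show ?thesis using M meq_trans by metis
  qed
  show ?thesis
    using assms by (simp add: inverse_mat_def *)
qed

lemma unitary_mmul:
  assumes "unitary_mat A B M" "unitary_mat B C N" "finite A" "finite B" "finite C"
  shows "unitary_mat A C (M \<odot>\<^bsub>B\<^esub> N)"
  using inverse_mat_mmul [of A B M _ C N] assms by (simp add: unitary_mat_def madj_mmul)

lemma unitary_madj: "unitary_mat A B M \<Longrightarrow> unitary_mat B A (madj M)"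
  by (simp add: unitary_mat_def inverse_mat_def)

lemma inverse_mat_unique:
  assumes "inverse_mat A B M N" "inverse_mat A B M N'" "finite A" "finite B"
  shows "meq B A N N'"
proof -
  have MN: "meq A A (M \<odot>\<^bsub>B\<^esub> N') mone" and NM: "meq B B (N \<odot>\<^bsub>A\<^esub> M) mone"
    using assms(1,2) by (simp_all add: inverse_mat_def)
  have "meq B A N (N \<odot>\<^bsub>A\<^esub> mone)" by (rule meq_sym [OF mmul_mone [OF assms(3)]])
  also have "meq B A (N \<odot>\<^bsub>A\<^esub> mone) (N \<odot>\<^bsub>A\<^esub> (M \<odot>\<^bsub>B\<^esub> N'))"
    by (rule meq_mmul [OF meq_refl meq_sym [OF MN]])
  also have "meq B A (N \<odot>\<^bsub>A\<^esub> (M \<odot>\<^bsub>B\<^esub> N')) (mone \<odot>\<^bsub>B\<^esub> N')"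
    unfolding mmul_assoc [symmetric] by (rule meq_mmul [OF NM meq_refl])
  also have "meq B A (mone \<odot>\<^bsub>B\<^esub> N') N'" by (rule mone_mmul [OF assms(4)])
  finally show ?thesis .
qed

text \<open>Uniqueness of inverses removes the choice in \<open>minv\<close>; it fixes only the
  entries inside the index sets, hence the membership premises.\<close>

lemma minv_eq:
  assumes "inverse_mat A B M N" "finite A" "finite B" "b \<in> B" "a \<in> A"
  shows "minv A B M b a = N b a"
proof -
  have "inverse_mat A B M (minv A B M)" unfolding minv_def by (rule someI [of "inverse_mat A B M" N]) (rule assms(1))
  from inverse_mat_unique [OF this assms(1-3)] show ?thesis using assms(4,5) by (simp add: meq_def)
qed

lemma uq_intertwiner_mmul:
  assumes "uq_intertwiner q d A \<rho> B \<sigma> M" "uq_intertwiner q d B \<sigma> C \<tau> N"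
  shows "uq_intertwiner q d A \<rho> C \<tau> (M \<odot>\<^bsub>B\<^esub> N)"
  unfolding uq_intertwiner_def
proof
  fix g assume g: "g \<in> uq_gens q d"
  have "meq A C (M \<odot>\<^bsub>B\<^esub> (N \<odot>\<^bsub>C\<^esub> \<tau> g)) (M \<odot>\<^bsub>B\<^esub> (\<sigma> g \<odot>\<^bsub>B\<^esub> N))"
    using assms(2) g by (intro meq_mmul meq_refl) (simp add: uq_intertwiner_def)
  moreover have "meq A C ((M \<odot>\<^bsub>B\<^esub> \<sigma> g) \<odot>\<^bsub>B\<^esub> N) ((\<rho> g \<odot>\<^bsub>A\<^esub> M) \<odot>\<^bsub>B\<^esub> N)"
    using assms(1) g by (intro meq_mmul meq_refl) (simp add: uq_intertwiner_def)
  ultimately show "meq A C (M \<odot>\<^bsub>B\<^esub> N \<odot>\<^bsub>C\<^esub> \<tau> g) (\<rho> g \<odot>\<^bsub>A\<^esub> (M \<odot>\<^bsub>B\<^esub> N))"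
    unfolding mmul_assoc by (rule meq_trans)
qed

text \<open>By unitarity the adjoint is the inverse, and the inverse of an intertwiner intertwines
  in the other direction. Adjoints of the generators never have to be computed.\<close>

lemma uq_intertwiner_madj:
  assumes M: "uq_intertwiner q d A \<rho> B \<sigma> M" and U: "unitary_mat A B M" and fin: "finite A" "finite B"
  shows "uq_intertwiner q d B \<sigma> A \<rho> (madj M)"
  unfolding uq_intertwiner_def
proof
  let ?N = "madj M"
  fix g assume g: "g \<in> uq_gens q d"
  have MN: "meq A A (M \<odot>\<^bsub>B\<^esub> ?N) mone" and NM: "meq B B (?N \<odot>\<^bsub>A\<^esub> M) mone"
    using U by (auto simp: unitary_mat_def inverse_mat_def)
  have "meq B A (?N \<odot>\<^bsub>A\<^esub> \<rho> g) ((?N \<odot>\<^bsub>A\<^esub> \<rho> g) \<odot>\<^bsub>A\<^esub> mone)"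
    by (rule meq_sym [OF mmul_mone [OF fin(1)]])
  also have "meq B A ((?N \<odot>\<^bsub>A\<^esub> \<rho> g) \<odot>\<^bsub>A\<^esub> mone) ((?N \<odot>\<^bsub>A\<^esub> \<rho> g) \<odot>\<^bsub>A\<^esub> (M \<odot>\<^bsub>B\<^esub> ?N))"
    by (rule meq_mmul [OF meq_refl meq_sym [OF MN]])
  also have "(?N \<odot>\<^bsub>A\<^esub> \<rho> g) \<odot>\<^bsub>A\<^esub> (M \<odot>\<^bsub>B\<^esub> ?N) = ?N \<odot>\<^bsub>A\<^esub> ((\<rho> g \<odot>\<^bsub>A\<^esub> M) \<odot>\<^bsub>B\<^esub> ?N)"
    by (simp only: mmul_assoc)
  also have "meq B A (?N \<odot>\<^bsub>A\<^esub> ((\<rho> g \<odot>\<^bsub>A\<^esub> M) \<odot>\<^bsub>B\<^esub> ?N)) (?N \<odot>\<^bsub>A\<^esub> ((M \<odot>\<^bsub>B\<^esub> \<sigma> g) \<odot>\<^bsub>B\<^esub> ?N))"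
    by (rule meq_mmul [OF meq_refl meq_mmul [OF meq_sym meq_refl]])
      (use M g in \<open>simp add: uq_intertwiner_def\<close>)
  also have "?N \<odot>\<^bsub>A\<^esub> ((M \<odot>\<^bsub>B\<^esub> \<sigma> g) \<odot>\<^bsub>B\<^esub> ?N) = (?N \<odot>\<^bsub>A\<^esub> M) \<odot>\<^bsub>B\<^esub> (\<sigma> g \<odot>\<^bsub>B\<^esub> ?N)"
    by (simp only: mmul_assoc)
  also have "meq B A ((?N \<odot>\<^bsub>A\<^esub> M) \<odot>\<^bsub>B\<^esub> (\<sigma> g \<odot>\<^bsub>B\<^esub> ?N)) (mone \<odot>\<^bsub>B\<^esub> (\<sigma> g \<odot>\<^bsub>B\<^esub> ?N))"
    by (rule meq_mmul [OF NM meq_refl])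
  also have "meq B A (mone \<odot>\<^bsub>B\<^esub> (\<sigma> g \<odot>\<^bsub>B\<^esub> ?N)) (\<sigma> g \<odot>\<^bsub>B\<^esub> ?N)"
    by (rule mone_mmul [OF fin(2)])
  finally show "meq B A (?N \<odot>\<^bsub>A\<^esub> \<rho> g) (\<sigma> g \<odot>\<^bsub>B\<^esub> ?N)" .
qed

section \<open>Action on vectors and the Cartan part\<close>

lemma mvec_add: "mvec B M (\<lambda>b. x b + y b) = (\<lambda>b. mvec B M x b + mvec B M y b)"
  by (auto simp: mvec_def fun_eq_iff distrib_left sum.distrib)

lemma mvec_scale: "mvec B M (\<lambda>b. c * x b) = (\<lambda>b. c * mvec B M x b)"
  by (auto simp: mvec_def fun_eq_iff sum_distrib_left mult.left_commute)

lemma mvec_zero: "mvec B M (\<lambda>_. 0) = (\<lambda>_. 0)"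
  by (auto simp: mvec_def)

lemma mvec_mvec: "mvec B M (mvec B N x) = mvec B (M \<odot>\<^bsub>B\<^esub> N) x"
proof -
  have "(\<Sum>b\<in>B. M a b * (\<Sum>c\<in>B. N b c * x c)) = (\<Sum>c\<in>B. (\<Sum>b\<in>B. M a b * N b c) * x c)" for a
    unfolding sum_distrib_left sum_distrib_right by (subst sum.swap) (simp add: mult.assoc)
  then show ?thesis by (auto simp: mvec_def mmul_def fun_eq_iff)
qed

lemma mvec_meq: "meq B B M N \<Longrightarrow> mvec B M x = mvec B N x"
  by (auto simp: meq_def mvec_def fun_eq_iff)

lemma mvec_in_vecs: "mvec B M x \<in> vecs B"
  by (simp add: mvec_def vecs_def)

lemma mvec_mone: "finite B \<Longrightarrow> x \<in> vecs B \<Longrightarrow> mvec B mone x = x"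
  by (auto simp: mvec_def mone_def vecs_def fun_eq_iff if_distrib if_distribR cong: if_cong)

lemma basis_vec_in_vecs: "b \<in> B \<Longrightarrow> basis_vec b \<in> vecs B"
  by (auto simp: basis_vec_def vecs_def)

lemma mvec_basis_vec: "finite B \<Longrightarrow> b \<in> B \<Longrightarrow> mvec B M (basis_vec b) = (\<lambda>a. if a \<in> B then M a b else 0)"
  by (auto simp: mvec_def basis_vec_def fun_eq_iff if_distrib cong: if_cong)

text \<open>The eigenspace of \<open>D\<close> in \<open>X\<close> is invariant, so it is all of \<open>X\<close>.\<close>

lemma irreducible_scalar:
  assumes irr: "irreducible_subspace q k B \<rho> X"
    and add: "\<And>x y. D (\<lambda>b. x b + y b) = (\<lambda>b. D x b + D y b)"
    and scale: "\<And>c x. D (\<lambda>b. c * x b) = (\<lambda>b. c * D x b)"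
    and comm: "\<And>g x. g \<in> uq_gens q k \<Longrightarrow> x \<in> X \<Longrightarrow> D (mvec B (\<rho> g) x) = mvec B (\<rho> g) (D x)"
    and x0: "x0 \<in> X" "x0 \<noteq> (\<lambda>_. 0)" "D x0 = (\<lambda>b. c * x0 b)"
    and x: "x \<in> X"
  shows "D x = (\<lambda>b. c * x b)"
proof -
  define Y where "Y = {x \<in> X. D x = (\<lambda>b. c * x b)}"
  have sub: "subspace_of B X" and inv: "\<And>g x. g \<in> uq_gens q k \<Longrightarrow> x \<in> X \<Longrightarrow> mvec B (\<rho> g) x \<in> X"
    using irr by (auto simp: irreducible_subspace_def invariant_subspace_def)
  have D0: "D (\<lambda>_. 0) = (\<lambda>_. 0)" using scale [of 0 "\<lambda>_. 0"] by simp
  have "subspace_of B Y"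
    using sub by (auto simp: subspace_of_def Y_def D0 add scale algebra_simps)
  moreover have "mvec B (\<rho> g) y \<in> Y" if "g \<in> uq_gens q k" "y \<in> Y" for g y
    using that inv comm by (simp add: Y_def mvec_scale)
  ultimately have "invariant_subspace q k B \<rho> Y" by (simp add: invariant_subspace_def)
  moreover have "Y \<subseteq> X" by (auto simp: Y_def)
  moreover have "x0 \<in> Y" using x0 by (simp add: Y_def)
  ultimately have "Y = X" using irr x0(2) by (auto simp: irreducible_subspace_def)
  then show ?thesis using x by (auto simp: Y_def)
qed

text \<open>The action of \<open>q\<^bsup>(h\<^sub>1 + \<dots> + h\<^sub>k)/2\<^esup>\<close>, or of \<open>h\<^sub>1 + \<dots> + h\<^sub>k\<close> for \<open>q = 1\<close>, which is central in
  \<open>U\<^sub>q(k)\<close>. Its eigenvalues on a copy of an irreducible representation count boxes, which makes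
  every Gelfand-Tsetlin-Jimbo basis vector a weight vector.\<close>

primrec cartan_op :: "real \<Rightarrow> 'b set \<Rightarrow> 'b rep \<Rightarrow> nat \<Rightarrow> ('b \<Rightarrow> complex) \<Rightarrow> 'b \<Rightarrow> complex" where
  "cartan_op q B \<rho> 0 x = (if q = 1 then (\<lambda>_. 0) else x)"
| "cartan_op q B \<rho> (Suc k) x =
    (if q = 1 then (\<lambda>b. mvec B (\<rho> (GenH (Suc k))) x b + cartan_op q B \<rho> k x b)
     else mvec B (\<rho> (GenK (Suc k))) (cartan_op q B \<rho> k x))"

lemma cartan_op_add: "cartan_op q B \<rho> k (\<lambda>b. x b + y b) = (\<lambda>b. cartan_op q B \<rho> k x b + cartan_op q B \<rho> k y b)"
  by (induction k; cases "q = 1") (simp_all add: mvec_add add_ac)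

lemma cartan_op_scale: "cartan_op q B \<rho> k (\<lambda>b. c * x b) = (\<lambda>b. c * cartan_op q B \<rho> k x b)"
  by (induction k; cases "q = 1") (simp_all add: mvec_scale distrib_left)

lemma cartan_op_in_vecs: "x \<in> vecs B \<Longrightarrow> cartan_op q B \<rho> k x \<in> vecs B"
  by (induction k) (auto simp: vecs_def mvec_def)

definition weight_eig :: "real \<Rightarrow> real \<Rightarrow> complex" where
  "weight_eig q r = complex_of_real (if q = 1 then r else q powr (r / 2))"

lemma weight_eig_inj: "q > 0 \<Longrightarrow> weight_eig q r = weight_eig q s \<Longrightarrow> r = s"
  by (auto simp: weight_eig_def powr_inj split: if_splits)

definition cartan_gen :: "real \<Rightarrow> nat \<Rightarrow> gen" where
  "cartan_gen q i = (if q = 1 then GenH i else GenK i)"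

lemma cartan_op_eig:
  assumes "q > 0" "\<And>i. i \<in> {1..k} \<Longrightarrow> mvec B (\<rho> (cartan_gen q i)) x = (\<lambda>b. weight_eig q (c i) * x b)"
  shows "cartan_op q B \<rho> k x = (\<lambda>b. weight_eig q (\<Sum>i=1..k. c i) * x b)"
  using assms(2)
proof (induction k)
  case 0
  then show ?case using assms(1) by (simp add: weight_eig_def)
next
  case (Suc k)
  have IH: "cartan_op q B \<rho> k x = (\<lambda>b. weight_eig q (\<Sum>i=1..k. c i) * x b)"
    using Suc by simp
  have K: "mvec B (\<rho> (cartan_gen q (Suc k))) x = (\<lambda>b. weight_eig q (c (Suc k)) * x b)"
    using Suc.prems by simp
  show ?case
  proof (cases "q = 1")
    case True
    then show ?thesis using IH K
      by (simp add: weight_eig_def cartan_gen_def algebra_simps)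
  next
    case False
    then show ?thesis using IH K assms(1)
      by (simp add: mvec_scale weight_eig_def cartan_gen_def powr_add add_divide_distrib)
        (simp add: mult_ac)
  qed
qed

text \<open>Moving \<open>X\<close> past the Cartan factor \<open>i\<close> costs a scalar given by
  \<open>w i\<close>, and the costs cancel in total. Partial products need not commute with
  \<open>X\<close>, so the inductions carry the accumulated scalar.\<close>

lemma cartan_op_commute_weight:
  assumes X: "q \<noteq> 1 \<Longrightarrow> \<forall>i\<in>{1..k}. meq B B (\<rho> (GenK i) \<odot>\<^bsub>B\<^esub> X) (\<lambda>a b. complex_of_real (q powr (w i / 2)) * (X \<odot>\<^bsub>B\<^esub> \<rho> (GenK i)) a b)"
    and X1: "q = 1 \<Longrightarrow> \<forall>i\<in>{1..k}. meq B B (\<rho> (GenH i) \<odot>\<^bsub>B\<^esub> X) (\<lambda>a b. (X \<odot>\<^bsub>B\<^esub> \<rho> (GenH i)) a b + complex_of_real (w i) * X a b)"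
    and q: "q > 0" and sum: "(\<Sum>i=1..k. w i) = 0"
  shows "cartan_op q B \<rho> k (mvec B X x) = mvec B X (cartan_op q B \<rho> k x)"
proof (cases "q = 1")
  case True
  have "cartan_op q B \<rho> l (mvec B X x)
      = (\<lambda>b. mvec B X (cartan_op q B \<rho> l x) b + complex_of_real (\<Sum>i=1..l. w i) * mvec B X x b)" if "l \<le> k" for l
    using that
  proof (induction l)
    case (Suc l)
    have "mvec B (\<rho> (GenH (Suc l))) (mvec B X x)
        = mvec B (\<lambda>a b. (X \<odot>\<^bsub>B\<^esub> \<rho> (GenH (Suc l))) a b + complex_of_real (w (Suc l)) * X a b) x"
      unfolding mvec_mvec using X1 [OF True] Suc.prems by (intro mvec_meq) simp
    also have "\<dots> = (\<lambda>b. mvec B X (mvec B (\<rho> (GenH (Suc l))) x) b + complex_of_real (w (Suc l)) * mvec B X x b)"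
      unfolding mvec_mvec
      by (auto simp: mvec_def fun_eq_iff distrib_right sum.distrib sum_distrib_left mult.assoc)
    finally show ?case using Suc True by (simp add: mvec_add fun_eq_iff algebra_simps)
  qed (use True in \<open>simp add: mvec_zero\<close>)
  from this [of k] show ?thesis using sum by (simp del: of_real_sum)
next
  case False
  have "cartan_op q B \<rho> l (mvec B X x)
      = (\<lambda>b. complex_of_real (q powr ((\<Sum>i=1..l. w i) / 2)) * mvec B X (cartan_op q B \<rho> l x) b)" if "l \<le> k" for l
    using that
  proof (induction l)
    case (Suc l)
    have "mvec B (\<rho> (GenK (Suc l))) (mvec B X y)
        = (\<lambda>b. complex_of_real (q powr (w (Suc l) / 2)) * mvec B X (mvec B (\<rho> (GenK (Suc l))) y) b)" for y
    proof -
      have "mvec B (\<rho> (GenK (Suc l))) (mvec B X y)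
        = mvec B (\<lambda>a b. complex_of_real (q powr (w (Suc l) / 2)) * (X \<odot>\<^bsub>B\<^esub> \<rho> (GenK (Suc l))) a b) y"
        unfolding mvec_mvec using X [OF False] Suc.prems by (intro mvec_meq) simp
      also have "\<dots> = (\<lambda>b. complex_of_real (q powr (w (Suc l) / 2)) * mvec B X (mvec B (\<rho> (GenK (Suc l))) y) b)"
        unfolding mvec_mvec by (auto simp: mvec_def fun_eq_iff sum_distrib_left mult.assoc)
      finally show ?thesis .
    qed
    then show ?case using Suc False q
      by (simp add: mvec_scale powr_add add_divide_distrib) (simp add: mult_ac)
  qed (use False q in simp)
  from this [of k] show ?thesis using sum q by (simp del: of_real_sum)
qed

text \<open>\<open>e_j\<close> moves one unit of weight between the indices \<open>j\<close> and
  \<open>j + 1\<close>; for \<open>j < k\<close> both are counted.\<close>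

lemma sum_wt: "1 \<le> j \<Longrightarrow> j < k \<Longrightarrow> (\<Sum>i=1..k. wt i j) = 0"
  by (simp add: wt_def sum_subtractf of_bool_def)

lemma cartan_op_commute:
  assumes rep: "uq_rep q d B \<rho>" and q: "q > 0" and k: "k \<le> d" and g: "g \<in> uq_gens q k"
    and fin: "finite B" and x: "x \<in> vecs B"
  shows "cartan_op q B \<rho> k (mvec B (\<rho> g) x) = mvec B (\<rho> g) (cartan_op q B \<rho> k x)"
proof -
  have cr: "cartan_relations q d B \<rho>" using rep by (simp add: uq_rep_def)
  have relK: "(\<rho> (GenK i) \<odot>\<^bsub>B\<^esub> \<rho> (GenE j)) a b
        = complex_of_real (q powr (wt i j / 2)) * (\<rho> (GenE j) \<odot>\<^bsub>B\<^esub> \<rho> (GenK i)) a b \<and>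
      (\<rho> (GenK i) \<odot>\<^bsub>B\<^esub> \<rho> (GenF j)) a b
        = complex_of_real (q powr (- wt i j / 2)) * (\<rho> (GenF j) \<odot>\<^bsub>B\<^esub> \<rho> (GenK i)) a b"
    if "q \<noteq> 1" "i \<in> {1..k}" "j \<in> {1..<k}" "a \<in> B" "b \<in> B" for i j a b
    using cr that k by (simp add: cartan_relations_def)
  have relH: "(\<rho> (GenH i) \<odot>\<^bsub>B\<^esub> \<rho> (GenE j)) a b
        = (\<rho> (GenE j) \<odot>\<^bsub>B\<^esub> \<rho> (GenH i)) a b + complex_of_real (wt i j) * \<rho> (GenE j) a b \<and>
      (\<rho> (GenH i) \<odot>\<^bsub>B\<^esub> \<rho> (GenF j)) a b
        = (\<rho> (GenF j) \<odot>\<^bsub>B\<^esub> \<rho> (GenH i)) a b + complex_of_real (- wt i j) * \<rho> (GenF j) a b"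
    if "q = 1" "i \<in> {1..k}" "j \<in> {1..<k}" "a \<in> B" "b \<in> B" for i j a b
  proof -
    have "(\<rho> (GenH i) \<odot>\<^bsub>B\<^esub> \<rho> (GenE j)) a b - (\<rho> (GenE j) \<odot>\<^bsub>B\<^esub> \<rho> (GenH i)) a b
          = complex_of_real (wt i j) * \<rho> (GenE j) a b \<and>
        (\<rho> (GenH i) \<odot>\<^bsub>B\<^esub> \<rho> (GenF j)) a b - (\<rho> (GenF j) \<odot>\<^bsub>B\<^esub> \<rho> (GenH i)) a b
          = - complex_of_real (wt i j) * \<rho> (GenF j) a b"
      using cr that k by (simp add: cartan_relations_def)
    then show ?thesis by (simp add: diff_eq_eq add.commute)
  qed
  have E: "cartan_op q B \<rho> k (mvec B (\<rho> (GenE j)) x) = mvec B (\<rho> (GenE j)) (cartan_op q B \<rho> k x)"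
    if j: "j \<in> {1..<k}" for j
  proof (rule cartan_op_commute_weight [where w = "\<lambda>i. wt i j"])
    show "(\<Sum>i=1..k. wt i j) = 0" using j by (intro sum_wt) auto
  qed (use relK relH j q in \<open>simp_all add: meq_def\<close>)
  have F: "cartan_op q B \<rho> k (mvec B (\<rho> (GenF j)) x) = mvec B (\<rho> (GenF j)) (cartan_op q B \<rho> k x)"
    if j: "j \<in> {1..<k}" for j
  proof (rule cartan_op_commute_weight [where w = "\<lambda>i. - wt i j"])
    show "(\<Sum>i=1..k. - wt i j) = 0" using j sum_wt [of j k] by (simp add: sum_negf)
  qed (use relK relH j q in \<open>simp_all add: meq_def\<close>)
  have H: "cartan_op q B \<rho> k (mvec B (\<rho> (GenH j)) x) = mvec B (\<rho> (GenH j)) (cartan_op q B \<rho> k x)"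
    if j: "j \<in> {1..k}" "q = 1" for j
    by (rule cartan_op_commute_weight [where w = "\<lambda>_. 0"])
      (use cr j k q in \<open>auto simp: cartan_relations_def meq_def\<close>)
  have K: "cartan_op q B \<rho> k (mvec B (\<rho> (GenK j)) y) = mvec B (\<rho> (GenK j)) (cartan_op q B \<rho> k y)"
    if j: "j \<in> {1..k}" "q \<noteq> 1" for j y
    by (rule cartan_op_commute_weight [where w = "\<lambda>_. 0"])
      (use cr j k q in \<open>auto simp: cartan_relations_def meq_def\<close>)
  \<comment> \<open>The defining relations mention \<open>GenKinv j\<close> only as the inverse of
    \<open>GenK j\<close>, so its commutation is transferred through that inverse.\<close>
  have Ki: "cartan_op q B \<rho> k (mvec B (\<rho> (GenKinv j)) x) = mvec B (\<rho> (GenKinv j)) (cartan_op q B \<rho> k x)"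
    if j: "j \<in> {1..k}" "q \<noteq> 1" for j
  proof -
    let ?K = "\<rho> (GenK j)" and ?L = "\<rho> (GenKinv j)" and ?D = "cartan_op q B \<rho> k"
    have inv: "inverse_mat B B ?K ?L" using cr j k by (auto simp: cartan_relations_def)
    have LK: "mvec B ?L (mvec B ?K y) = y" if "y \<in> vecs B" for y
      unfolding mvec_mvec using inv that mvec_meq [of B "?L \<odot>\<^bsub>B\<^esub> ?K" mone y] mvec_mone [OF fin]
      by (simp add: inverse_mat_def)
    have KL: "mvec B ?K (mvec B ?L y) = y" if "y \<in> vecs B" for y
      unfolding mvec_mvec using inv that mvec_meq [of B "?K \<odot>\<^bsub>B\<^esub> ?L" mone y] mvec_mone [OF fin]
      by (simp add: inverse_mat_def)
    have "?D (mvec B ?L x) = mvec B ?L (mvec B ?K (?D (mvec B ?L x)))"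
      by (rule LK [symmetric]) (rule cartan_op_in_vecs, rule mvec_in_vecs)
    also have "mvec B ?K (?D (mvec B ?L x)) = ?D x"
      using K [OF j, of "mvec B ?L x"] KL [OF x] by simp
    finally show ?thesis .
  qed
  show ?thesis using g E F H K Ki by (auto simp: uq_gens_def split: if_splits)
qed

text \<open>Weights are kept as multisets of letters. Confining them to \<open>{1..d}\<close> lets
  the eigenvalues of the \<open>d\<close> Cartan generators determine the whole multiset.\<close>

definition weight_basis :: "real \<Rightarrow> nat \<Rightarrow> 'b set \<Rightarrow> 'b rep \<Rightarrow> ('b \<Rightarrow> nat multiset) \<Rightarrow> bool" where
  "weight_basis q d B \<rho> \<omega> \<longleftrightarrow> (\<forall>b\<in>B. set_mset (\<omega> b) \<subseteq> {1..d}) \<and>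
     (\<forall>i\<in>{1..d}. meq B B (\<rho> (cartan_gen q i))
        (\<lambda>a b. if a = b then weight_eig q (real (count (\<omega> b) i)) else 0))"

lemma cartan_gen_in_gens: "i \<in> {1..d} \<Longrightarrow> cartan_gen q i \<in> uq_gens q d"
  by (auto simp: cartan_gen_def uq_gens_def)

text \<open>At \<open>(a, b)\<close> the intertwining relation for a diagonal generator says that a
  nonzero \<open>M a b\<close> is multiplied by the same number from both sides; eigenvalues
  determine multiplicities because \<open>q > 0\<close>.\<close>

lemma intertwiner_weight:
  assumes A: "weight_basis q d A \<rho> \<alpha>" and B: "weight_basis q d B \<sigma> \<beta>"
    and M: "uq_intertwiner q d A \<rho> B \<sigma> M" and fin: "finite A" "finite B" and q: "q > 0"
    and ab: "a \<in> A" "b \<in> B" and nz: "M a b \<noteq> 0"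
  shows "\<alpha> a = \<beta> b"
proof (rule multiset_eqI)
  fix i
  show "count (\<alpha> a) i = count (\<beta> b) i"
  proof (cases "i \<in> {1..d}")
    case True
    have s: "\<sigma> (cartan_gen q i) b' b = (if b' = b then weight_eig q (real (count (\<beta> b) i)) else 0)" if "b' \<in> B" for b'
      using B True that ab by (simp add: weight_basis_def meq_def)
    have r: "\<rho> (cartan_gen q i) a a' = (if a' = a then weight_eig q (real (count (\<alpha> a) i)) else 0)" if "a' \<in> A" for a'
      using A True that ab by (simp add: weight_basis_def meq_def)
    have "(\<Sum>b'\<in>B. M a b' * \<sigma> (cartan_gen q i) b' b) = (\<Sum>a'\<in>A. \<rho> (cartan_gen q i) a a' * M a' b)"
      using M ab cartan_gen_in_gens [OF True] by (simp add: uq_intertwiner_def meq_def mmul_def)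
    moreover have "(\<Sum>b'\<in>B. M a b' * \<sigma> (cartan_gen q i) b' b) = M a b * weight_eig q (real (count (\<beta> b) i))"
      using ab fin by (simp add: s if_distrib cong: if_cong sum.cong)
    moreover have "(\<Sum>a'\<in>A. \<rho> (cartan_gen q i) a a' * M a' b) = weight_eig q (real (count (\<alpha> a) i)) * M a b"
    proof -
      have "(\<Sum>a'\<in>A. \<rho> (cartan_gen q i) a a' * M a' b)
          = (\<Sum>a'\<in>A. if a' = a then weight_eig q (real (count (\<alpha> a) i)) * M a b else 0)"
        by (rule sum.cong) (auto simp: r)
      then show ?thesis using ab fin by simp
    qed
    ultimately have "weight_eig q (real (count (\<alpha> a) i)) = weight_eig q (real (count (\<beta> b) i))"
      using nz by simp
    then show ?thesis using weight_eig_inj [OF q] by fastforce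
  next
    case False
    have "set_mset (\<alpha> a) \<subseteq> {1..d}" "set_mset (\<beta> b) \<subseteq> {1..d}"
      using A B ab by (simp_all add: weight_basis_def)
    with False have "i \<notin># \<alpha> a" "i \<notin># \<beta> b" by blast+
    then show ?thesis by (simp add: not_in_iff)
  qed
qed

lemma sum_part: "length \<nu> \<le> k \<Longrightarrow> (\<Sum>i=1..k. part \<nu> i) = sum_list \<nu>"
proof -
  assume len: "length \<nu> \<le> k"
  have "(\<Sum>i=1..k. part \<nu> i) = (\<Sum>i=1..length \<nu>. part \<nu> i)"
    using len by (intro sum.mono_neutral_right) (auto simp: Defs.part_def)
  also have "\<dots> = (\<Sum>i\<in>{..<length \<nu>}. \<nu> ! i)"
    by (rule sum.reindex_bij_witness [where i = Suc and j = "\<lambda>i. i - 1"]) (auto simp: Defs.part_def)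
  finally show ?thesis by (simp add: sum_list_sum_nth lessThan_atLeast0)
qed

text \<open>The eigenvalues of \<open>cartan_op\<close> at \<open>k\<close> and at
  \<open>Suc k\<close> count the entries at most \<open>k\<close> and at most \<open>Suc k\<close>;
  their quotient, or their difference for \<open>q = 1\<close>, is the eigenvalue of the single
  Cartan generator.\<close>

lemma gtj_weight_basis:
  assumes gtj: "gtj_irrep q d lam \<rho>" and lam: "lam \<in> partitions n" and q: "q > 0"
  shows "weight_basis q d (SSYT lam d) \<rho> (\<lambda>t. mset (concat t))"
proof -
  let ?B = "SSYT lam d"
  have rep: "uq_rep q d ?B \<rho>" using gtj by (simp add: gtj_irrep_def uq_star_rep_def Let_def)
  define below where "below t k = size (filter_mset (\<lambda>x. x \<le> k) (mset (concat t)))" for t :: tableau and k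
  have op: "cartan_op q ?B \<rho> k (basis_vec t) = (\<lambda>b. weight_eig q (real (below t k)) * basis_vec t b)"
    if t: "t \<in> ?B" and k: "k \<le> d" for t k
  \<comment> \<open>\<open>gtj_irrep\<close> speaks of \<open>k \<ge> 1\<close> only; the value at 0
    is the starting point for the first generator.\<close>
  proof (cases "k = 0")
    case True
    have "x \<noteq> 0" if "x \<in> set (concat t)" for x using t that unfolding SSYT_def by fastforce
    then have "filter (\<lambda>x. x \<le> 0) (concat t) = []" unfolding filter_empty_conv by simp
    then have "below t 0 = 0" unfolding below_def by (metis list.size(3) mset_filter size_mset)
    then show ?thesis using True q by (simp add: weight_eig_def)
  next
    case False
    let ?\<nu> = "shape (tab_le k t)"
    obtain X where X: "copy_of_irrep q k ?B \<rho> ?\<nu> X" "basis_vec t \<in> X"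
      using gtj t k False by (auto simp: gtj_irrep_def Let_def) (meson One_nat_def Suc_leI atLeastAtMost_iff neq0_conv)
    then have irr: "irreducible_subspace q k ?B \<rho> X" by (simp add: copy_of_irrep_def)
    have Xv: "X \<subseteq> vecs ?B"
      using irr by (simp add: irreducible_subspace_def invariant_subspace_def subspace_of_def)
    obtain x0 where x0: "x0 \<in> X" "highest_weight_vec q k ?B \<rho> ?\<nu> x0"
      using X(1) by (auto simp: copy_of_irrep_def)
    have "cartan_op q ?B \<rho> k x0 = (\<lambda>b. weight_eig q (\<Sum>i=1..k. real (part ?\<nu> i)) * x0 b)"
    proof (rule cartan_op_eig [OF q])
      fix i assume "i \<in> {1..k}"
      then show "mvec ?B (\<rho> (cartan_gen q i)) x0 = (\<lambda>b. weight_eig q (real (part ?\<nu> i)) * x0 b)"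
        using x0(2) unfolding highest_weight_vec_def by (cases "q = 1") (simp_all add: cartan_gen_def weight_eig_def)
    qed
    moreover have "(\<Sum>i=1..k. real (part ?\<nu> i)) = real (below t k)"
    proof -
      have "length ?\<nu> \<le> k" using length_tab_le [OF t lam, of k] by (simp add: shape_def)
      then have "(\<Sum>i=1..k. part ?\<nu> i) = length (concat (tab_le k t))"
        by (simp only: sum_part sum_list_shape)
      also have "\<dots> = below t k" unfolding concat_tab_le below_def by (metis mset_filter size_mset)
      finally show ?thesis by (metis of_nat_sum)
    qed
    ultimately have D: "cartan_op q ?B \<rho> k x0 = (\<lambda>b. weight_eig q (real (below t k)) * x0 b)" by simp
    show ?thesis
    proof (rule irreducible_scalar [OF irr cartan_op_add cartan_op_scale _ x0(1) _ D X(2)])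
      show "x0 \<noteq> (\<lambda>_. 0)" using x0(2) by (simp add: highest_weight_vec_def)
      fix g x assume "g \<in> uq_gens q k" "x \<in> X"
      then show "cartan_op q ?B \<rho> k (mvec ?B (\<rho> g) x) = mvec ?B (\<rho> g) (cartan_op q ?B \<rho> k x)"
        using Xv by (intro cartan_op_commute [OF rep q k]) auto
    qed
  qed
  have below_Suc: "below t (Suc k) = below t k + count (mset (concat t)) (Suc k)" for t k
  proof -
    have "filter_mset (\<lambda>x. x \<le> Suc k) M = filter_mset (\<lambda>x. x \<le> k) M + filter_mset (\<lambda>x. x = Suc k) M" for M :: "nat multiset"
      by (rule multiset_eqI) auto
    then show ?thesis unfolding below_def by (simp only: size_union filter_eq_replicate_mset size_replicate_mset)
  qed
  have "\<rho> (cartan_gen q i) s t = (if s = t then weight_eig q (real (count (mset (concat t)) i)) else 0)"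
    if i: "i \<in> {1..d}" and s: "s \<in> ?B" and t: "t \<in> ?B" for i s t
  proof -
    obtain k where k: "i = Suc k" "k < d" using i by (cases i) auto
    let ?c = "real (count (mset (concat t)) i)" and ?b = "real (below t k)"
    have 1: "cartan_op q ?B \<rho> k (basis_vec t) = (\<lambda>b. weight_eig q ?b * basis_vec t b)"
      using op [OF t, of k] k by simp
    have 2: "cartan_op q ?B \<rho> (Suc k) (basis_vec t) = (\<lambda>b. weight_eig q (?b + ?c) * basis_vec t b)"
      using op [OF t, of "Suc k"] k below_Suc [of t k] by simp
    have "mvec ?B (\<rho> (cartan_gen q i)) (basis_vec t) s = weight_eig q ?c * basis_vec t s"
    proof (cases "q = 1")
      case True
      have "mvec ?B (\<rho> (GenH (Suc k))) (basis_vec t) s + weight_eig q ?b * basis_vec t s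
          = weight_eig q (?b + ?c) * basis_vec t s"
        using fun_cong [OF 2, of s] 1 True by simp
      then show ?thesis using True k by (simp add: cartan_gen_def weight_eig_def algebra_simps)
    next
      case False
      have "weight_eig q ?b * mvec ?B (\<rho> (GenK (Suc k))) (basis_vec t) s
          = weight_eig q (?b + ?c) * basis_vec t s"
        using fun_cong [OF 2, of s] 1 False by (simp add: mvec_scale)
      then show ?thesis using False k q
        by (simp add: cartan_gen_def weight_eig_def powr_add add_divide_distrib)
    qed
    then show ?thesis using s t by (simp add: mvec_basis_vec) (auto simp: basis_vec_def)
  qed
  moreover have "set_mset (mset (concat t)) \<subseteq> {1..d}" if "t \<in> ?B" for t
    using that unfolding SSYT_def set_mset_mset by blast
  ultimately show ?thesis by (simp add: weight_basis_def meq_def)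
qed

section \<open>Schur's lemma for Gelfand-Tsetlin-Jimbo irreps\<close>

lemma intertwiner_kernel:
  assumes irr: "irreducible_subspace q d B \<sigma> (vecs B)" and \<phi>: "uq_intertwiner q d A \<rho> B \<sigma> \<phi>"
    and fin: "finite B" and x: "x \<in> vecs B" "x \<noteq> (\<lambda>_. 0)" "\<And>a. a \<in> A \<Longrightarrow> (\<Sum>b\<in>B. \<phi> a b * x b) = 0"
    and ab: "a \<in> A" "b \<in> B"
  shows "\<phi> a b = 0"
proof -
  define X where "X = {x \<in> vecs B. \<forall>a\<in>A. (\<Sum>b\<in>B. \<phi> a b * x b) = 0}"
  have "subspace_of B X"
    unfolding subspace_of_def
  proof (intro conjI ballI allI)
    show "X \<subseteq> vecs B" by (auto simp: X_def)
    show "(\<lambda>_. 0) \<in> X" by (simp add: X_def vecs_def)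
  next
    fix y z assume "y \<in> X" "z \<in> X"
    then show "(\<lambda>b. y b + z b) \<in> X" by (simp add: X_def vecs_def distrib_left sum.distrib)
  next
    fix c y assume y: "y \<in> X"
    have "(\<Sum>b\<in>B. \<phi> a b * (c * y b)) = c * (\<Sum>b\<in>B. \<phi> a b * y b)" for a
      by (simp add: sum_distrib_left mult.left_commute)
    then show "(\<lambda>b. c * y b) \<in> X" using y by (simp add: X_def vecs_def)
  qed
  moreover have "mvec B (\<sigma> g) y \<in> X" if g: "g \<in> uq_gens q d" and y: "y \<in> X" for g y
  proof -
    have "(\<Sum>b\<in>B. \<phi> a b * mvec B (\<sigma> g) y b) = 0" if a: "a \<in> A" for a
    proof -
      have "(\<Sum>b\<in>B. \<phi> a b * mvec B (\<sigma> g) y b) = (\<Sum>b\<in>B. \<Sum>c\<in>B. \<phi> a b * \<sigma> g b c * y c)"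
        by (rule sum.cong) (simp_all add: mvec_def sum_distrib_left mult.assoc)
      also have "\<dots> = (\<Sum>c\<in>B. (\<phi> \<odot>\<^bsub>B\<^esub> \<sigma> g) a c * y c)"
        unfolding mmul_def sum_distrib_right by (rule sum.swap)
      also have "\<dots> = (\<Sum>c\<in>B. (\<rho> g \<odot>\<^bsub>A\<^esub> \<phi>) a c * y c)"
        using \<phi> g a by (simp add: uq_intertwiner_def meq_def)
      also have "\<dots> = (\<Sum>a'\<in>A. \<rho> g a a' * (\<Sum>c\<in>B. \<phi> a' c * y c))"
        unfolding mmul_def sum_distrib_left sum_distrib_right by (subst sum.swap) (simp add: mult.assoc)
      also have "\<dots> = 0" using y by (simp add: X_def)
      finally show ?thesis .
    qed
    then show ?thesis by (simp add: X_def mvec_in_vecs)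
  qed
  ultimately have "invariant_subspace q d B \<sigma> X" by (simp add: invariant_subspace_def)
  moreover have "X \<subseteq> vecs B" by (auto simp: X_def)
  moreover have "x \<in> X" using x by (simp add: X_def)
  ultimately have "X = vecs B" using irr x(2) by (auto simp: irreducible_subspace_def)
  then have "basis_vec b \<in> X" using basis_vec_in_vecs [OF ab(2)] by simp
  then have "(\<Sum>b'\<in>B. \<phi> a b' * basis_vec b b') = 0" using ab by (simp add: X_def)
  then show ?thesis using fin ab by (simp add: basis_vec_def if_distrib cong: if_cong)
qed

lemma intertwiner_kernel_basis:
  assumes irr: "irreducible_subspace q d B \<sigma> (vecs B)" and \<phi>: "uq_intertwiner q d A \<rho> B \<sigma> \<phi>"
    and fin: "finite B" and b0: "b0 \<in> B" "\<And>a. a \<in> A \<Longrightarrow> \<phi> a b0 = 0" and ab: "a \<in> A" "b \<in> B"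
  shows "\<phi> a b = 0"
proof (rule intertwiner_kernel [OF irr \<phi> fin basis_vec_in_vecs [OF b0(1)] _ _ ab])
  show "basis_vec b0 \<noteq> (\<lambda>_. 0)" by (auto simp: basis_vec_def fun_eq_iff)
  show "(\<Sum>b\<in>B. \<phi> a b * basis_vec b0 b) = 0" if "a \<in> A" for a
    using that fin b0 by (simp add: basis_vec_def if_distrib cong: if_cong)
qed

lemma gtj_irreducible: "gtj_irrep q d lam \<rho> \<Longrightarrow> irreducible_subspace q d (SSYT lam d) \<rho> (vecs (SSYT lam d))"
  by (simp add: gtj_irrep_def Let_def copy_of_irrep_def)

text \<open>Schur's lemma: a nonzero intertwiner is injective, so each of the two highest weights occurs as
  a weight of the other representation.\<close>

lemma gtj_intertwiner_zero:
  assumes q: "q > 0"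
    and A: "gtj_irrep q d lam \<rho>" "lam \<in> partitions n" "length lam \<le> d"
    and B: "gtj_irrep q d \<mu> \<sigma>" "\<mu> \<in> partitions m" "length \<mu> \<le> d"
    and \<phi>: "uq_intertwiner q d (SSYT lam d) \<rho> (SSYT \<mu> d) \<sigma> \<phi>"
    and \<phi>': "uq_intertwiner q d (SSYT \<mu> d) \<sigma> (SSYT lam d) \<rho> (madj \<phi>)"
    and st: "s \<in> SSYT lam d" "t \<in> SSYT \<mu> d" and nz: "\<phi> s t \<noteq> 0"
  shows "lam = \<mu>"
proof -
  \<comment> \<open>Generalised over both representations, as it is applied to \<open>\<phi>\<close>
    and then to its adjoint.\<close>
  have *: "\<exists>a\<in>SSYT lam d. mset (concat a) = mset (concat (hw_tableau \<mu>))"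
    if A: "gtj_irrep q d lam \<rho>" "lam \<in> partitions n"
      and B: "gtj_irrep q d \<mu> \<sigma>" "\<mu> \<in> partitions m" "length \<mu> \<le> d"
      and \<phi>: "uq_intertwiner q d (SSYT lam d) \<rho> (SSYT \<mu> d) \<sigma> \<phi>"
      and st: "s \<in> SSYT lam d" "t \<in> SSYT \<mu> d" and nz: "\<phi> s t \<noteq> 0"
    for lam \<mu> n m \<rho> \<sigma> \<phi> s t
  proof -
    have hw: "hw_tableau \<mu> \<in> SSYT \<mu> d" by (rule hw_tableau_SSYT [OF B(2,3)])
    have "\<exists>a\<in>SSYT lam d. \<phi> a (hw_tableau \<mu>) \<noteq> 0"
      using intertwiner_kernel_basis [OF gtj_irreducible [OF B(1)] \<phi> finite_SSYT hw _ st] nz by blast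
    then show ?thesis
      using intertwiner_weight [OF gtj_weight_basis [OF A q] gtj_weight_basis [OF B(1,2) q] \<phi>
          finite_SSYT finite_SSYT q _ hw] by blast
  qed
  obtain a where a: "a \<in> SSYT lam d" "mset (concat a) = mset (concat (hw_tableau \<mu>))"
    using * [OF A(1,2) B \<phi> st nz] by blast
  have "madj \<phi> t s \<noteq> 0" using nz by (simp add: madj_def)
  then obtain b where b: "b \<in> SSYT \<mu> d" "mset (concat b) = mset (concat (hw_tableau lam))"
    using * [OF B(1,2) A \<phi>' st(2,1)] by blast
  \<comment> \<open>\<open>a\<close> has shape \<open>lam\<close> and the content of the highest
    weight of \<open>\<mu>\<close>, and \<open>b\<close> conversely. Highest weight tableaux
    minimise the letter sum in their shape, and the two inequalities squeeze \<open>a\<close> to the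
    minimum.\<close>
  have "sum_list (concat a) = sum_list (concat (hw_tableau \<mu>))"
    using a(2) by (metis sum_mset_sum_list)
  also have "\<dots> \<le> sum_list (concat b)" by (rule sum_concat_ge_hw [OF b(1) B(2)])
  also have "\<dots> = sum_list (concat (hw_tableau lam))"
    using b(2) by (metis sum_mset_sum_list)
  finally have "a = hw_tableau lam" by (rule hw_tableau_unique [OF a(1) A(2)])
  then show ?thesis using a(2) hw_tableau_content_inj [OF A(2) B(2)] by simp
qed

text \<open>The highest weight occurs once, so \<open>\<phi>\<close> multiplies its basis vector by
  some \<open>c\<close>; then \<open>\<phi> - c\<close> has a kernel and vanishes. The eigenvalue
  comes from a weight, so no characteristic polynomial is involved.\<close>

lemma gtj_intertwiner_scalar:
  assumes q: "q > 0" and A: "gtj_irrep q d lam \<rho>" "lam \<in> partitions n" "length lam \<le> d"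
    and \<phi>: "uq_intertwiner q d (SSYT lam d) \<rho> (SSYT lam d) \<rho> \<phi>"
  shows "\<exists>c. \<forall>s\<in>SSYT lam d. \<forall>t\<in>SSYT lam d. \<phi> s t = (if s = t then c else 0)"
proof -
  let ?B = "SSYT lam d" and ?h = "hw_tableau lam"
  define c where "c = \<phi> ?h ?h"
  define \<psi> where "\<psi> = (\<lambda>a b. \<phi> a b - c * mone a b)"
  have hw: "?h \<in> ?B" by (rule hw_tableau_SSYT [OF A(2,3)])
  have "uq_intertwiner q d ?B \<rho> ?B \<rho> \<psi>"
    unfolding uq_intertwiner_def
  proof
    fix g assume "g \<in> uq_gens q d"
    then have 1: "meq ?B ?B (\<phi> \<odot>\<^bsub>?B\<^esub> \<rho> g) (\<rho> g \<odot>\<^bsub>?B\<^esub> \<phi>)" using \<phi> by (simp add: uq_intertwiner_def)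
    have 2: "\<psi> \<odot>\<^bsub>?B\<^esub> \<rho> g = (\<lambda>a b. (\<phi> \<odot>\<^bsub>?B\<^esub> \<rho> g) a b - c * (mone \<odot>\<^bsub>?B\<^esub> \<rho> g) a b)"
      by (simp add: \<psi>_def mmul_def left_diff_distrib sum_subtractf sum_distrib_left mult.assoc)
    have 3: "\<rho> g \<odot>\<^bsub>?B\<^esub> \<psi> = (\<lambda>a b. (\<rho> g \<odot>\<^bsub>?B\<^esub> \<phi>) a b - c * (\<rho> g \<odot>\<^bsub>?B\<^esub> mone) a b)"
      by (simp add: \<psi>_def mmul_def right_diff_distrib sum_subtractf sum_distrib_left mult.left_commute)
    show "meq ?B ?B (\<psi> \<odot>\<^bsub>?B\<^esub> \<rho> g) (\<rho> g \<odot>\<^bsub>?B\<^esub> \<psi>)"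
      using 1 mone_mmul [of ?B ?B "\<rho> g"] mmul_mone [of ?B ?B "\<rho> g"]
      unfolding 2 3 by (simp add: meq_def)
  qed
  moreover have "\<psi> a ?h = 0" if a: "a \<in> ?B" for a
  proof (cases "a = ?h")
    case True
    then show ?thesis by (simp add: \<psi>_def c_def mone_def)
  next
    case False
    have "\<phi> a ?h = 0"
    proof (rule ccontr)
      assume "\<phi> a ?h \<noteq> 0"
      then have "mset (concat a) = mset (concat ?h)"
        using intertwiner_weight [OF gtj_weight_basis [OF A(1,2) q] gtj_weight_basis [OF A(1,2) q] \<phi>
            finite_SSYT finite_SSYT q a hw] by blast
      then have "sum_list (concat a) = sum_list (concat ?h)" by (metis sum_mset_sum_list)
      then show False using hw_tableau_unique [OF a A(2)] False by simp
    qed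
    then show ?thesis using False by (simp add: \<psi>_def mone_def)
  qed
  ultimately have "\<psi> s t = 0" if "s \<in> ?B" "t \<in> ?B" for s t
    using intertwiner_kernel_basis [OF gtj_irreducible [OF A(1)] _ finite_SSYT hw _ that] by blast
  then have "\<phi> s t = (if s = t then c else 0)" if "s \<in> ?B" "t \<in> ?B" for s t
    using that by (force simp: \<psi>_def mone_def)
  then show ?thesis by blast
qed

section \<open>The cascade of Pieri transforms\<close>

lemma unitary_cong: "unitary_mat A B M \<Longrightarrow> meq A B M M' \<Longrightarrow> unitary_mat A B M'"
proof -
  assume U: "unitary_mat A B M" and eq: "meq A B M M'"
  have eq': "meq B A (madj M) (madj M')" using eq by (simp add: meq_def madj_def)
  have "meq A A (M' \<odot>\<^bsub>B\<^esub> madj M') (M \<odot>\<^bsub>B\<^esub> madj M)"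
    by (rule meq_mmul [OF meq_sym [OF eq] meq_sym [OF eq']])
  moreover have "meq B B (madj M' \<odot>\<^bsub>A\<^esub> M') (madj M \<odot>\<^bsub>A\<^esub> M)"
    by (rule meq_mmul [OF meq_sym [OF eq'] meq_sym [OF eq]])
  ultimately show "unitary_mat A B M'"
    using U by (auto simp: unitary_mat_def inverse_mat_def intro: meq_trans)
qed

lemma uq_intertwiner_cong:
  assumes "uq_intertwiner q d A \<rho> B \<sigma> M" "meq A B M M'"
  shows "uq_intertwiner q d A \<rho> B \<sigma> M'"
  unfolding uq_intertwiner_def
proof
  fix g assume "g \<in> uq_gens q d"
  then have 1: "meq A B (M \<odot>\<^bsub>B\<^esub> \<sigma> g) (\<rho> g \<odot>\<^bsub>A\<^esub> M)" using assms(1) by (simp add: uq_intertwiner_def)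
  have "meq A B (M' \<odot>\<^bsub>B\<^esub> \<sigma> g) (M \<odot>\<^bsub>B\<^esub> \<sigma> g)" by (rule meq_mmul [OF meq_sym [OF assms(2)] meq_refl])
  also note 1
  also have "meq A B (\<rho> g \<odot>\<^bsub>A\<^esub> M) (\<rho> g \<odot>\<^bsub>A\<^esub> M')" by (rule meq_mmul [OF meq_refl assms(2)])
  finally show "meq A B (M' \<odot>\<^bsub>B\<^esub> \<sigma> g) (\<rho> g \<odot>\<^bsub>A\<^esub> M')" .
qed

lemma unitary_reindex:
  assumes U: "unitary_mat A B M" and f: "bij_betw f B' B"
  shows "unitary_mat A B' (\<lambda>a b. M a (f b))"
proof -
  have "(\<Sum>b\<in>B'. M a (f b) * cnj (M a' (f b))) = (\<Sum>b\<in>B. M a b * cnj (M a' b))" for a a'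
    by (rule sum.reindex_bij_betw [OF f])
  moreover have "f b \<in> B" "f b = f b' \<longleftrightarrow> b = b'" if "b \<in> B'" "b' \<in> B'" for b b'
    using f that by (auto simp: bij_betw_def inj_on_def)
  ultimately show ?thesis
    using U by (simp add: unitary_mat_def inverse_mat_def meq_def mmul_def madj_def mone_def)
qed

lemma uq_intertwiner_reindex:
  assumes M: "uq_intertwiner q d A \<rho> B \<sigma> M" and f: "bij_betw f B' B"
  shows "uq_intertwiner q d A \<rho> B' (\<lambda>g u w. \<sigma> g (f u) (f w)) (\<lambda>a b. M a (f b))"
proof -
  have "(\<Sum>b\<in>B'. M a (f b) * \<sigma> g (f b) c) = (\<Sum>b\<in>B. M a b * \<sigma> g b c)" for a c g
    by (rule sum.reindex_bij_betw [OF f])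
  moreover have "f b \<in> B" if "b \<in> B'" for b using f that by (auto simp: bij_betw_def)
  ultimately show ?thesis using M by (simp add: uq_intertwiner_def meq_def mmul_def)
qed

section \<open>Tensoring an intertwiner with a further representation\<close>

lemma kron_mmul:
  "kron M N \<odot>\<^bsub>B \<times> D\<^esub> kron M' N' = kron (M \<odot>\<^bsub>B\<^esub> M') (N \<odot>\<^bsub>D\<^esub> N')"
proof -
  have "(kron M N \<odot>\<^bsub>B \<times> D\<^esub> kron M' N') (a, c) (b, d) = kron (M \<odot>\<^bsub>B\<^esub> M') (N \<odot>\<^bsub>D\<^esub> N') (a, c) (b, d)"
    for a b c d
  proof -
    have "(\<Sum>z\<in>B \<times> D. kron M N (a, c) z * kron M' N' z (b, d))
        = (\<Sum>(u, v)\<in>B \<times> D. (M a u * M' u b) * (N c v * N' v d))"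
      by (rule sum.cong) (auto simp: kron_def)
    also have "\<dots> = (\<Sum>u\<in>B. M a u * M' u b) * (\<Sum>v\<in>D. N c v * N' v d)"
      by (simp add: sum_product sum.cartesian_product)
    finally show ?thesis by (simp add: mmul_def kron_def)
  qed
  then show ?thesis by (auto simp: fun_eq_iff)
qed

lemma meq_kron: "meq A B M M' \<Longrightarrow> meq C D N N' \<Longrightarrow> meq (A \<times> C) (B \<times> D) (kron M N) (kron M' N')"
  by (simp add: meq_def kron_def)

lemma kron_mone: "kron mone mone = mone"
  by (auto simp: kron_def mone_def fun_eq_iff)

lemma unitary_kron_mone:
  assumes "unitary_mat A B M" "finite I"
  shows "unitary_mat (A \<times> I) (B \<times> I) (kron M mone)"
proof -
  have adj: "madj (kron M mone) = kron (madj M) (mone :: ('c, 'c) cmat)"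
    by (auto simp: madj_def kron_def mone_def fun_eq_iff)
  show ?thesis
    unfolding unitary_mat_def inverse_mat_def adj kron_mmul kron_mone [symmetric]
    using assms by (auto simp: unitary_mat_def inverse_mat_def intro!: meq_kron mone_mmul)
qed

lemma mmul_add_right: "M \<odot>\<^bsub>B\<^esub> (\<lambda>a b. N a b + N' a b) = (\<lambda>a b. (M \<odot>\<^bsub>B\<^esub> N) a b + (M \<odot>\<^bsub>B\<^esub> N') a b)"
  by (simp add: mmul_def distrib_left sum.distrib)

lemma mmul_add_left: "(\<lambda>a b. N a b + N' a b) \<odot>\<^bsub>B\<^esub> M = (\<lambda>a b. (N \<odot>\<^bsub>B\<^esub> M) a b + (N' \<odot>\<^bsub>B\<^esub> M) a b)"
  by (simp add: mmul_def distrib_right sum.distrib)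

lemma meq_add:
  "meq A B M M' \<Longrightarrow> meq A B N N' \<Longrightarrow> meq A B (\<lambda>a b. M a b + N a b) (\<lambda>a b. M' a b + N' a b)"
  by (simp add: meq_def)

lemma intertwine_mmul:
  assumes "meq A B (M \<odot>\<^bsub>B\<^esub> X) (X' \<odot>\<^bsub>A\<^esub> M)" "meq A B (M \<odot>\<^bsub>B\<^esub> Y) (Y' \<odot>\<^bsub>A\<^esub> M)"
  shows "meq A B (M \<odot>\<^bsub>B\<^esub> (X \<odot>\<^bsub>B\<^esub> Y)) ((X' \<odot>\<^bsub>A\<^esub> Y') \<odot>\<^bsub>A\<^esub> M)"
proof -
  have "meq A B ((M \<odot>\<^bsub>B\<^esub> X) \<odot>\<^bsub>B\<^esub> Y) ((X' \<odot>\<^bsub>A\<^esub> M) \<odot>\<^bsub>B\<^esub> Y)" by (rule meq_mmul [OF assms(1) meq_refl])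
  moreover have "meq A B (X' \<odot>\<^bsub>A\<^esub> (M \<odot>\<^bsub>B\<^esub> Y)) (X' \<odot>\<^bsub>A\<^esub> (Y' \<odot>\<^bsub>A\<^esub> M))" by (rule meq_mmul [OF meq_refl assms(2)])
  ultimately show ?thesis unfolding mmul_assoc by (rule meq_trans)
qed

lemma intertwine_kron:
  assumes "meq A B (M \<odot>\<^bsub>B\<^esub> X) (X' \<odot>\<^bsub>A\<^esub> M)" "finite I"
  shows "meq (A \<times> I) (B \<times> I) (kron M mone \<odot>\<^bsub>B \<times> I\<^esub> kron X Z) (kron X' Z \<odot>\<^bsub>A \<times> I\<^esub> kron M mone)"
proof -
  have "meq I I (mone \<odot>\<^bsub>I\<^esub> Z) Z" by (rule mone_mmul [OF assms(2)])
  also have "meq I I Z (Z \<odot>\<^bsub>I\<^esub> mone)" by (rule meq_sym [OF mmul_mone [OF assms(2)]])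
  finally show ?thesis unfolding kron_mmul by (rule meq_kron [OF assms(1)])
qed

lemma tensor_rep_simps:
  "tensor_rep q A \<rho> B \<sigma> (GenE i) = (\<lambda>x y. kron (\<rho> (GenE i)) (k_half_inv q B \<sigma> i) x y + kron (k_half q A \<rho> i) (\<sigma> (GenE i)) x y)"
  "tensor_rep q A \<rho> B \<sigma> (GenF i) = (\<lambda>x y. kron (\<rho> (GenF i)) (k_half_inv q B \<sigma> i) x y + kron (k_half q A \<rho> i) (\<sigma> (GenF i)) x y)"
  "tensor_rep q A \<rho> B \<sigma> (GenK i) = kron (\<rho> (GenK i)) (\<sigma> (GenK i))"
  "tensor_rep q A \<rho> B \<sigma> (GenKinv i) = kron (\<rho> (GenKinv i)) (\<sigma> (GenKinv i))"
  "tensor_rep q A \<rho> B \<sigma> (GenH i) = (\<lambda>x y. kron (\<rho> (GenH i)) mone x y + kron mone (\<sigma> (GenH i)) x y)"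
  by (simp_all add: tensor_rep_def fun_eq_iff)

text \<open>In the coproduct the left factor carries only generators, the identity and
  \<open>k_half\<close>, which for \<open>q \<noteq> 1\<close> is a product of generators.
  \<open>M\<close> intertwines each of these, while the right factor is left alone.\<close>

lemma uq_intertwiner_tensor:
  assumes M: "uq_intertwiner q d A \<rho> B \<sigma> M" and fin: "finite A" "finite B" "finite I"
  shows "uq_intertwiner q d (A \<times> I) (tensor_rep q A \<rho> I \<tau>) (B \<times> I) (tensor_rep q B \<sigma> I \<tau>) (kron M mone)"
  unfolding uq_intertwiner_def
proof
  have gen: "meq A B (M \<odot>\<^bsub>B\<^esub> \<sigma> g) (\<rho> g \<odot>\<^bsub>A\<^esub> M)" if "g \<in> uq_gens q d" for g
    using M that by (simp add: uq_intertwiner_def)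
  have one: "meq A B (M \<odot>\<^bsub>B\<^esub> mone) (mone \<odot>\<^bsub>A\<^esub> M)"
    using mmul_mone [OF fin(2)] meq_sym [OF mone_mmul [OF fin(1)]] by (rule meq_trans)
  have k: "meq A B (M \<odot>\<^bsub>B\<^esub> k_half q B \<sigma> i) (k_half q A \<rho> i \<odot>\<^bsub>A\<^esub> M)" if "i \<in> {1..<d}" for i
  proof (cases "q = 1")
    case False
    then have "GenK i \<in> uq_gens q d" "GenKinv (Suc i) \<in> uq_gens q d"
      using that by (auto simp: uq_gens_def)
    then show ?thesis unfolding k_half_def using False by (simp add: intertwine_mmul gen)
  qed (simp add: k_half_def one)
  fix g assume g: "g \<in> uq_gens q d"
  show "meq (A \<times> I) (B \<times> I) (kron M mone \<odot>\<^bsub>B \<times> I\<^esub> tensor_rep q B \<sigma> I \<tau> g)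
      (tensor_rep q A \<rho> I \<tau> g \<odot>\<^bsub>A \<times> I\<^esub> kron M mone)"
  proof (cases g)
    case (GenE i)
    then have "i \<in> {1..<d}" using g by (auto simp: uq_gens_def split: if_splits)
    then show ?thesis unfolding GenE tensor_rep_simps mmul_add_left mmul_add_right
      using gen [OF g] k by (intro meq_add intertwine_kron fin) (simp_all add: GenE)
  next
    case (GenF i)
    then have "i \<in> {1..<d}" using g by (auto simp: uq_gens_def split: if_splits)
    then show ?thesis unfolding GenF tensor_rep_simps mmul_add_left mmul_add_right
      using gen [OF g] k by (intro meq_add intertwine_kron fin) (simp_all add: GenF)
  next
    case (GenK i)
    then show ?thesis unfolding GenK tensor_rep_simps
      using gen [OF g] by (intro intertwine_kron fin) (simp add: GenK)
  next
    case (GenKinv i)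
    then show ?thesis unfolding GenKinv tensor_rep_simps
      using gen [OF g] by (intro intertwine_kron fin) (simp add: GenKinv)
  next
    case (GenH i)
    then show ?thesis unfolding GenH tensor_rep_simps mmul_add_left mmul_add_right
      using gen [OF g] one by (intro meq_add intertwine_kron fin) (simp_all add: GenH)
  qed
qed

section \<open>Index sets and sums over blocks\<close>

lemma finite_sw_index [simp]: "finite (sw_index d n)"
proof -
  have "sw_index d n \<subseteq> (SIGMA lam:partitions n. SSYT lam d \<times> SYT lam)"
    by (auto simp: sw_index_def)
  then show ?thesis by (rule finite_subset) simp
qed

lemma finite_words [simp]: "finite (words d n)"
proof (rule finite_subset)
  show "words d n \<subseteq> {w. set w \<subseteq> {1..d} \<and> length w = n}" by (auto simp: words_def)
qed (rule finite_lists_length_eq, simp)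

lemma words_Suc_bij: "bij_betw (\<lambda>w. (butlast w, last w)) (words d (Suc n)) (words d n \<times> {1..d})"
proof (rule bij_betw_byWitness [where f' = "\<lambda>(w, i). w @ [i]"])
  show "\<forall>w\<in>words d (Suc n). (case (butlast w, last w) of (w, i) \<Rightarrow> w @ [i]) = w"
    by (auto simp: words_def intro!: append_butlast_last_id)
  show "(\<lambda>w. (butlast w, last w)) ` words d (Suc n) \<subseteq> words d n \<times> {1..d}"
  proof clarify
    fix w assume w: "w \<in> words d (Suc n)"
    then have "w \<noteq> []" by (auto simp: words_def)
    then have "last w \<in> set w" by simp
    moreover have "set (butlast w) \<subseteq> set w" by (auto dest: in_set_butlastD)
    ultimately show "butlast w \<in> words d n \<and> last w \<in> {1..d}"
      using w unfolding words_def by auto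
  qed
qed (auto simp: words_def)

text \<open>\<open>U_q(d)\<close> does not mix different pairs \<open>(lam, S)\<close>: a sum with
  such a block diagonal factor collapses to a single copy of the irrep.\<close>

lemma sum_sw_block:
  assumes lam: "lam \<in> partitions n" "length lam \<le> d" "S \<in> SYT lam"
    and f: "\<And>lam' t S'. (lam', t, S') \<in> sw_index d n \<Longrightarrow> \<not> (lam' = lam \<and> S' = S) \<Longrightarrow> f (lam', t, S') = 0"
  shows "sum f (sw_index d n) = (\<Sum>t\<in>SSYT lam d. f (lam, t, S))"
proof -
  have inj: "inj_on (\<lambda>t. (lam, t, S)) (SSYT lam d)" by (simp add: inj_on_def)
  have "sum f (sw_index d n) = sum f ((\<lambda>t. (lam, t, S)) ` SSYT lam d)"
  proof (rule sum.mono_neutral_right)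
    show "(\<lambda>t. (lam, t, S)) ` SSYT lam d \<subseteq> sw_index d n" using lam by (auto simp: sw_index_def)
    show "\<forall>x\<in>sw_index d n - (\<lambda>t. (lam, t, S)) ` SSYT lam d. f x = 0"
      using f by (auto simp: sw_index_def image_iff)
  qed simp
  then show ?thesis by (simp add: sum.reindex [OF inj])
qed

lemma sum_sw_block_prod:
  assumes lam: "lam \<in> partitions n" "length lam \<le> d" "S \<in> SYT lam"
    and f: "\<And>lam' t S' i. (lam', t, S') \<in> sw_index d n \<Longrightarrow> i \<in> I \<Longrightarrow> \<not> (lam' = lam \<and> S' = S)
      \<Longrightarrow> f ((lam', t, S'), i) = 0"
  shows "sum f (sw_index d n \<times> I) = (\<Sum>(t, i)\<in>SSYT lam d \<times> I. f ((lam, t, S), i))"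
proof -
  have "sum f (sw_index d n \<times> I) = (\<Sum>a\<in>sw_index d n. \<Sum>i\<in>I. f (a, i))"
    by (simp add: sum.cartesian_product)
  also have "\<dots> = (\<Sum>t\<in>SSYT lam d. \<Sum>i\<in>I. f ((lam, t, S), i))"
    by (rule sum_sw_block [OF lam]) (simp add: f)
  finally show ?thesis by (simp add: sum.cartesian_product)
qed

text \<open>One stage of the cascade on all summands at once. It turns the recursion into a matrix
  product, to which unitarity and equivariance pass by general rules.\<close>

definition pieri_step ::
    "(nat list \<Rightarrow> (tableau, tableau \<times> nat) cmat) \<Rightarrow> nat \<Rightarrow> (sw_label, sw_label \<times> nat) cmat" where
  "pieri_step P n = (\<lambda>(\<mu>, s, S) ((lam, t, S'), i).
     if covers \<mu> lam \<and> S = add_box \<mu> S' (Suc n) then P lam s (t, i) else 0)"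

text \<open>Restriction of \<open>S\<close> fixes the block \<open>(lam, S0)\<close> from which the
  row draws, so every row is one row of a single Pieri transform.\<close>

lemma pieri_step_row:
  assumes a: "(\<mu>, s, S) \<in> sw_index d (Suc n)"
  obtains lam S0 where "lam \<in> partitions n" "length lam \<le> d" "S0 \<in> SYT lam" "covers \<mu> lam"
    "S = add_box \<mu> S0 (Suc n)" "s \<in> pieri_index d lam"
    "\<forall>lam' t S' i. (lam', t, S') \<in> sw_index d n \<longrightarrow>
      pieri_step P n (\<mu>, s, S) ((lam', t, S'), i) = (if lam' = lam \<and> S' = S0 then P lam s (t, i) else 0)"
proof -
  have \<mu>: "\<mu> \<in> partitions (Suc n)" and len: "length \<mu> \<le> d" and s: "s \<in> SSYT \<mu> d" and S: "S \<in> SYT \<mu>"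
    using a by (auto simp: sw_index_def)
  obtain lam S0 where *: "lam \<in> partitions n" "covers \<mu> lam" "S0 \<in> SYT lam" "S = add_box \<mu> S0 (Suc n)"
    using add_box_surj [OF S \<mu>] by blast
  have "length lam \<le> d" using covers_length_le [OF *(2,1)] len by simp
  moreover have "s \<in> pieri_index d lam"
    using * \<mu> len s by (auto simp: pieri_index_def partitions_sum)
  moreover have "pieri_step P n (\<mu>, s, S) ((lam', t, S'), i) = (if lam' = lam \<and> S' = S0 then P lam s (t, i) else 0)"
    if "(lam', t, S') \<in> sw_index d n" for lam' t S' i
  proof -
    have "lam' \<in> partitions n" "S' \<in> SYT lam'" using that by (simp_all add: sw_index_def)
    then have "covers \<mu> lam' \<and> S = add_box \<mu> S' (Suc n) \<longleftrightarrow> lam' = lam \<and> S' = S0"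
      using * add_box_inj [OF _ *(1) \<mu> _ *(2) _ *(3), of lam' S'] by metis
    then show ?thesis by (simp add: pieri_step_def)
  qed
  ultimately show ?thesis using that * by blast
qed

lemma pieri_index_D:
  assumes "s \<in> pieri_index d lam" "lam \<in> partitions n"
  shows "shape s \<in> partitions (Suc n)" "covers (shape s) lam" "length (shape s) \<le> d" "s \<in> SSYT (shape s) d"
  using assms SSYT_shape by (auto simp: pieri_index_def partitions_sum)

text \<open>Up to relabelling this is the direct sum of \<open>P lam\<close> over all
  \<open>(lam, S')\<close>. Rows and columns from different blocks have disjoint supports; within a
  block orthonormality is that of \<open>P lam\<close>.\<close>

lemma unitary_pieri_step:
  assumes P: "\<And>lam. lam \<in> partitions n \<Longrightarrow> length lam \<le> d \<Longrightarrow>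
    unitary_mat (pieri_index d lam) (SSYT lam d \<times> {1..d}) (P lam)"
  shows "unitary_mat (sw_index d (Suc n)) (sw_index d n \<times> {1..d}) (pieri_step P n)"
  unfolding unitary_mat_def inverse_mat_def
proof
  let ?Q = "pieri_step P n"
  show "meq (sw_index d (Suc n)) (sw_index d (Suc n)) (?Q \<odot>\<^bsub>sw_index d n \<times> {1..d}\<^esub> madj ?Q) mone"
    unfolding meq_def
  proof (intro ballI)
    fix a a' assume a: "a \<in> sw_index d (Suc n)" and a': "a' \<in> sw_index d (Suc n)"
    obtain \<mu> s S where aa: "a = (\<mu>, s, S)" by (cases a)
    obtain \<mu>' s' S' where aa': "a' = (\<mu>', s', S')" by (cases a')
    obtain lam S0 where r: "lam \<in> partitions n" "length lam \<le> d" "S0 \<in> SYT lam" "covers \<mu> lam"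
      "S = add_box \<mu> S0 (Suc n)" "s \<in> pieri_index d lam" and
      Q: "\<forall>lam' t S' i. (lam', t, S') \<in> sw_index d n \<longrightarrow>
        ?Q (\<mu>, s, S) ((lam', t, S'), i) = (if lam' = lam \<and> S' = S0 then P lam s (t, i) else 0)"
      by (rule pieri_step_row [OF a [unfolded aa], where P = P])
    obtain lam' S0' where r': "lam' \<in> partitions n" "length lam' \<le> d" "S0' \<in> SYT lam'" "covers \<mu>' lam'"
      "S' = add_box \<mu>' S0' (Suc n)" "s' \<in> pieri_index d lam'" and
      Q': "\<forall>lam'' t S'' i. (lam'', t, S'') \<in> sw_index d n \<longrightarrow>
        ?Q (\<mu>', s', S') ((lam'', t, S''), i) = (if lam'' = lam' \<and> S'' = S0' then P lam' s' (t, i) else 0)"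
      by (rule pieri_step_row [OF a' [unfolded aa'], where P = P])
    have idx: "(lam, t, S0) \<in> sw_index d n" if "t \<in> SSYT lam d" for t
      using r that by (simp add: sw_index_def)
    have "(?Q \<odot>\<^bsub>sw_index d n \<times> {1..d}\<^esub> madj ?Q) a a'
        = (\<Sum>(t, i)\<in>SSYT lam d \<times> {1..d}. ?Q a ((lam, t, S0), i) * cnj (?Q a' ((lam, t, S0), i)))"
      unfolding mmul_def madj_def by (rule sum_sw_block_prod [OF r(1,2,3)]) (auto simp: aa Q)
    also have "\<dots> = (\<Sum>(t, i)\<in>SSYT lam d \<times> {1..d}. P lam s (t, i) *
        cnj (if lam = lam' \<and> S0 = S0' then P lam' s' (t, i) else 0))"
    proof (rule sum.cong [OF refl])
      fix x assume "x \<in> SSYT lam d \<times> {1..d}"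
      then obtain t i where x: "x = (t, i)" "t \<in> SSYT lam d" by blast
      show "(case x of (t, i) \<Rightarrow> ?Q a ((lam, t, S0), i) * cnj (?Q a' ((lam, t, S0), i)))
        = (case x of (t, i) \<Rightarrow> P lam s (t, i) * cnj (if lam = lam' \<and> S0 = S0' then P lam' s' (t, i) else 0))"
        unfolding x prod.case aa aa' using Q [rule_format, OF idx [OF x(2)]] Q' [rule_format, OF idx [OF x(2)]]
        by (simp only: simp_thms if_True)
    qed
    also have "\<dots> = mone a a'"
    proof (cases "lam = lam' \<and> S0 = S0'")
      case True
      have "(\<Sum>(t, i)\<in>SSYT lam d \<times> {1..d}. P lam s (t, i) * cnj (P lam s' (t, i))) = mone s s'"
        using P [OF r(1,2)] r(6) r'(6) True
        by (simp add: unitary_mat_def inverse_mat_def meq_def mmul_def madj_def case_prod_beta)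
      \<comment> \<open>Rows of \<open>P lam\<close> are labelled by tableaux alone;
        \<open>s\<close> determines its shape \<open>\<mu>\<close>, and with the common
        \<open>S0\<close> also the standard tableau.\<close>
      also have "mone s s' = mone a a'"
      proof (cases "s = s'")
        case True
        then have "\<mu> = \<mu>'" using a a' aa aa' by (auto simp: sw_index_def dest: SSYT_shape)
        then show ?thesis using True \<open>lam = lam' \<and> S0 = S0'\<close> r r' by (simp add: aa aa' mone_def)
      qed (simp add: aa aa' mone_def)
      finally show ?thesis using True by simp
    next
      case False
      have "a \<noteq> a'"
      proof
        assume "a = a'"
        then have "lam = lam' \<and> S0 = S0'"
          using add_box_inj [OF r(1) r'(1) _ r(4) _ r(3) r'(3), of] r r' a aa aa'
          by (auto simp: sw_index_def)
        then show False using False by simp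
      qed
      then show ?thesis using False by (auto simp: mone_def case_prod_beta)
    qed
    finally show "(?Q \<odot>\<^bsub>sw_index d n \<times> {1..d}\<^esub> madj ?Q) a a' = mone a a'" .
  qed
  show "meq (sw_index d n \<times> {1..d}) (sw_index d n \<times> {1..d}) (madj ?Q \<odot>\<^bsub>sw_index d (Suc n)\<^esub> ?Q) mone"
    unfolding meq_def
  proof (intro ballI)
    fix b b' assume b: "b \<in> sw_index d n \<times> {1..d}" and b': "b' \<in> sw_index d n \<times> {1..d}"
    obtain lam t S i where bb: "b = ((lam, t, S), i)" by (metis surj_pair)
    obtain lam' t' S' i' where bb': "b' = ((lam', t', S'), i')" by (metis surj_pair)
    have r: "lam \<in> partitions n" "length lam \<le> d" "S \<in> SYT lam" "t \<in> SSYT lam d" "i \<in> {1..d}"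
      using b by (auto simp: bb sw_index_def)
    have r': "lam' \<in> partitions n" "length lam' \<le> d" "S' \<in> SYT lam'" "t' \<in> SSYT lam' d" "i' \<in> {1..d}"
      using b' by (auto simp: bb' sw_index_def)
    show "(madj ?Q \<odot>\<^bsub>sw_index d (Suc n)\<^esub> ?Q) b b' = mone b b'"
    proof (cases "lam = lam' \<and> S = S'")
      case False
      have "cnj (?Q a b) * ?Q a b' = 0" if a: "a \<in> sw_index d (Suc n)" for a
      proof (rule ccontr)
        assume nz: "\<not> ?thesis"
        obtain \<mu> s T where aa: "a = (\<mu>, s, T)" by (cases a)
        have "covers \<mu> lam" "T = add_box \<mu> S (Suc n)" "covers \<mu> lam'" "T = add_box \<mu> S' (Suc n)"
          using nz by (auto simp: aa bb bb' pieri_step_def split: if_splits)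
        then show False
          using False add_box_inj [of lam n lam' \<mu> S S'] r r' a by (auto simp: aa sw_index_def)
      qed
      then have "(madj ?Q \<odot>\<^bsub>sw_index d (Suc n)\<^esub> ?Q) b b' = 0"
        unfolding mmul_def madj_def by (intro sum.neutral ballI)
      then show ?thesis using False by (auto simp: mone_def bb bb')
    next
      case True
      \<comment> \<open>The labels reachable from the block \<open>(lam, S)\<close>: a Pieri label
        \<open>s\<close> determines the new shape and with it the box to be added.\<close>
      define h where "h s = (shape s, s, add_box (shape s) S (Suc n))" for s
      have inj: "inj_on h (pieri_index d lam)" by (auto simp: inj_on_def h_def)
      have h: "h s \<in> sw_index d (Suc n)" if "s \<in> pieri_index d lam" for s
        using pieri_index_D [OF that r(1)] add_box_SYT [OF r(1) _ _ r(3)] by (simp add: h_def sw_index_def)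
      have "(madj ?Q \<odot>\<^bsub>sw_index d (Suc n)\<^esub> ?Q) b b' = (\<Sum>a\<in>h ` pieri_index d lam. cnj (?Q a b) * ?Q a b')"
        unfolding mmul_def madj_def
      proof (rule sum.mono_neutral_right)
        show "h ` pieri_index d lam \<subseteq> sw_index d (Suc n)" using h by blast
        show "\<forall>a\<in>sw_index d (Suc n) - h ` pieri_index d lam. cnj (?Q a b) * ?Q a b' = 0"
        proof
          fix a assume a: "a \<in> sw_index d (Suc n) - h ` pieri_index d lam"
          obtain \<mu> s T where aa: "a = (\<mu>, s, T)" by (cases a)
          have am: "\<mu> \<in> partitions (Suc n)" "length \<mu> \<le> d" "s \<in> SSYT \<mu> d"
            using a by (auto simp: aa sw_index_def)
          have "\<not> (covers \<mu> lam \<and> T = add_box \<mu> S (Suc n))"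
          proof
            assume *: "covers \<mu> lam \<and> T = add_box \<mu> S (Suc n)"
            then have "s \<in> pieri_index d lam" using am r by (auto simp: pieri_index_def partitions_sum)
            moreover have "a = h s" using * SSYT_shape [OF am(3)] by (simp add: aa h_def)
            ultimately show False using a by blast
          qed
          then show "cnj (?Q a b) * ?Q a b' = 0" by (auto simp: aa bb pieri_step_def)
        qed
      qed simp
      also have "\<dots> = (\<Sum>s\<in>pieri_index d lam. cnj (P lam s (t, i)) * P lam s (t', i'))"
        unfolding sum.reindex [OF inj]
      proof (rule sum.cong [OF refl])
        fix s assume "s \<in> pieri_index d lam"
        then show "((\<lambda>a. cnj (?Q a b) * ?Q a b') \<circ> h) s = cnj (P lam s (t, i)) * P lam s (t', i')"
          using pieri_index_D(2) [OF _ r(1)] True by (simp add: h_def bb bb' pieri_step_def)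
      qed
      also have "\<dots> = mone (t, i) (t', i')"
        using P [OF r(1,2)] r r' True
        by (simp add: unitary_mat_def inverse_mat_def meq_def mmul_def madj_def)
      also have "\<dots> = mone b b'" using True by (auto simp: mone_def bb bb')
      finally show ?thesis .
    qed
  qed
qed

lemma tensor_rep_sw_uq:
  assumes x: "(lam, t, S) \<in> sw_index d n" and y: "(lam', t', S') \<in> sw_index d n"
  shows "tensor_rep q (sw_index d n) (sw_uq V) I \<tau> g ((lam, t, S), i) ((lam', t', S'), i')
    = (if lam = lam' \<and> S = S' then tensor_rep q (SSYT lam' d) (V lam') I \<tau> g (t, i) (t', i') else 0)"
proof -
  have k: "k_half q (sw_index d n) (sw_uq V) j (lam, t, S) (lam', t', S')
      = (if lam = lam' \<and> S = S' then k_half q (SSYT lam' d) (V lam') j t t' else 0)" for j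
  proof (cases "q = 1")
    case False
    have "(sw_uq V (GenK j) \<odot>\<^bsub>sw_index d n\<^esub> sw_uq V (GenKinv (Suc j))) (lam, t, S) (lam', t', S')
      = (\<Sum>s\<in>SSYT lam' d. sw_uq V (GenK j) (lam, t, S) (lam', s, S') * sw_uq V (GenKinv (Suc j)) (lam', s, S') (lam', t', S'))"
      unfolding mmul_def by (rule sum_sw_block) (use y in \<open>auto simp: sw_index_def sw_uq_def\<close>)
    then show ?thesis using False
      by (cases "lam = lam' \<and> S = S'") (auto simp: k_half_def sw_uq_def mmul_def)
  qed (auto simp: k_half_def mone_def)
  show ?thesis
    by (cases g) (auto simp: tensor_rep_simps kron_def k sw_uq_def mone_def)
qed

lemma uq_intertwiner_pieri_step:
  assumes P: "\<And>lam. lam \<in> partitions n \<Longrightarrow> length lam \<le> d \<Longrightarrow>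
    uq_intertwiner q d (pieri_index d lam) (pieri_uq V) (SSYT lam d \<times> {1..d})
      (tensor_rep q (SSYT lam d) (V lam) {1..d} \<tau>) (P lam)"
  shows "uq_intertwiner q d (sw_index d (Suc n)) (sw_uq V) (sw_index d n \<times> {1..d})
    (tensor_rep q (sw_index d n) (sw_uq V) {1..d} \<tau>) (pieri_step P n)"
  unfolding uq_intertwiner_def meq_def
proof (intro ballI)
  let ?Q = "pieri_step P n" and ?T = "tensor_rep q (sw_index d n) (sw_uq V) {1..d} \<tau>"
  fix g a b assume g: "g \<in> uq_gens q d" and a: "a \<in> sw_index d (Suc n)" and b: "b \<in> sw_index d n \<times> {1..d}"
  obtain \<mu> s S where aa: "a = (\<mu>, s, S)" by (cases a)
  obtain lam t S0 i where bb: "b = ((lam, t, S0), i)" by (metis surj_pair)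
  have am: "\<mu> \<in> partitions (Suc n)" "length \<mu> \<le> d" "s \<in> SSYT \<mu> d" "S \<in> SYT \<mu>"
    using a by (auto simp: aa sw_index_def)
  have r: "lam \<in> partitions n" "length lam \<le> d" "S0 \<in> SYT lam" "t \<in> SSYT lam d" "i \<in> {1..d}"
    using b by (auto simp: bb sw_index_def)
  have idx: "(lam, u, S0) \<in> sw_index d n" if "u \<in> SSYT lam d" for u using r that by (simp add: sw_index_def)
  let ?c = "covers \<mu> lam \<and> S = add_box \<mu> S0 (Suc n)"
  let ?TT = "tensor_rep q (SSYT lam d) (V lam) {1..d} \<tau> g"
  have "(?Q \<odot>\<^bsub>sw_index d n \<times> {1..d}\<^esub> ?T g) a b
      = (\<Sum>(u, j)\<in>SSYT lam d \<times> {1..d}. ?Q a ((lam, u, S0), j) * ?T g ((lam, u, S0), j) b)"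
    unfolding mmul_def
  proof (rule sum_sw_block_prod [OF r(1,2,3)])
    fix lam' t' S' i'
    assume "(lam', t', S') \<in> sw_index d n" "\<not> (lam' = lam \<and> S' = S0)"
    then show "?Q a ((lam', t', S'), i') * ?T g ((lam', t', S'), i') b = 0"
      using b by (auto simp: bb tensor_rep_sw_uq)
  qed
  also have "\<dots> = (\<Sum>(u, j)\<in>SSYT lam d \<times> {1..d}. (if ?c then P lam s (u, j) else 0) * ?TT (u, j) (t, i))"
  proof (rule sum.cong [OF refl])
    fix x assume "x \<in> SSYT lam d \<times> {1..d}"
    then show "(case x of (u, j) \<Rightarrow> ?Q a ((lam, u, S0), j) * ?T g ((lam, u, S0), j) b)
        = (case x of (u, j) \<Rightarrow> (if ?c then P lam s (u, j) else 0) * ?TT (u, j) (t, i))"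
      using idx r by (auto simp: aa bb tensor_rep_sw_uq pieri_step_def)
  qed
  also have "\<dots> = (if ?c then \<Sum>x\<in>SSYT lam d \<times> {1..d}. P lam s x * ?TT x (t, i) else 0)"
    by (auto simp: case_prod_beta)
  also have "\<dots> = (if ?c then \<Sum>s'\<in>SSYT \<mu> d. V \<mu> g s s' * P lam s' (t, i) else 0)"
  proof (cases ?c)
    case True
    then have s: "s \<in> pieri_index d lam" using am r by (auto simp: pieri_index_def partitions_sum)
    have "(\<Sum>x\<in>SSYT lam d \<times> {1..d}. P lam s x * ?TT x (t, i))
        = (\<Sum>s'\<in>pieri_index d lam. pieri_uq V g s s' * P lam s' (t, i))"
      using P [OF r(1,2)] g s r by (simp add: uq_intertwiner_def meq_def mmul_def)
    also have "\<dots> = (\<Sum>s'\<in>SSYT \<mu> d. pieri_uq V g s s' * P lam s' (t, i))"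
    proof (rule sum.mono_neutral_right)
      show "finite (pieri_index d lam)"
      proof (rule finite_subset)
        show "pieri_index d lam \<subseteq> (\<Union>\<mu>\<in>partitions (Suc (sum_list lam)). SSYT \<mu> d)"
          by (auto simp: pieri_index_def)
      qed simp
      show "SSYT \<mu> d \<subseteq> pieri_index d lam" using am r True by (auto simp: pieri_index_def partitions_sum)
      show "\<forall>s'\<in>pieri_index d lam - SSYT \<mu> d. pieri_uq V g s s' * P lam s' (t, i) = 0"
      proof
        fix s' assume s': "s' \<in> pieri_index d lam - SSYT \<mu> d"
        then have "shape s' \<noteq> \<mu>" using pieri_index_D(4) [OF _ r(1)] by auto
        then show "pieri_uq V g s s' * P lam s' (t, i) = 0"
          using SSYT_shape [OF am(3)] by (simp add: pieri_uq_def)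
      qed
    qed
    also have "\<dots> = (\<Sum>s'\<in>SSYT \<mu> d. V \<mu> g s s' * P lam s' (t, i))"
      using SSYT_shape am(3) by (intro sum.cong refl) (auto simp: pieri_uq_def)
    finally show ?thesis using True by simp
  next
    case False
    then show ?thesis by (simp only: if_False)
  qed
  also have "\<dots> = (\<Sum>s'\<in>SSYT \<mu> d. sw_uq V g a (\<mu>, s', S) * ?Q (\<mu>, s', S) b)"
    by (auto simp: aa bb sw_uq_def pieri_step_def)
  also have "\<dots> = (sw_uq V g \<odot>\<^bsub>sw_index d (Suc n)\<^esub> ?Q) a b"
    unfolding mmul_def by (rule sum_sw_block [OF am(1,2,4), symmetric]) (auto simp: aa sw_uq_def)
  finally show "(?Q \<odot>\<^bsub>sw_index d n \<times> {1..d}\<^esub> ?T g) a b = (sw_uq V g \<odot>\<^bsub>sw_index d (Suc n)\<^esub> ?Q) a b" .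
qed

section \<open>Assembling the cascade\<close>

lemma cascade_Suc:
  "meq (sw_index d (Suc (Suc m))) (words d (Suc (Suc m)))
     (\<lambda>a w. (pieri_step P (Suc m) \<odot>\<^bsub>sw_index d (Suc m) \<times> {1..d}\<^esub> kron (cascade d P m) mone) a (butlast w, last w))
     (cascade d P (Suc m))"
  unfolding meq_def
proof (intro ballI)
  fix a :: sw_label and w assume w: "w \<in> words d (Suc (Suc m))"
  obtain \<mu> s S where a: "a = (\<mu>, s, S)" by (cases a)
  have last: "last w \<in> {1..d}" using bij_betwE [OF words_Suc_bij] w by fastforce
  have "(pieri_step P (Suc m) \<odot>\<^bsub>sw_index d (Suc m) \<times> {1..d}\<^esub> kron (cascade d P m) mone) a (butlast w, last w)
      = (\<Sum>b\<in>sw_index d (Suc m). \<Sum>i\<in>{1..d}. if i = last w then pieri_step P (Suc m) a (b, i) * cascade d P m b (butlast w) else 0)"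
    unfolding mmul_def sum.cartesian_product
    by (rule sum.cong) (auto simp: kron_def mone_def)
  also have "\<dots> = (\<Sum>b\<in>sw_index d (Suc m). pieri_step P (Suc m) a (b, last w) * cascade d P m b (butlast w))"
    using last by simp
  also have "\<dots> = cascade d P (Suc m) a w"
    unfolding a cascade.simps prod.case
    by (rule sum.cong) (auto simp: pieri_step_def)
  finally show "(pieri_step P (Suc m) \<odot>\<^bsub>sw_index d (Suc m) \<times> {1..d}\<^esub> kron (cascade d P m) mone) a (butlast w, last w)
      = cascade d P (Suc m) a w" .
qed

lemma partitions_1: "partitions (Suc 0) = {[1]}"
proof
  show "partitions (Suc 0) \<subseteq> {[1]}"
  proof
    fix lam assume lam: "lam \<in> partitions (Suc 0)"
    then obtain a l where l: "lam = a # l" by (cases lam) (auto simp: partitions_def)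
    have "0 < a" "a + sum_list l = 1" using lam by (simp_all add: partitions_def l)
    then have "a = 1" "sum_list l = 0" by arith+
    then have "l = []" using lam by (cases l) (auto simp: partitions_def l)
    then show "lam \<in> {[1]}" using \<open>a = 1\<close> l by simp
  qed
qed (simp add: partitions_def)

lemma SSYT_one_box: "SSYT [1] d = (\<lambda>i. [[i]]) ` {1..d}"
proof
  show "SSYT [1] d \<subseteq> (\<lambda>i. [[i]]) ` {1..d}"
  proof
    fix t assume t: "t \<in> SSYT [1] d"
    then have "map length t = [1]" by (simp add: SSYT_def shape_def)
    then obtain i where "t = [[i]]" by (auto simp: map_eq_Cons_conv length_Suc_conv)
    then show "t \<in> (\<lambda>i. [[i]]) ` {1..d}" using t by (auto simp: SSYT_def)
  qed
qed (auto simp: SSYT_def shape_def)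

lemma SYT_one_box: "SYT [1] = {[[1]]}"
proof -
  have "SYT [1] = {S \<in> SSYT [1] 1. distinct (concat S)}" by (simp add: SYT_def)
  also have "\<dots> = {[[1]]}" unfolding SSYT_one_box by auto
  finally show ?thesis .
qed

lemma words_1: "words d (Suc 0) = (\<lambda>i. [i]) ` {1..d}"
  by (auto simp: words_def length_Suc_conv)

lemma sw_index_1: "d \<ge> 1 \<Longrightarrow> sw_index d (Suc 0) = (\<lambda>w. ([1], [w], [[1]])) ` words d (Suc 0)"
  unfolding sw_index_def partitions_1 words_1
  by (auto simp: SSYT_one_box [simplified] SYT_one_box [simplified])

lemma unitary_of_bij:
  assumes "bij_betw f B A" "finite A" "finite B"
  shows "unitary_mat A B (\<lambda>a b. if a = f b then 1 else 0)"
proof -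
  have 1: "(\<Sum>b\<in>B. (if a = f b then 1 else 0) * cnj (if a' = f b then 1 else 0)) = (mone a a' :: complex)"
    if "a \<in> A" for a a'
  proof -
    have "(\<Sum>b\<in>B. (if a = f b then 1 else 0) * cnj (if a' = f b then 1 else 0))
        = (\<Sum>c\<in>A. (if a = c then 1 else 0) * cnj (if a' = c then 1 else 0) :: complex)"
      by (rule sum.reindex_bij_betw [OF assms(1)])
    also have "\<dots> = (\<Sum>c\<in>A. if a = c then mone a a' else 0)"
      by (rule sum.cong) (auto simp: mone_def)
    finally show ?thesis using that assms(2) by simp
  qed
  have 2: "(\<Sum>a\<in>A. cnj (if a = f b then 1 else 0) * (if a = f b' then 1 else 0)) = (mone b b' :: complex)"
    if "b \<in> B" "b' \<in> B" for b b'
  proof -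
    have "(\<Sum>a\<in>A. cnj (if a = f b then 1 else 0) * (if a = f b' then 1 else 0))
        = (\<Sum>a\<in>A. if a = f b then mone b b' else 0 :: complex)"
      using that assms(1) by (intro sum.cong refl) (auto simp: mone_def bij_betw_def inj_on_def)
    then show ?thesis using that assms(1,2) by (auto simp: bij_betw_def)
  qed
  show ?thesis unfolding unitary_mat_def inverse_mat_def meq_def mmul_def madj_def using 1 2 by blast
qed

text \<open>The recursion for words starts at the trivial representation, where
  \<open>k_half\<close> is 1 and \<open>GenE\<close>, \<open>GenF\<close>, \<open>GenH\<close>
  vanish, so the first factor contributes exactly the vector representation.\<close>

lemma word_rep_1:
  assumes "g \<in> uq_gens q d"
  shows "word_rep q d (Suc 0) g [i] [j] = vec_rep q g i j"
proof -
  have w0: "words d 0 = {[]}" by (auto simp: words_def)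
  have k: "k_half q {[]} trivial_rep l [] [] = 1" for l
    by (simp add: k_half_def mone_def mmul_def trivial_rep_def)
  show ?thesis using assms
    by (cases g) (auto simp: tensor_rep_simps kron_def w0 k trivial_rep_def mone_def)
qed

lemma cascade_0_props:
  assumes d: "d \<ge> 1" and V: "gtj_family q d V"
  shows "unitary_mat (sw_index d (Suc 0)) (words d (Suc 0)) (cascade d P 0)"
    and "uq_intertwiner q d (sw_index d (Suc 0)) (sw_uq V) (words d (Suc 0)) (word_rep q d (Suc 0)) (cascade d P 0)"
proof -
  let ?f = "\<lambda>w. ([1], [w], [[1]]) :: sw_label" and ?A = "sw_index d (Suc 0)" and ?B = "words d (Suc 0)"
  have casc: "cascade d P 0 = (\<lambda>a w. if a = ?f w then 1 else 0)"
    by (auto simp: fun_eq_iff)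
  have bij: "bij_betw ?f ?B ?A" unfolding sw_index_1 [OF d] by (simp add: bij_betw_def inj_on_def)
  show "unitary_mat ?A ?B (cascade d P 0)"
    unfolding casc by (rule unitary_of_bij [OF bij]) simp_all
  show "uq_intertwiner q d ?A (sw_uq V) ?B (word_rep q d (Suc 0)) (cascade d P 0)"
    unfolding uq_intertwiner_def meq_def
  proof (intro ballI)
    fix g a w assume g: "g \<in> uq_gens q d" and a: "a \<in> ?A" and w: "w \<in> ?B"
    obtain u where u: "u \<in> ?B" "a = ?f u" using a sw_index_1 [OF d] by auto
    obtain i j where ij: "u = [i]" "w = [j]" "i \<in> {1..d}" "j \<in> {1..d}" using u(1) w by (auto simp: words_1)
    have "(cascade d P 0 \<odot>\<^bsub>?B\<^esub> word_rep q d (Suc 0) g) a w = (\<Sum>v\<in>?B. if v = u then word_rep q d (Suc 0) g u w else 0)"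
      unfolding mmul_def casc by (rule sum.cong) (auto simp: u)
    also have "\<dots> = word_rep q d (Suc 0) g u w" using u by simp
    also have "\<dots> = vec_rep q g i j" unfolding ij by (rule word_rep_1 [OF g])
    \<comment> \<open>The identification of the one-box irrep with the vector representation in
      \<open>gtj_family\<close> makes the identity matrix an admissible start.\<close>
    also have "\<dots> = V [1] g [[i]] [[j]]" using V g ij by (simp add: gtj_family_def)
    also have "\<dots> = sw_uq V g a (?f w)" by (simp add: u ij sw_uq_def)
    also have "\<dots> = (\<Sum>b\<in>?A. if b = ?f w then sw_uq V g a (?f w) else 0)"
      using bij_betwE [OF bij] w by (simp add: sum.delta)
    also have "\<dots> = (sw_uq V g \<odot>\<^bsub>?A\<^esub> cascade d P 0) a w"
      unfolding mmul_def casc by (rule sum.cong) auto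
    finally show "(cascade d P 0 \<odot>\<^bsub>?B\<^esub> word_rep q d (Suc 0) g) a w = (sw_uq V g \<odot>\<^bsub>?A\<^esub> cascade d P 0) a w" .
  qed
qed

lemma cascade_props:
  assumes d: "d \<ge> 1" and V: "gtj_family q d V"
    and P: "\<And>m lam. lam \<in> partitions m \<Longrightarrow> length lam \<le> d \<Longrightarrow> pieri_transform q d V lam (P lam)"
  shows "unitary_mat (sw_index d (Suc m)) (words d (Suc m)) (cascade d P m) \<and>
    uq_intertwiner q d (sw_index d (Suc m)) (sw_uq V) (words d (Suc m)) (word_rep q d (Suc m)) (cascade d P m)"
proof (induction m)
  case 0
  then show ?case using cascade_0_props [OF d V] by blast
next
  case (Suc m)
  let ?n = "Suc m"
  let ?I = "{1..d}" and ?Q = "pieri_step P ?n" and ?C = "kron (cascade d P m) (mone :: (nat, nat) cmat)"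
  let ?g = "\<lambda>w. (butlast w, last w)"
  have UQ: "unitary_mat (sw_index d (Suc ?n)) (sw_index d ?n \<times> ?I) ?Q"
    by (rule unitary_pieri_step) (use P in \<open>auto simp: pieri_transform_def Let_def\<close>)
  have IQ: "uq_intertwiner q d (sw_index d (Suc ?n)) (sw_uq V) (sw_index d ?n \<times> ?I)
      (tensor_rep q (sw_index d ?n) (sw_uq V) ?I (vec_rep q)) ?Q"
    by (rule uq_intertwiner_pieri_step) (use P in \<open>auto simp: pieri_transform_def Let_def\<close>)
  have UC: "unitary_mat (sw_index d ?n \<times> ?I) (words d ?n \<times> ?I) ?C"
    using Suc by (intro unitary_kron_mone) auto
  have IC: "uq_intertwiner q d (sw_index d ?n \<times> ?I) (tensor_rep q (sw_index d ?n) (sw_uq V) ?I (vec_rep q))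
      (words d ?n \<times> ?I) (tensor_rep q (words d ?n) (word_rep q d ?n) ?I (vec_rep q)) ?C"
    using Suc by (intro uq_intertwiner_tensor) auto
  let ?M = "?Q \<odot>\<^bsub>sw_index d ?n \<times> ?I\<^esub> ?C"
  have U: "unitary_mat (sw_index d (Suc ?n)) (words d ?n \<times> ?I) ?M"
    by (rule unitary_mmul [OF UQ UC]) simp_all
  have I: "uq_intertwiner q d (sw_index d (Suc ?n)) (sw_uq V) (words d ?n \<times> ?I)
      (tensor_rep q (words d ?n) (word_rep q d ?n) ?I (vec_rep q)) ?M"
    by (rule uq_intertwiner_mmul [OF IQ IC])
  have rep: "word_rep q d (Suc ?n) = (\<lambda>g u w. tensor_rep q (words d ?n) (word_rep q d ?n) ?I (vec_rep q) g (?g u) (?g w))"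
    by (simp only: word_rep.simps)
  show ?case
    unfolding rep
    by (intro conjI unitary_cong [OF unitary_reindex [OF U words_Suc_bij] cascade_Suc]
        uq_intertwiner_cong [OF uq_intertwiner_reindex [OF I words_Suc_bij] cascade_Suc])
qed

lemma cascade_real:
  assumes P: "\<And>m lam. lam \<in> partitions m \<Longrightarrow> length lam \<le> d \<Longrightarrow> pieri_transform q d V lam (P lam)"
    and a: "a \<in> sw_index d (Suc m)" and w: "w \<in> words d (Suc m)"
  shows "cascade d P m a w \<in> \<real>"
  using a w
proof (induction m arbitrary: a w)
  case 0
  then show ?case by (cases a) auto
next
  case (Suc m)
  obtain \<mu> s S where aa: "a = (\<mu>, s, S)" by (cases a)
  have w: "butlast w \<in> words d (Suc m)" "last w \<in> {1..d}"
    using bij_betwE [OF words_Suc_bij] Suc.prems(2) by fastforce+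
  have "(case b of (lam, t, S') \<Rightarrow> if covers \<mu> lam \<and> S = add_box \<mu> S' (m + 2)
       then P lam s (t, last w) * cascade d P m (lam, t, S') (butlast w) else 0) \<in> \<real>"
    if b: "b \<in> sw_index d (Suc m)" for b
  proof -
    obtain lam t S' where bb: "b = (lam, t, S')" by (cases b)
    have lam: "lam \<in> partitions (Suc m)" "length lam \<le> d" "t \<in> SSYT lam d"
      using b by (auto simp: bb sw_index_def)
    have "P lam s (t, last w) \<in> \<real>" if "covers \<mu> lam"
    proof -
      have "s \<in> pieri_index d lam"
        using that Suc.prems(1) lam by (auto simp: aa sw_index_def pieri_index_def partitions_sum)
      then show ?thesis using P [OF lam(1,2)] lam w by (auto simp: pieri_transform_def Let_def real_mat_def)
    qed
    moreover have "cascade d P m (lam, t, S') (butlast w) \<in> \<real>"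
      using Suc.IH [OF b w(1)] by (simp add: bb)
    ultimately show ?thesis by (simp add: bb)
  qed
  then show ?case unfolding aa cascade.simps prod.case by (intro sum_in_Reals)
qed

section \<open>Contents as weights and the support of the cascade\<close>

lemma word_weight_basis:
  assumes q: "q > 0"
  shows "weight_basis q d (words d n) (word_rep q d n) mset"
proof -
  have "word_rep q d n (cartan_gen q i) u w = (if u = w then weight_eig q (real (count (mset w) i)) else 0)"
    if "u \<in> words d n" "w \<in> words d n" for i u w
    using that
  proof (induction n arbitrary: u w)
    case 0
    then show ?case using q
      by (auto simp: words_def trivial_rep_def cartan_gen_def weight_eig_def mone_def)
  next
    case (Suc n)
    obtain u' a where u: "u = u' @ [a]" "u' \<in> words d n"
      using Suc.prems(1) by (cases u rule: rev_cases) (auto simp: words_def)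
    obtain w' b where w: "w = w' @ [b]" "w' \<in> words d n"
      using Suc.prems(2) by (cases w rule: rev_cases) (auto simp: words_def)
    note IH = Suc.IH [OF u(2) w(2)]
    show ?case
    proof (cases "q = 1")
      case True
      then show ?thesis using IH
        by (auto simp: u w cartan_gen_def weight_eig_def tensor_rep_simps kron_def mone_def vec_rep_def)
    next
      case False
      then show ?thesis using IH q
        by (auto simp: u w cartan_gen_def weight_eig_def tensor_rep_simps kron_def vec_rep_def
            add_divide_distrib powr_add)
    qed
  qed
  then show ?thesis by (auto simp: weight_basis_def meq_def words_def)
qed

lemma gtj_family_irrep:
  "gtj_family q d V \<Longrightarrow> lam \<in> partitions n \<Longrightarrow> length lam \<le> d \<Longrightarrow> gtj_irrep q d lam (V lam)"
  by (auto simp: gtj_family_def)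

lemma sw_weight_basis:
  assumes V: "gtj_family q d V" and q: "q > 0"
  shows "weight_basis q d (sw_index d n) (sw_uq V) (\<lambda>(lam, t, S). mset (concat t))"
proof -
  have wb: "weight_basis q d (SSYT lam d) (V lam) (\<lambda>t. mset (concat t))"
    if "lam \<in> partitions n" "length lam \<le> d" for lam
    by (rule gtj_weight_basis [OF gtj_family_irrep [OF V that] that(1) q])
  show ?thesis
    unfolding weight_basis_def meq_def
  proof (intro conjI ballI)
    fix b assume b: "b \<in> sw_index d n"
    obtain lam t S where bb: "b = (lam, t, S)" by (cases b)
    have "set (concat t) \<subseteq> {1..d}" using b unfolding bb sw_index_def SSYT_def by blast
    then show "set_mset (case b of (lam, t, S) \<Rightarrow> mset (concat t)) \<subseteq> {1..d}"
      unfolding bb prod.case set_mset_mset .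
  next
    fix i a b assume i: "i \<in> {1..d}" and a: "a \<in> sw_index d n" and b: "b \<in> sw_index d n"
    obtain lam t S where aa: "a = (lam, t, S)" by (cases a)
    obtain lam' t' S' where bb: "b = (lam', t', S')" by (cases b)
    show "sw_uq V (cartan_gen q i) a b
        = (if a = b then weight_eig q (real (count (case b of (lam, t, S) \<Rightarrow> mset (concat t)) i)) else 0)"
    proof (cases "lam = lam' \<and> S = S'")
      case True
      have "V lam (cartan_gen q i) t t' = (if t = t' then weight_eig q (real (count (mset (concat t')) i)) else 0)"
        using wb [of lam] i a b True by (simp add: aa bb sw_index_def weight_basis_def meq_def)
      then show ?thesis using True by (simp add: aa bb sw_uq_def)
    qed (auto simp: aa bb sw_uq_def)
  qed
qed

lemma sw_word_weight:
  assumes V: "gtj_family q d V" and q: "q > 0"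
    and M: "uq_intertwiner q d (sw_index d n) (sw_uq V) (words d n) (word_rep q d n) M"
    and "(lam, t, S) \<in> sw_index d n" "w \<in> words d n" "M (lam, t, S) w \<noteq> 0"
  shows "mset (concat t) = mset w"
  using intertwiner_weight [OF sw_weight_basis [OF V q] word_weight_basis [OF q] M finite_sw_index finite_words q assms(4-6)]
  by simp

text \<open>\<open>t\<close> stays arbitrary in the induction because intermediate tableaux run
  through all of \<open>SSYT lam d\<close>, whatever the final one is. Proper prefixes are governed
  by the previous stage; the full word is governed by its weight.\<close>

lemma cascade_support:
  assumes d: "d \<ge> 1" and V: "gtj_family q d V" and q: "q > 0"
    and P: "\<And>m lam. lam \<in> partitions m \<Longrightarrow> length lam \<le> d \<Longrightarrow> pieri_transform q d V lam (P lam)"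
    and a: "(lam, t, S) \<in> sw_index d (Suc m)" and w: "w \<in> words d (Suc m)" and nz: "cascade d P m (lam, t, S) w \<noteq> 0"
  shows "prefix_le w (row_word S)"
  using a w nz
proof (induction m arbitrary: lam t S w)
  case (0 lam t S w)
  have "uq_intertwiner q d (sw_index d (Suc 0)) (sw_uq V) (words d (Suc 0)) (word_rep q d (Suc 0)) (cascade d P 0)"
    by (rule conjunct2, rule cascade_props [OF d V]) (rule P)
  from sw_word_weight [OF V q this 0] have "mset (concat t) = mset w" .
  then have 1: "prefix_count w 1 m \<le> prefix_count (row_word S) 1 m" for m
    using 0 by (intro prefix_count_content_le [of t lam d]) (auto simp: sw_index_def)
  show ?case
    unfolding prefix_le_def
  proof (intro allI impI)
    fix k m assume "k \<le> length w"
    then have "k = 0 \<or> k = 1" using 0 by (auto simp: words_def)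
    then show "prefix_count w k m \<le> prefix_count (row_word S) k m"
      using 1 by (elim disjE) simp_all
  qed
next
  case (Suc m \<mu> s T w)
  let ?n = "Suc m"
  have am: "\<mu> \<in> partitions (Suc ?n)" "length \<mu> \<le> d" "s \<in> SSYT \<mu> d" "T \<in> SYT \<mu>"
    using Suc.prems by (auto simp: sw_index_def)
  have lenw: "length w = Suc ?n" using Suc.prems by (simp add: words_def)
  have w': "butlast w \<in> words d ?n" using bij_betwE [OF words_Suc_bij] Suc.prems(2) by fastforce
  have "uq_intertwiner q d (sw_index d (Suc ?n)) (sw_uq V) (words d (Suc ?n)) (word_rep q d (Suc ?n)) (cascade d P ?n)"
    by (rule conjunct2, rule cascade_props [OF d V]) (rule P)
  from sw_word_weight [OF V q this Suc.prems] have "mset (concat s) = mset w" .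
  then have full: "prefix_count w (Suc ?n) m' \<le> prefix_count (row_word T) (Suc ?n) m'" for m'
    using am by (intro prefix_count_content_le [of s \<mu> d]) auto
  \<comment> \<open>A nonzero sum has a nonzero summand, and its label \<open>S'\<close> is the
    restriction of \<open>T\<close>.\<close>
  obtain b where b: "b \<in> sw_index d ?n" and nzb: "(case b of (lam, t, S') \<Rightarrow>
      if covers \<mu> lam \<and> T = add_box \<mu> S' (m + 2)
      then P lam s (t, last w) * cascade d P m (lam, t, S') (butlast w) else 0) \<noteq> 0"
    using Suc.prems(3) unfolding cascade.simps prod.case by (rule sum.not_neutral_contains_not_neutral)
  obtain lam t S' where bb: "b = (lam, t, S')" by (cases b)
  have cov: "covers \<mu> lam" "T = add_box \<mu> S' (Suc ?n)" and nz': "cascade d P m (lam, t, S') (butlast w) \<noteq> 0"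
    using nzb by (auto simp: bb split: if_splits)
  have lam: "lam \<in> partitions ?n" "S' \<in> SYT lam" using b by (auto simp: bb sw_index_def)
  have IH: "prefix_le (butlast w) (row_word S')" by (rule Suc.IH [OF b [unfolded bb] w' nz'])
  show ?case
    unfolding prefix_le_def
  proof (intro allI impI)
    fix k m' assume k: "k \<le> length w"
    show "prefix_count w k m' \<le> prefix_count (row_word T) k m'"
    proof (cases "k = Suc ?n")
      case False
      then have k': "k \<le> ?n" using k lenw by simp
      have "prefix_count w k m' = prefix_count (butlast w) k m'"
        by (rule prefix_count_cong) (use k' lenw in \<open>simp add: nth_butlast\<close>)
      also have "\<dots> \<le> prefix_count (row_word S') k m'"
        using IH k' lenw by (simp add: prefix_le_def)
      also have "\<dots> = prefix_count (row_word T) k m'"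
        unfolding cov(2) by (rule prefix_count_add_box [OF lam(1) am(1) cov(1) lam(2) k', symmetric])
      finally show ?thesis .
    qed (use full in simp)
  qed
qed

section \<open>The Hecke action and triangularity\<close>

text \<open>Two forms of the recursion: the first shows monotonicity in \<open>m\<close> for
  \<open>q \<ge> 1\<close>, the second for \<open>q < 1\<close>.\<close>

lemma qint_of_nat_Suc:
  assumes "q > 0"
  shows "qint q (int (Suc m)) = q * qint q (int m) + inverse q ^ m"
    and "qint q (int (Suc m)) = inverse q * qint q (int m) + q ^ m"
proof -
  have qint: "qint q (int k) = (q ^ k - inverse q ^ k) / (q - inverse q)" if "q \<noteq> 1" for k
    using that by (simp add: qint_def power_int_def power_int_minus power_inverse)
  have D: "q - inverse q \<noteq> 0" if "q \<noteq> 1"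
  proof
    assume "q - inverse q = 0"
    then have "q * q = 1" using assms by (simp add: field_simps)
    then show False using assms that
      by (metis abs_of_pos mult_cancel_right2 power2_eq_1_iff power2_eq_square less_asym zero_less_one
          neg_less_0_iff_less)
  qed
  show "qint q (int (Suc m)) = q * qint q (int m) + inverse q ^ m"
  proof (cases "q = 1")
    case False
    have "(q ^ Suc m - inverse q ^ Suc m) = q * (q ^ m - inverse q ^ m) + inverse q ^ m * (q - inverse q)"
      by (simp add: algebra_simps)
    then show ?thesis unfolding qint [OF False] using D [OF False] by (simp add: add_divide_distrib)
  qed (simp add: qint_def)
  show "qint q (int (Suc m)) = inverse q * qint q (int m) + q ^ m"
  proof (cases "q = 1")
    case False
    have "(q ^ Suc m - inverse q ^ Suc m) = inverse q * (q ^ m - inverse q ^ m) + q ^ m * (q - inverse q)"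
      by (simp add: algebra_simps)
    then show ?thesis unfolding qint [OF False] using D [OF False] by (simp add: add_divide_distrib)
  qed (simp add: qint_def)
qed

lemma qint_one: "q > 0 \<Longrightarrow> qint q 1 = 1"
  using qint_of_nat_Suc(1) [of q 0] by (simp add: qint_def)

lemma qint_minus: "qint q (- a) = - qint q a"
  by (simp add: qint_def minus_divide_left)

lemma qint_gt_one:
  assumes "q > 0"
  shows "1 < qint q (int (Suc (Suc m)))"
proof -
  have step: "qint q (int k) < qint q (int (Suc k))" if "0 \<le> qint q (int k)" for k
  proof (cases "1 \<le> q")
    case True
    have "qint q (int k) \<le> q * qint q (int k)" using True that by (simp add: mult_le_cancel_right1)
    moreover have "0 < inverse q ^ k" using assms by simp
    ultimately show ?thesis unfolding qint_of_nat_Suc(1) [OF assms] by linarith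
  next
    case False
    then have "1 \<le> inverse q" using assms by (simp add: one_le_inverse)
    then have "qint q (int k) \<le> inverse q * qint q (int k)" using that by (simp add: mult_le_cancel_right1)
    moreover have "0 < q ^ k" using assms by simp
    ultimately show ?thesis unfolding qint_of_nat_Suc(2) [OF assms] by linarith
  qed
  show ?thesis
  proof (induction m)
    case 0
    then show ?case using step [of 1] qint_one [OF assms] by simp
  next
    case (Suc m)
    then show ?case using step [of "Suc (Suc m)"] by linarith
  qed
qed

text \<open>At a free ascent the residue drops by at least 2, which is what the bound on
  \<open>a\<close> expresses; at \<open>a = -1\<close> the coefficient would vanish because
  \<open>[-1]^2 = 1\<close>.\<close>

lemma yyh_offdiag_nonzero:
  assumes "q > 0" "a \<le> -2"
  shows "sqrt (1 - 1 / (qint q a)\<^sup>2) \<noteq> 0"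
proof -
  obtain m where m: "a = - int (Suc (Suc m))"
    using assms(2) by (metis add_2_eq_Suc neg_le_iff_le int_ops(3) minus_minus nonneg_int_cases
        of_nat_add of_nat_numeral zle_iff_zadd)
  have "1 < (qint q a)\<^sup>2"
    using qint_gt_one [OF assms(1), of m] by (simp add: m qint_minus del: of_nat_Suc)
  then show ?thesis by simp
qed

section \<open>Hecke generators on rows of coefficients\<close>

lemma letter_swap_words: "w \<in> words d n \<Longrightarrow> Suc p < n \<Longrightarrow> letter_swap p w \<in> words d n"
  using mset_letter_swap [of p w] by (auto simp: words_def dest!: mset_eq_setD)

text \<open>The row vector \<open>x\<close> times the matrix of the generator with index
  \<open>Suc p\<close>, evaluated at \<open>w\<close>: generators are numbered from 1, list
  positions from 0.\<close>

definition hecke_apply :: "real \<Rightarrow> nat \<Rightarrow> (nat list \<Rightarrow> complex) \<Rightarrow> nat list \<Rightarrow> complex" where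
  "hecke_apply q p x w =
    (if w ! p < w ! Suc p then x (letter_swap p w)
     else if w ! Suc p < w ! p then complex_of_real (inverse q - q) * x w + x (letter_swap p w)
     else complex_of_real (inverse q) * x w)"

lemma sum_hecke_word:
  assumes w: "w \<in> words d n" and p: "Suc p < n"
  shows "(\<Sum>u\<in>words d n. x u * hecke_word q (Suc p) u w) = hecke_apply q p x w"
proof -
  have delta: "(\<Sum>u\<in>words d n. x u * (c * mone u v)) = c * x v" if "v \<in> words d n" for v c
  proof -
    have "(\<Sum>u\<in>words d n. x u * (c * mone u v)) = (\<Sum>u\<in>words d n. if u = v then c * x v else 0)"
      by (rule sum.cong) (auto simp: mone_def)
    then show ?thesis using that by simp
  qed
  have lw: "letter_swap p w \<in> words d n" by (rule letter_swap_words [OF w p])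
  have hw: "hecke_word q (Suc p) u w = (if w ! p < w ! Suc p then 1 * mone u (letter_swap p w)
      else if w ! Suc p < w ! p then complex_of_real (inverse q - q) * mone u w + 1 * mone u (letter_swap p w)
      else complex_of_real (inverse q) * mone u w)" for u
    by (simp add: hecke_word_def letter_swap_def Let_def)
  consider "w ! p < w ! Suc p" | "w ! Suc p < w ! p" | "w ! p = w ! Suc p" by linarith
  then show ?thesis
  proof cases
    case 1
    then show ?thesis unfolding hw hecke_apply_def using delta [OF lw, of 1] by simp
  next
    case 2
    then have "\<not> w ! p < w ! Suc p" by simp
    then show ?thesis unfolding hw hecke_apply_def using 2 delta [OF lw, of 1] delta [OF w]
      by (simp only: if_True if_False distrib_left sum.distrib mult_1)
  next
    case 3
    then show ?thesis unfolding hw hecke_apply_def using delta [OF w] by (simp only: less_irrefl if_False)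
  qed
qed

text \<open>Counterpart of \<open>sum_sw_block\<close> for the Hecke algebra, which fixes
  \<open>(lam, t)\<close> and mixes the standard tableaux.\<close>

lemma sum_sw_mult:
  assumes lam: "lam \<in> partitions n" "length lam \<le> d" "t \<in> SSYT lam d"
    and f: "\<And>lam' t' S. (lam', t', S) \<in> sw_index d n \<Longrightarrow> \<not> (lam' = lam \<and> t' = t) \<Longrightarrow> f (lam', t', S) = 0"
  shows "sum f (sw_index d n) = (\<Sum>S\<in>SYT lam. f (lam, t, S))"
proof -
  have inj: "inj_on (\<lambda>S. (lam, t, S)) (SYT lam)" by (simp add: inj_on_def)
  have "sum f (sw_index d n) = sum f ((\<lambda>S. (lam, t, S)) ` SYT lam)"
  proof (rule sum.mono_neutral_right)
    show "(\<lambda>S. (lam, t, S)) ` SYT lam \<subseteq> sw_index d n" using lam by (auto simp: sw_index_def)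
    show "\<forall>x\<in>sw_index d n - (\<lambda>S. (lam, t, S)) ` SYT lam. f x = 0"
      using f by (auto simp: sw_index_def image_iff)
  qed simp
  then show ?thesis by (simp add: sum.reindex [OF inj])
qed

definition yyh_diag :: "real \<Rightarrow> nat \<Rightarrow> tableau \<Rightarrow> complex" where
  "yyh_diag q i S = (let a = residue S (Suc i) - residue S i in complex_of_real (q powi (- a) / qint q a))"

definition yyh_offdiag :: "real \<Rightarrow> nat \<Rightarrow> tableau \<Rightarrow> complex" where
  "yyh_offdiag q i S = (let a = residue S (Suc i) - residue S i in complex_of_real (sqrt (1 - 1 / (qint q a)\<^sup>2)))"

text \<open>\<open>yyh\<close> is given by columns. Along row \<open>S\<close> the off-diagonal
  entry stands in column \<open>swap_entries i S\<close> and carries the coefficient of that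
  tableau.\<close>

lemma sum_yyh:
  assumes S: "S \<in> SYT lam"
  shows "(\<Sum>S'\<in>SYT lam. yyh q i S S' * y S') = yyh_diag q i S * y S +
    (if swap_entries i S \<in> SYT lam then yyh_offdiag q i (swap_entries i S) * y (swap_entries i S) else 0)"
proof -
  have swap: "S = swap_entries i S' \<longleftrightarrow> S' = swap_entries i S" for S'
    using swap_entries_invol by metis
  have "(\<Sum>S'\<in>SYT lam. yyh q i S S' * y S')
      = (\<Sum>S'\<in>SYT lam. (if S' = S then yyh_diag q i S * y S else 0) +
          (if S' = swap_entries i S then yyh_offdiag q i (swap_entries i S) * y (swap_entries i S) else 0))"
  proof (rule sum.cong [OF refl])
    fix S'
    have "yyh q i S S' * y S' = yyh_diag q i S' * mone S S' * y S' + yyh_offdiag q i S' * mone S (swap_entries i S') * y S'"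
      by (simp add: yyh_def yyh_diag_def yyh_offdiag_def Let_def distrib_right)
    also have "yyh_diag q i S' * mone S S' * y S' = (if S' = S then yyh_diag q i S * y S else 0)"
      by (simp add: mone_def)
    also have "yyh_offdiag q i S' * mone S (swap_entries i S') * y S'
        = (if S' = swap_entries i S then yyh_offdiag q i (swap_entries i S) * y (swap_entries i S) else 0)"
      unfolding mone_def swap by simp
    finally show "yyh q i S S' * y S' = (if S' = S then yyh_diag q i S * y S else 0) +
          (if S' = swap_entries i S then yyh_offdiag q i (swap_entries i S) * y (swap_entries i S) else 0)" .
  qed
  then show ?thesis using S by (simp add: sum.distrib)
qed

lemma schur_weyl_hecke_row:
  assumes W: "schur_weyl_transform q d n V W"
    and lam: "lam \<in> partitions n" "length lam \<le> d" "t \<in> SSYT lam d" and S: "S \<in> SYT lam"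
    and p: "Suc p < n" and w: "w \<in> words d n"
  shows "hecke_apply q p (W (lam, t, S)) w = yyh_diag q (Suc p) S * W (lam, t, S) w +
      (if swap_entries (Suc p) S \<in> SYT lam
       then yyh_offdiag q (Suc p) (swap_entries (Suc p) S) * W (lam, t, swap_entries (Suc p) S) w else 0)"
proof -
  have idx: "(lam, t, S) \<in> sw_index d n" using lam S by (simp add: sw_index_def)
  have "(\<Sum>u\<in>words d n. W (lam, t, S) u * hecke_word q (Suc p) u w)
      = (\<Sum>b\<in>sw_index d n. sw_hecke q (Suc p) (lam, t, S) b * W b w)"
    using W idx w p by (simp add: schur_weyl_transform_def meq_def mmul_def)
  also have "\<dots> = (\<Sum>S'\<in>SYT lam. sw_hecke q (Suc p) (lam, t, S) (lam, t, S') * W (lam, t, S') w)"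
    by (rule sum_sw_mult [OF lam]) (auto simp: sw_hecke_def)
  also have "\<dots> = (\<Sum>S'\<in>SYT lam. yyh q (Suc p) S S' * W (lam, t, S') w)"
    by (simp add: sw_hecke_def)
  also have "\<dots> = yyh_diag q (Suc p) S * W (lam, t, S) w +
      (if swap_entries (Suc p) S \<in> SYT lam
       then yyh_offdiag q (Suc p) (swap_entries (Suc p) S) * W (lam, t, swap_entries (Suc p) S) w else 0)"
    by (rule sum_yyh [OF S])
  finally show ?thesis unfolding sum_hecke_word [OF w p] .
qed

text \<open>Makes explicit that the off-diagonal term is absent at a vertical ascent, so that
  \<open>T_i\<close> acts there by a scalar.\<close>

lemma same_column_not_SYT:
  assumes S: "S \<in> SYT lam" and lam: "lam \<in> partitions n" and i: "1 \<le> i" "i < n"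
    and r: "fst (pos S i) < fst (pos S (Suc i))" and c: "snd (pos S i) = snd (pos S (Suc i))"
  shows "swap_entries i S \<notin> SYT lam"
proof
  assume S': "swap_entries i S \<in> SYT lam"
  have n: "sum_list lam = n" using lam by (rule partitions_sum)
  have b: "pos S i \<in> boxes lam" "pos S (Suc i) \<in> boxes lam"
    using pos_in_boxes [OF S] i n by auto
  have "entry (swap_entries i S) (pos S i) = Suc i" "entry (swap_entries i S) (pos S (Suc i)) = i"
    using b SYT_shape [OF S] entry_pos [OF S, of i] entry_pos [OF S, of "Suc i"] i n
    by (auto simp: entry_swap_entries step_swap_def)
  moreover have "entry (swap_entries i S) (pos S i) < entry (swap_entries i S) (pos S (Suc i))"
  proof -
    obtain r c' where 1: "pos S i = (r, c')" by fastforce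
    obtain r' c'' where 2: "pos S (Suc i) = (r', c'')" by fastforce
    show ?thesis using SYT_strict [OF S' lam, of r' c'' r c'] b r c by (simp add: 1 2)
  qed
  ultimately show False by simp
qed

lemma row_word_words:
  assumes "S \<in> SYT lam" "lam \<in> partitions n" "length lam \<le> d"
  shows "row_word S \<in> words d n"
  using length_row_word [OF assms(1)] row_word_range [OF assms(1)] partitions_sum [OF assms(2)] assms(3)
  by (auto simp: words_def)

lemma words_prefix_antisym:
  assumes "u \<in> words d n" "v \<in> words d n" "prefix_le u v" "prefix_height d v \<le> prefix_height d u"
  shows "u = v"
  using assms by (intro prefix_le_antisym_height [of u v d]) (auto simp: words_def)

text \<open>Induction along the order. If \<open>i\<close> and \<open>i + 1\<close> form a free ascent of \<open>S\<close>, the vector of \<open>S\<close> is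
  obtained by applying \<open>T\<^sub>i\<close> to that of the smaller tableau \<open>s\<^sub>i S\<close>. If there is no free ascent,
  \<open>T\<^sub>i\<close> acts by \<open>-q\<close> at every ascent, and antisymmetry determines the vector up to a scalar.\<close>

lemma schur_weyl_triangular:
  assumes q: "q > 0" and V: "gtj_family q d V" and W: "schur_weyl_transform q d n V W"
    and lam: "lam \<in> partitions n" "length lam \<le> d" and S: "S \<in> SYT lam"
  defines "h \<equiv> hw_tableau lam"
  shows "(\<forall>w\<in>words d n. W (lam, h, S) w \<noteq> 0 \<longrightarrow> prefix_le w (row_word S)) \<and> W (lam, h, S) (row_word S) \<noteq> 0"
  using S
proof (induction "prefix_height d (row_word S)" arbitrary: S rule: less_induct)
  case (less S)
  note S = less.prems
  have n: "sum_list lam = n" using lam(1) by (rule partitions_sum)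
  have h: "h \<in> SSYT lam d" unfolding h_def by (rule hw_tableau_SSYT [OF lam])
  let ?v = "row_word S"
  have v: "?v \<in> words d n" by (rule row_word_words [OF S lam])
  have nth_v: "?v ! p = Suc (fst (pos S (Suc p)))" if "p < n" for p
    using nth_row_word [OF S] that n by simp
  have len: "length (concat S) = n" using sum_list_shape [of S] SYT_shape [OF S] n by simp
  show ?case
  proof (cases "no_free_ascent S")
    case True
    define Q where "Q = {w \<in> words d n. W (lam, h, S) w \<noteq> 0}"
    have asc: "fst (pos S (Suc p)) < fst (pos S (Suc (Suc p)))" "snd (pos S (Suc p)) = snd (pos S (Suc (Suc p)))"
      if "Suc p < n" "?v ! p < ?v ! Suc p" for p
    proof -
      show *: "fst (pos S (Suc p)) < fst (pos S (Suc (Suc p)))" using that by (simp add: nth_v)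
      then show "snd (pos S (Suc p)) = snd (pos S (Suc (Suc p)))"
        using True that len by (simp add: no_free_ascent_def)
    qed
    have T: "hecke_apply q p (W (lam, h, S)) w = - complex_of_real q * W (lam, h, S) w"
      if p: "Suc p < n" "?v ! p < ?v ! Suc p" and w: "w \<in> words d n" for p w
    proof -
      note r = asc(1) [OF p] and c = asc(2) [OF p]
      have nS: "swap_entries (Suc p) S \<notin> SYT lam"
        by (rule same_column_not_SYT [OF S lam(1) _ p(1) r c]) simp
      have "fst (pos S (Suc (Suc p))) = Suc (fst (pos S (Suc p)))"
        using SYT_ascent(2) [OF S lam(1) _ p(1) r] c by simp
      \<comment> \<open>Vertical neighbours have residue difference -1, where the diagonal
        coefficient is \<open>q / [-1] = -q\<close>.\<close>
      then have "residue S (Suc (Suc p)) - residue S (Suc p) = -1"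
        using residue_SYT [OF S] p(1) n c by simp
      then have "yyh_diag q (Suc p) S = - complex_of_real q"
        using qint_minus [of q 1] qint_one [OF q] by (simp add: yyh_diag_def)
      then show ?thesis using schur_weyl_hecke_row [OF W lam h S p(1) w] nS by simp
    qed
    have "\<exists>w\<in>words d n. W (lam, h, S) w \<noteq> 0"
    proof (rule ccontr)
      assume no: "\<not> ?thesis"
      have "(\<Sum>w\<in>words d n. W (lam, h, S) w * cnj (W (lam, h, S) w)) = 1"
        using W lam h S
        by (simp add: schur_weyl_transform_def unitary_mat_def inverse_mat_def meq_def mmul_def madj_def
            mone_def sw_index_def)
      then show False using no by simp
    qed
    then obtain w0 where w0: "w0 \<in> Q" by (auto simp: Q_def)
    have sorted: "prefix_le w ?v \<and> ?v \<in> Q" if wQ: "w \<in> Q" for w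
    proof (rule sort_runs [where n = n and Q = Q and d = d])
      show "w \<in> Q" by (rule wQ)
      show "length ?v = n" using v by (simp add: words_def)
      show "?v ! 0 = 1" if "0 < n" using pos_one_row [OF S lam(1)] that nth_v [of 0] by simp
      show "?v ! Suc p = 1 \<or> ?v ! Suc p = Suc (?v ! p)" if p: "Suc p < n" for p
      proof (cases "?v ! p < ?v ! Suc p")
        case True
        have "fst (pos S (Suc (Suc p))) = Suc (fst (pos S (Suc p)))"
          using SYT_ascent(2) [OF S lam(1) _ p asc(1) [OF p True]] asc(2) [OF p True] by simp
        then show ?thesis using p by (simp add: nth_v)
      next
        case False
        then have "fst (pos S (Suc (Suc p))) \<le> fst (pos S (Suc p))" using p by (simp add: nth_v)
        then have "fst (pos S (Suc (Suc p))) = 0"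
          using no_free_ascent_descent [OF S lam(1) _ p \<open>no_free_ascent S\<close>] by simp
        then show ?thesis using p by (simp add: nth_v)
      qed
    next
      fix w assume w: "w \<in> Q"
      then have ww: "w \<in> words d n" and nz: "W (lam, h, S) w \<noteq> 0" by (auto simp: Q_def)
      have I: "uq_intertwiner q d (sw_index d n) (sw_uq V) (words d n) (word_rep q d n) W"
        using W by (simp add: schur_weyl_transform_def)
      have idx: "(lam, h, S) \<in> sw_index d n" using lam h S by (simp add: sw_index_def)
      have "mset (concat h) = mset w" by (rule sw_word_weight [OF V q I idx ww nz])
      then have "sum_list w = sum_list (concat h)" by (metis sum_mset_sum_list)
      then show "length w = n \<and> set w \<subseteq> {1..d} \<and> sum_list w = sum_list ?v"
        using ww sum_row_word [OF S] by (simp add: words_def h_def)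
      fix p assume p: "Suc p < n" "?v ! p < ?v ! Suc p"
      note Tw = T [OF p ww, unfolded hecke_apply_def]
      \<comment> \<open>On equal letters the generator acts by \<open>1/q\<close>, which differs
        from \<open>-q\<close> as \<open>q > 0\<close>, so such words are outside the
        support.\<close>
      show "w ! p \<noteq> w ! Suc p"
      proof
        assume "w ! p = w ! Suc p"
        then have "complex_of_real (inverse q) * W (lam, h, S) w = - complex_of_real q * W (lam, h, S) w"
          using Tw by simp
        then have "complex_of_real (inverse q + q) * W (lam, h, S) w = 0" by (simp add: distrib_right)
        moreover have "inverse q + q \<noteq> 0" using q by (simp add: add_pos_pos less_imp_neq [symmetric])
        ultimately show False using nz by (simp del: of_real_add of_real_inverse)
      qed
      assume d: "w ! Suc p < w ! p"
      then have "\<not> w ! p < w ! Suc p" by simp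
      then have "complex_of_real (inverse q - q) * W (lam, h, S) w + W (lam, h, S) (letter_swap p w)
          = - complex_of_real q * W (lam, h, S) w"
        using Tw d by (simp only: if_True if_False)
      \<comment> \<open>Sorting a descent multiplies the coefficient by \<open>-1/q\<close>, hence
        keeps the word in the support.\<close>
      then have "W (lam, h, S) (letter_swap p w) = - complex_of_real (inverse q) * W (lam, h, S) w"
        by (simp add: algebra_simps) (simp add: eq_neg_iff_add_eq_0)
      then show "letter_swap p w \<in> Q" using nz q letter_swap_words [OF ww p(1)] by (simp add: Q_def)
    qed
    show ?thesis using sorted w0 by (auto simp: Q_def)
  next
    case False
    then obtain i where i: "1 \<le> i" "i < n" "fst (pos S i) < fst (pos S (Suc i))" "snd (pos S i) \<noteq> snd (pos S (Suc i))"
      unfolding no_free_ascent_def len by blast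
    obtain p where p: "i = Suc p" using i(1) by (cases i) auto
    have pn: "Suc p < n" using i p by simp
    let ?S = "swap_entries (Suc p) S"
    let ?u = "row_word ?S"
    have S': "?S \<in> SYT lam" using swap_entries_SYT [OF S lam(1) i(1,2)] i(3,4) p by simp
    have u: "?u \<in> words d n" by (rule row_word_words [OF S' lam])
    have uv: "?u = letter_swap p ?v"
      unfolding letter_swap_def by (rule row_word_swap_entries [OF S S']) (use pn n in simp)
    have lv: "length ?v = n" "length ?u = n" using u v by (simp_all add: words_def)
    have vu: "?v = letter_swap p ?u" unfolding uv by (rule letter_swap_invol [symmetric]) (use pn lv in simp)
    have v_asc: "?v ! p < ?v ! Suc p" using i p pn by (simp add: nth_v)
    have u_desc: "?u ! Suc p < ?u ! p" unfolding uv using v_asc pn lv by (simp add: nth_letter_swap)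
    have uv_le: "prefix_le ?u ?v"
      unfolding vu by (subst vu [symmetric], subst vu) (rule prefix_le_letter_swap, use pn lv u_desc in auto)
    have neq: "?u \<noteq> ?v" using v_asc u_desc by auto
    have lt: "prefix_height d ?u < prefix_height d ?v"
      using words_prefix_antisym [OF u v uv_le] neq by (meson not_less)
    have IH: "\<And>w. w \<in> words d n \<Longrightarrow> W (lam, h, ?S) w \<noteq> 0 \<Longrightarrow> prefix_le w ?u" "W (lam, h, ?S) ?u \<noteq> 0"
      using less.hyps [OF lt S'] by auto
    let ?b = "yyh_offdiag q (Suc p) S"
    have b: "?b \<noteq> 0"
    proof -
      have "snd (pos S (Suc i)) < snd (pos S i)" using SYT_ascent(1) [OF S lam(1) i(1,2,3)] i(4) by simp
      then have "residue S (Suc (Suc p)) - residue S (Suc p) \<le> -2"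
        using residue_SYT [OF S] pn n i(3) p by simp
      then show ?thesis using yyh_offdiag_nonzero [OF q] unfolding yyh_offdiag_def Let_def by simp
    qed
    have T: "hecke_apply q p (W (lam, h, ?S)) w
        = yyh_diag q (Suc p) ?S * W (lam, h, ?S) w + ?b * W (lam, h, S) w" if w: "w \<in> words d n" for w
      using schur_weyl_hecke_row [OF W lam h S' pn w] S by (simp add: swap_entries_invol)
    show ?thesis
    proof (intro conjI ballI impI)
      fix w assume w: "w \<in> words d n" and nz: "W (lam, h, S) w \<noteq> 0"
      \<comment> \<open>The generator relates the coefficient at \<open>w\<close> only to those of
        \<open>?S\<close> at \<open>w\<close> and at its swap, and \<open>?b\<close> is
        nonzero.\<close>
      have "W (lam, h, ?S) w \<noteq> 0 \<or> W (lam, h, ?S) (letter_swap p w) \<noteq> 0"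
      proof (rule ccontr)
        assume "\<not> ?thesis"
        then have "?b * W (lam, h, S) w = 0" using T [OF w] by (simp add: hecke_apply_def split: if_splits)
        then show False using b nz by simp
      qed
      then show "prefix_le w ?v"
      proof
        assume "W (lam, h, ?S) w \<noteq> 0"
        from prefix_le_trans [OF IH(1) [OF w this] uv_le] show ?thesis using w lv by (simp add: words_def)
      next
        assume "W (lam, h, ?S) (letter_swap p w) \<noteq> 0"
        \<comment> \<open>The lifting property applies because \<open>?u\<close> has a descent at
          \<open>p\<close>; swapping both sides returns \<open>w\<close> and turns \<open>?u\<close>
          into \<open>?v\<close>.\<close>
        from IH(1) [OF letter_swap_words [OF w pn] this]
        have "prefix_le (letter_swap p (letter_swap p w)) (letter_swap p ?u)"
          by (rule prefix_le_letter_swap_mono) (use w lv pn u_desc in \<open>auto simp: words_def\<close>)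
        then show ?thesis using letter_swap_invol [of p w] w pn vu by (simp add: words_def)
      qed
    next
      \<comment> \<open>\<open>?v\<close> lies strictly above \<open>?u\<close>, hence outside the
        support for \<open>?S\<close>. The relation at \<open>?v\<close> then loses its diagonal
        term and equates the leading coefficients up to \<open>?b\<close>.\<close>
      have "W (lam, h, ?S) ?v = 0"
      proof (rule ccontr)
        assume "\<not> ?thesis"
        from IH(1) [OF v this] have "prefix_le ?v ?u" .
        then have "prefix_height d ?v \<le> prefix_height d ?u" using lv by (intro prefix_height_mono) simp_all
        then show False using lt by simp
      qed
      then have "W (lam, h, ?S) ?u = ?b * W (lam, h, S) ?v"
        using T [OF v] v_asc uv by (simp add: hecke_apply_def)
      then show "W (lam, h, S) ?v \<noteq> 0" using IH(2) by auto
    qed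
  qed
qed

section \<open>Multiplicity matrices and their diagonality\<close>

lemma sw_intertwiner_block:
  assumes M: "uq_intertwiner q d (sw_index d n) (sw_uq V) (sw_index d n) (sw_uq V) M"
    and lam: "lam \<in> partitions n" "length lam \<le> d" "S \<in> SYT lam"
    and \<mu>: "\<mu> \<in> partitions n" "length \<mu> \<le> d" "S' \<in> SYT \<mu>"
  shows "uq_intertwiner q d (SSYT lam d) (V lam) (SSYT \<mu> d) (V \<mu>) (\<lambda>t s. M (lam, t, S) (\<mu>, s, S'))"
  unfolding uq_intertwiner_def meq_def
proof (intro ballI)
  fix g t s assume g: "g \<in> uq_gens q d" and t: "t \<in> SSYT lam d" and s: "s \<in> SSYT \<mu> d"
  have "((\<lambda>t s. M (lam, t, S) (\<mu>, s, S')) \<odot>\<^bsub>SSYT \<mu> d\<^esub> V \<mu> g) t s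
      = (\<Sum>r\<in>SSYT \<mu> d. M (lam, t, S) (\<mu>, r, S') * sw_uq V g (\<mu>, r, S') (\<mu>, s, S'))"
    by (simp add: mmul_def sw_uq_def)
  also have "\<dots> = (M \<odot>\<^bsub>sw_index d n\<^esub> sw_uq V g) (lam, t, S) (\<mu>, s, S')"
    unfolding mmul_def by (rule sum_sw_block [OF \<mu>, symmetric]) (auto simp: sw_uq_def)
  also have "\<dots> = (sw_uq V g \<odot>\<^bsub>sw_index d n\<^esub> M) (lam, t, S) (\<mu>, s, S')"
    using M g lam \<mu> t s by (simp add: uq_intertwiner_def meq_def sw_index_def)
  also have "\<dots> = (\<Sum>r\<in>SSYT lam d. sw_uq V g (lam, t, S) (lam, r, S) * M (lam, r, S) (\<mu>, s, S'))"
    unfolding mmul_def by (rule sum_sw_block [OF lam]) (auto simp: sw_uq_def)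
  also have "\<dots> = (V lam g \<odot>\<^bsub>SSYT lam d\<^esub> (\<lambda>t s. M (lam, t, S) (\<mu>, s, S'))) t s"
    by (simp add: mmul_def sw_uq_def)
  finally show "((\<lambda>t s. M (lam, t, S) (\<mu>, s, S')) \<odot>\<^bsub>SSYT \<mu> d\<^esub> V \<mu> g) t s
    = (V lam g \<odot>\<^bsub>SSYT lam d\<^esub> (\<lambda>t s. M (lam, t, S) (\<mu>, s, S'))) t s" .
qed

text \<open>Schur's lemma on each pair of blocks. The scalar is read off at the highest weight
  entry, which makes its independence of \<open>t\<close> explicit; unitarity supplies the adjoint
  intertwiner for blocks of different shape.\<close>

lemma sw_intertwiner_entries:
  assumes q: "q > 0" and V: "gtj_family q d V"
    and M: "uq_intertwiner q d (sw_index d n) (sw_uq V) (sw_index d n) (sw_uq V) M"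
    and U: "unitary_mat (sw_index d n) (sw_index d n) M"
    and a: "(lam, t, S) \<in> sw_index d n" and b: "(\<mu>, s, S') \<in> sw_index d n"
  shows "M (lam, t, S) (\<mu>, s, S')
    = (if lam = \<mu> \<and> t = s then M (lam, hw_tableau lam, S) (lam, hw_tableau lam, S') else 0)"
proof -
  have am: "lam \<in> partitions n" "length lam \<le> d" "S \<in> SYT lam" "t \<in> SSYT lam d" using a by (auto simp: sw_index_def)
  have bm: "\<mu> \<in> partitions n" "length \<mu> \<le> d" "S' \<in> SYT \<mu>" "s \<in> SSYT \<mu> d" using b by (auto simp: sw_index_def)
  let ?\<phi> = "\<lambda>t s. M (lam, t, S) (\<mu>, s, S')"
  have I: "uq_intertwiner q d (SSYT lam d) (V lam) (SSYT \<mu> d) (V \<mu>) ?\<phi>"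
    by (rule sw_intertwiner_block [OF M am(1-3) bm(1-3)])
  have M': "uq_intertwiner q d (sw_index d n) (sw_uq V) (sw_index d n) (sw_uq V) (madj M)"
    by (rule uq_intertwiner_madj [OF M U]) simp_all
  have I': "uq_intertwiner q d (SSYT \<mu> d) (V \<mu>) (SSYT lam d) (V lam) (madj ?\<phi>)"
    using sw_intertwiner_block [OF M' bm(1-3) am(1-3)] by (simp add: madj_def)
  note gA = gtj_family_irrep [OF V am(1,2)] and gB = gtj_family_irrep [OF V bm(1,2)]
  show ?thesis
  proof (cases "lam = \<mu>")
    case False
    then show ?thesis
      using gtj_intertwiner_zero [OF q gA am(1,2) gB bm(1,2) I I' am(4) bm(4)] by auto
  next
    case True
    obtain c where c: "\<forall>s\<in>SSYT lam d. \<forall>t\<in>SSYT lam d. M (lam, s, S) (lam, t, S') = (if s = t then c else 0)"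
      using gtj_intertwiner_scalar [OF q gA am(1,2)] I True by blast
    then show ?thesis using True am(4) bm(4) hw_tableau_SSYT [OF am(1,2)] by simp
  qed
qed

text \<open>Row \<open>b\<close> lies lower and is already known to be diagonal, so its
  orthogonality to row \<open>a\<close> isolates \<open>m a b * cnj (m b b)\<close>, where
  \<open>m b b\<close> has modulus 1.\<close>

lemma unitary_triangular_diagonal:
  fixes f :: "'a \<Rightarrow> nat" and m :: "('a, 'a) cmat"
  assumes fin: "finite A"
    and orth: "\<And>a b. a \<in> A \<Longrightarrow> b \<in> A \<Longrightarrow> (\<Sum>c\<in>A. m a c * cnj (m b c)) = (if a = b then 1 else 0)"
    and tri: "\<And>a b. a \<in> A \<Longrightarrow> b \<in> A \<Longrightarrow> m a b \<noteq> 0 \<Longrightarrow> b = a \<or> f b < f a"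
    and ab: "a \<in> A" "b \<in> A" "b \<noteq> a"
  shows "m a b = 0"
  using ab
proof (induction "f a" arbitrary: a b rule: less_induct)
  case (less a b)
  show ?case
  proof (rule ccontr)
    assume nz: "m a b \<noteq> 0"
    then have lt: "f b < f a" using tri less.prems by blast
    have row: "m b c = 0" if "c \<in> A" "c \<noteq> b" for c using less.hyps [OF lt] that less.prems by blast
    have *: "(\<Sum>c\<in>A. m x c * cnj (m b c)) = m x b * cnj (m b b)" for x
    proof -
      have "(\<Sum>c\<in>A. m x c * cnj (m b c)) = (\<Sum>c\<in>A. if c = b then m x b * cnj (m b b) else 0)"
        by (rule sum.cong) (auto simp: row)
      then show ?thesis using fin less.prems by simp
    qed
    have "m b b * cnj (m b b) = 1" using orth [of b b] * [of b] less.prems by simp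
    moreover have "m a b * cnj (m b b) = 0" using orth [of a b] * [of a] less.prems by simp
    ultimately show False using nz by auto
  qed
qed

theorem theorem5p3p1:
  fixes q :: real and n d :: nat
    and V :: "nat list \<Rightarrow> tableau rep"
    and P :: "nat list \<Rightarrow> (tableau, tableau \<times> nat) cmat"
    and W :: "(sw_label, nat list) cmat"
  assumes "q > 0" and "n \<ge> 1" and "d \<ge> 1"
    and "gtj_family q d V"
    and "\<And>m lam. lam \<in> partitions m \<Longrightarrow> length lam \<le> d \<Longrightarrow> pieri_transform q d V lam (P lam)"
    and "schur_weyl_transform q d n V W"
  shows "invertible_mat (sw_index d n) (words d n) (cascade d P (n - 1)) \<and>
    (\<forall>lam t S. lam \<in> partitions n \<longrightarrow> length lam \<le> d \<longrightarrow> t \<in> SSYT lam d \<longrightarrow> S \<in> SYT lam \<longrightarrow>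
      (\<exists>\<epsilon>\<in>{1, -1}. \<forall>w\<in>words d n.
        minv (sw_index d n) (words d n) (cascade d P (n - 1)) w (lam, t, S)
          = \<epsilon> * minv (sw_index d n) (words d n) W w (lam, t, S)))"
proof -
  note q = assms(1) and d = assms(3) and V = assms(4) and P = assms(5) and W = assms(6)
  let ?A = "sw_index d n" and ?B = "words d n"
  define C where "C = cascade d P (n - 1)"
  have n: "n = Suc (n - 1)" using assms(2) by simp
  have "unitary_mat (sw_index d (Suc (n - 1))) (words d (Suc (n - 1))) (cascade d P (n - 1)) \<and>
    uq_intertwiner q d (sw_index d (Suc (n - 1))) (sw_uq V) (words d (Suc (n - 1))) (word_rep q d (Suc (n - 1))) (cascade d P (n - 1))"
    by (rule cascade_props [OF d V]) (rule P)
  then have UC: "unitary_mat ?A ?B C" and IC: "uq_intertwiner q d ?A (sw_uq V) ?B (word_rep q d n) C"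
    unfolding C_def n [symmetric] by auto
  have realC: "C a w \<in> \<real>" if "a \<in> ?A" "w \<in> ?B" for a w
    using cascade_real [of d q V P a "n - 1" w] P that unfolding C_def n [symmetric] by blast
  have suppC: "prefix_le w (row_word S)" if "(lam, t, S) \<in> ?A" "w \<in> ?B" "C (lam, t, S) w \<noteq> 0" for lam t S w
    using cascade_support [OF d V q, of P lam t S "n - 1" w] P that unfolding C_def n [symmetric] by blast
  have UW: "unitary_mat ?A ?B W" and IW: "uq_intertwiner q d ?A (sw_uq V) ?B (word_rep q d n) W"
    and realW: "\<And>a w. a \<in> ?A \<Longrightarrow> w \<in> ?B \<Longrightarrow> W a w \<in> \<real>"
    using W by (auto simp: schur_weyl_transform_def real_mat_def)
  define M where "M = C \<odot>\<^bsub>?B\<^esub> madj W"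
  have UM: "unitary_mat ?A ?A M"
    unfolding M_def by (rule unitary_mmul [OF UC unitary_madj [OF UW]]) simp_all
  have IM: "uq_intertwiner q d ?A (sw_uq V) ?A (sw_uq V) M"
    unfolding M_def by (rule uq_intertwiner_mmul [OF IC uq_intertwiner_madj [OF IW UW]]) simp_all
  have CM: "meq ?A ?B C (M \<odot>\<^bsub>?A\<^esub> W)"
  proof -
    have "meq ?A ?B C (C \<odot>\<^bsub>?B\<^esub> mone)" by (rule meq_sym [OF mmul_mone]) simp
    also have "meq ?A ?B (C \<odot>\<^bsub>?B\<^esub> mone) (C \<odot>\<^bsub>?B\<^esub> (madj W \<odot>\<^bsub>?A\<^esub> W))"
      using UW by (intro meq_mmul [OF meq_refl]) (simp add: unitary_mat_def inverse_mat_def meq_def)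
    finally show ?thesis unfolding M_def mmul_assoc .
  qed
  have main: "\<exists>\<epsilon>\<in>{1, -1}. \<forall>w\<in>?B. C (lam, t, S) w = \<epsilon> * W (lam, t, S) w"
    if lam: "lam \<in> partitions n" "length lam \<le> d" and t: "t \<in> SSYT lam d" and S: "S \<in> SYT lam" for lam t S
  proof -
    define h where "h = hw_tableau lam"
    define m where "m = (\<lambda>S S'. M (lam, h, S) (lam, h, S'))"
    define f where "f = (\<lambda>S. prefix_height d (row_word S))"
    have h: "h \<in> SSYT lam d" unfolding h_def by (rule hw_tableau_SSYT [OF lam])
    have idx: "(lam, u, T) \<in> ?A" if "u \<in> SSYT lam d" "T \<in> SYT lam" for u T
      using lam that by (simp add: sw_index_def)
    have M_block: "M (lam, u, T) (\<mu>, s, T') = (if lam = \<mu> \<and> u = s then m T T' else 0)"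
      if "u \<in> SSYT lam d" "T \<in> SYT lam" "(\<mu>, s, T') \<in> ?A" for u T \<mu> s T'
      unfolding m_def h_def by (rule sw_intertwiner_entries [OF q V IM UM idx [OF that(1,2)] that(3)])
    have row: "C (lam, u, T) w = (\<Sum>T'\<in>SYT lam. m T T' * W (lam, u, T') w)"
      if "u \<in> SSYT lam d" "T \<in> SYT lam" "w \<in> ?B" for u T w
    proof -
      have "C (lam, u, T) w = (\<Sum>b\<in>?A. M (lam, u, T) b * W b w)"
        using CM idx that by (simp add: meq_def mmul_def)
      also have "\<dots> = (\<Sum>T'\<in>SYT lam. M (lam, u, T) (lam, u, T') * W (lam, u, T') w)"
        by (rule sum_sw_mult [OF lam that(1)]) (use M_block that in auto)
      also have "\<dots> = (\<Sum>T'\<in>SYT lam. m T T' * W (lam, u, T') w)"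
        by (rule sum.cong) (use M_block that idx in auto)
      finally show ?thesis .
    qed
    have orth: "(\<Sum>T\<in>SYT lam. m S1 T * cnj (m S2 T)) = (if S1 = S2 then 1 else 0)"
      if "S1 \<in> SYT lam" "S2 \<in> SYT lam" for S1 S2
    proof -
      have "(\<Sum>T\<in>SYT lam. m S1 T * cnj (m S2 T)) = (\<Sum>b\<in>?A. M (lam, h, S1) b * cnj (M (lam, h, S2) b))"
        unfolding m_def by (rule sum_sw_mult [OF lam h, symmetric]) (use M_block h that in auto)
      also have "\<dots> = mone (lam, h, S1) (lam, h, S2)"
        using UM idx [OF h] that by (simp add: unitary_mat_def inverse_mat_def meq_def mmul_def madj_def)
      finally show ?thesis by (simp add: mone_def)
    qed
    have W_supp: "prefix_le w (row_word T)" if "T \<in> SYT lam" "w \<in> ?B" "W (lam, h, T) w \<noteq> 0" for T w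
      using schur_weyl_triangular [OF q V W lam that(1)] that unfolding h_def by blast
    have W_lead: "W (lam, h, T) (row_word T) \<noteq> 0" if "T \<in> SYT lam" for T
      using schur_weyl_triangular [OF q V W lam that] unfolding h_def by blast
    have rw: "row_word T \<in> ?B" if "T \<in> SYT lam" for T by (rule row_word_words [OF that lam])
    have f_eq: "T = T'" if "T \<in> SYT lam" "T' \<in> SYT lam" "prefix_le (row_word T) (row_word T')" "f T' \<le> f T" for T T'
      using words_prefix_antisym [OF rw [OF that(1)] rw [OF that(2)] that(3)] that(4) row_word_inj [OF that(1,2)]
      unfolding f_def by blast
    have f_mono: "f T \<le> f T'" if "T \<in> SYT lam" "T' \<in> SYT lam" "prefix_le (row_word T) (row_word T')" for T T'
      unfolding f_def by (rule prefix_height_mono [OF that(3)]) (use rw that in \<open>simp add: words_def\<close>)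
    have tri: "S' = S \<or> f S' < f S" if S: "S \<in> SYT lam" and S': "S' \<in> SYT lam" "m S S' \<noteq> 0" for S S'
    proof -
      define Z where "Z = {T \<in> SYT lam. m S T \<noteq> 0}"
      \<comment> \<open>For \<open>T\<close> of maximal height in \<open>Z\<close>, only the term of
        \<open>T\<close> itself contributes at \<open>row_word T\<close>: any other would need a row
        word strictly above. So \<open>C\<close> does not vanish there, and its support bounds
        \<open>row_word T\<close> by \<open>row_word S\<close>.\<close>
      have top: "T = S \<or> f T < f S" if T: "T \<in> Z" and max: "\<And>T'. T' \<in> Z \<Longrightarrow> f T' \<le> f T" for T
      proof -
        have TS: "T \<in> SYT lam" and mT: "m S T \<noteq> 0" using T by (auto simp: Z_def)
        have "C (lam, h, S) (row_word T) = (\<Sum>T'\<in>SYT lam. m S T' * W (lam, h, T') (row_word T))"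
          by (rule row [OF h S rw [OF TS]])
        also have "\<dots> = (\<Sum>T'\<in>SYT lam. if T' = T then m S T * W (lam, h, T) (row_word T) else 0)"
        proof (rule sum.cong [OF refl])
          fix T' assume T': "T' \<in> SYT lam"
          show "m S T' * W (lam, h, T') (row_word T) = (if T' = T then m S T * W (lam, h, T) (row_word T) else 0)"
          proof (cases "m S T' = 0 \<or> W (lam, h, T') (row_word T) = 0")
            case False
            then have "f T' \<le> f T" using T' by (intro max) (simp add: Z_def)
            moreover have "prefix_le (row_word T) (row_word T')"
              using W_supp [OF T' rw [OF TS]] False by blast
            ultimately have "T = T'" using f_eq [OF TS T'] by blast
            then show ?thesis by simp
          qed (use mT W_lead [OF TS] in auto)
        qed
        also have "\<dots> = m S T * W (lam, h, T) (row_word T)" using TS by simp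
        finally have "C (lam, h, S) (row_word T) \<noteq> 0" using mT W_lead [OF TS] by simp
        then have le: "prefix_le (row_word T) (row_word S)" by (rule suppC [OF idx [OF h S] rw [OF TS]])
        show ?thesis using f_eq [OF TS S le] f_mono [OF TS S le] by linarith
      qed
      have "finite Z" "Z \<noteq> {}" using S' by (auto simp: Z_def)
      then obtain T where T: "T \<in> Z" "\<And>T'. T' \<in> Z \<Longrightarrow> f T' \<le> f T"
        using Max_in [of "f ` Z"] Max_ge [of "f ` Z"] by (metis (no_types, lifting) finite_imageI image_iff image_is_empty)
      have SZ: "S' \<in> Z" using S' by (simp add: Z_def)
      show ?thesis
      proof (rule ccontr)
        assume no: "\<not> ?thesis"
        \<comment> \<open>A violating \<open>S'\<close> would be at least as high as
          \<open>S\<close>, hence as \<open>T\<close>; it would then be of maximal height itself and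
          \<open>top\<close> would apply to it.\<close>
        have "f T \<le> f S" using top [OF T] by auto
        then have "f T' \<le> f S'" if "T' \<in> Z" for T' using no T(2) [OF that] by simp
        from top [OF SZ this] show False using no by blast
      qed
    qed
    have diag: "m S T = 0" if "T \<in> SYT lam" "T \<noteq> S" for T
      by (rule unitary_triangular_diagonal [of "SYT lam" m f, OF _ orth tri S that]) simp_all
    have CW: "C (lam, t, S) w = m S S * W (lam, t, S) w" if w: "w \<in> ?B" for w
    proof -
      have "C (lam, t, S) w = (\<Sum>T\<in>SYT lam. if T = S then m S S * W (lam, t, S) w else 0)"
        unfolding row [OF t S w] by (rule sum.cong) (auto simp: diag)
      then show ?thesis using S by simp
    qed
    have "m S S * cnj (m S S) = 1"
    proof -
      have "(\<Sum>T\<in>SYT lam. m S T * cnj (m S T)) = (\<Sum>T\<in>SYT lam. if T = S then m S S * cnj (m S S) else 0)"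
        by (rule sum.cong) (auto simp: diag)
      then show ?thesis using orth [OF S S] S by simp
    qed
    moreover have "m S S \<in> \<real>"
      unfolding m_def M_def mmul_def madj_def
      using realC realW idx [OF h S] by (intro sum_in_Reals Reals_mult) (auto simp: Reals_cnj_iff)
    ultimately have "(m S S)\<^sup>2 = 1" by (simp add: power2_eq_square Reals_cnj_iff)
    then have "m S S \<in> {1, -1}" by (simp add: power2_eq_1_iff)
    then show ?thesis using CW by blast
  qed
  have invC: "inverse_mat ?A ?B C (madj C)" and invW: "inverse_mat ?A ?B W (madj W)"
    using UC UW by (simp_all add: unitary_mat_def)
  show ?thesis
    unfolding C_def [symmetric]
  proof (intro conjI allI impI)
    show "invertible_mat ?A ?B C" using invC by (auto simp: invertible_mat_def)
    fix lam t S
    assume "lam \<in> partitions n" "length lam \<le> d" "t \<in> SSYT lam d" "S \<in> SYT lam"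
    then have idx: "(lam, t, S) \<in> ?A" and "\<exists>\<epsilon>\<in>{1, -1}. \<forall>w\<in>?B. C (lam, t, S) w = \<epsilon> * W (lam, t, S) w"
      using main by (simp_all add: sw_index_def)
    then obtain \<epsilon> where \<epsilon>: "\<epsilon> \<in> {1, -1}" "\<forall>w\<in>?B. C (lam, t, S) w = \<epsilon> * W (lam, t, S) w" by blast
    \<comment> \<open>Both inverses are adjoints, and a real sign survives conjugation.\<close>
    have "minv ?A ?B C w (lam, t, S) = \<epsilon> * minv ?A ?B W w (lam, t, S)" if w: "w \<in> ?B" for w
      using minv_eq [OF invC _ _ w idx] minv_eq [OF invW _ _ w idx] \<epsilon> w by (auto simp: madj_def)
    then show "\<exists>\<epsilon>\<in>{1, -1}. \<forall>w\<in>?B. minv ?A ?B C w (lam, t, S) = \<epsilon> * minv ?A ?B W w (lam, t, S)"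
      using \<epsilon>(1) by blast
  qed
qed

end
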